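(* Let $p$ be a prime, let $F$ be a non-archimedean local field of residue characteristic $p$ with ring of integers $\mathcal{O}_F$ and residue field $k_F$ of cardinality $q=p^{e}$. Set $G_S=\mathrm{SL}_2(F)$ and $K_0=\mathrm{SL}_2(\mathcal{O}_F)$. Let $\vec r=(r_0,\dots,r_{e-1})\in\{0,\dots,p-1\}^{e}$ and let $\sigma_{\vec r}$ be the associated smooth irreducible $\bar{\mathbb{F}}_p$-representation $\mathrm{Sym}^{\vec r}\,\bar{\mathbb{F}}_p^2$ of $K_0$. Then the compactly induced representation $\mathrm{ind}_{K_0}^{G_S}(\sigma_{\vec r})$ is a free module of infinite rank over the spherical Hecke algebra $\mathcal{H}(G_S,K_0,\sigma_{\vec r})=\mathrm{End}_{G_S}\big(\mathrm{ind}_{K_0}^{G_S}(\sigma_{\vec r})\big)$.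
   Context: $\bar{\mathbb{F}}_p$ is a fixed algebraic closure of $\mathbb{F}_p$, and all representations are over $\bar{\mathbb{F}}_p$. Fix an embedding $k_F=\mathbb{F}_q\subset\bar{\mathbb{F}}_p$. Weights: for $\vec r=(r_0,\dots,r_{e-1})\in\{0,\dots,p-1\}^e$, $\sigma_{\vec r}=\mathrm{Sym}^{\vec r}\,\bar{\mathbb{F}}_p^2:=\mathrm{Sym}^{r_0}\bar{\mathbb{F}}_p^2\otimes\cdots\otimes\mathrm{Sym}^{r_{e-1}}\bar{\mathbb{F}}_p^2$, where $\mathrm{Sym}^{r_i}\bar{\mathbb{F}}_p^2=\bigoplus_{l=0}^{r_i}\bar{\mathbb{F}}_pX^{r_i-l}Y^l$ and $\begin{pmatrix}a&b\\c&d\end{pmatrix}\in\mathrm{SL}_2(\mathbb{F}_q)$ acts on the $i$-th factor by $X^{r_i-l}Y^l\mapsto(a^{p^i}X+c^{p^i}Y)^{r_i-l}(b^{p^i}X+d^{p^i}Y)^l$. The group $K_0$ acts on $\sigma_{\vec r}$ through the reduction map $K_0\to\mathrm{SL}_2(k_F)=\mathrm{SL}_2(\mathbb{F}_q)$. (The $\sigma_{\vec r}$ are precisely the smooth irreducible $\bar{\mathbb{F}}_p$-representations of $K_0$.) Compact induction: $\mathrm{ind}_{K_0}^{G_S}(\sigma_{\vec r})$ is the space of functions $f:G_S\to\sigma_{\vec r}$ with $f(kg)=\sigma_{\vec r}(k)f(g)$ for all $k\in K_0$, $g\in G_S$, whose support is a finite union of cosets $K_0g$; $G_S$ acts by $(g\cdot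 f)(g')=f(g'g)$. The Hecke algebra $\mathcal{H}(G_S,K_0,\sigma_{\vec r})$ is the algebra of $G_S$-equivariant $\bar{\mathbb{F}}_p$-linear endomorphisms of $\mathrm{ind}_{K_0}^{G_S}(\sigma_{\vec r})$, and $\mathrm{ind}_{K_0}^{G_S}(\sigma_{\vec r})$ is a left module over it by evaluation. (This algebra is a polynomial algebra in one variable over $\bar{\mathbb{F}}_p$.) *)

theory Defs
  imports "HOL-Analysis.Analysis" "HOL-Algebra.Algebraic_Closure_Type"
begin

section \<open>Non-archimedean local fields\<close>

definition valuation_ring :: "('f::field \<Rightarrow> real) \<Rightarrow> 'f ring" where
  "valuation_ring av = ring_of_type_algebra\<lparr>carrier := {x. av x \<le> 1}\<rparr>"

definition max_ideal :: "('f::field \<Rightarrow> real) \<Rightarrow> 'f set" where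
  "max_ideal av = {x. av x < 1}"

definition residue_field :: "('f::field \<Rightarrow> real) \<Rightarrow> 'f set ring" where
  "residue_field av = valuation_ring av Quot max_ideal av"

text \<open>A field that is complete for a discrete valuation and has finite residue field.  The
  valuation is written multiplicatively, as an absolute value whose value group is infinite
  cyclic; both characteristics are allowed.\<close>

locale nonarch_local_field =
  fixes av :: "'f::field \<Rightarrow> real"
  assumes av_nonneg: "av x \<ge> 0"
    and av_eq_0_iff: "av x = 0 \<longleftrightarrow> x = 0"
    and av_mult: "av (x * y) = av x * av y"
    and av_add: "av (x + y) \<le> max (av x) (av y)"
    and discrete: "\<exists>c. 0 < c \<and> c < 1 \<and> av ` (UNIV - {0}) = range (\<lambda>n::int. c powi n)"
    and complete: "Metric_space.mcomplete UNIV (\<lambda>x y. av (x - y))"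
    and finite_residue_field: "finite (carrier (residue_field av))"

section \<open>Special linear groups and weights\<close>

definition SL2 :: "'a::comm_ring_1 set \<Rightarrow> ('a^2^2) set" where
  "SL2 S = {A. (\<forall>i j. A $ i $ j \<in> S) \<and> det A = 1}"

text \<open>Reduction of a matrix modulo the maximal ideal, followed by the embedding \<open>\<iota>\<close> of the residue
  field into the coefficient field.\<close>

definition reduction :: "('f::field \<Rightarrow> real) \<Rightarrow> ('f set \<Rightarrow> 'k) \<Rightarrow> 'f^2^2 \<Rightarrow> 'k^2^2" where
  "reduction av \<iota> A = (\<chi> i j. \<iota> (max_ideal av +>\<^bsub>valuation_ring av\<^esub> (A $ i $ j)))"

definition frob_matrix :: "nat \<Rightarrow> nat \<Rightarrow> 'k::field^2^2 \<Rightarrow> 'k^2^2" where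
  "frob_matrix p i A = (\<chi> j l. (A $ j $ l) ^ (p ^ i))"

text \<open>Polynomials in \<open>X\<close> and \<open>Y\<close> are polynomials in \<open>Y\<close> over \<open>k[X]\<close>.  \<open>sym_coeff n A l m\<close> is the
  coefficient of \<open>X^(n-m) Y^m\<close> in the image \<open>(aX+cY)^(n-l) (bX+dY)^l\<close> of \<open>X^(n-l) Y^l\<close> under
  \<open>A = (a b; c d)\<close>.\<close>

definition linear_form :: "'k::field \<Rightarrow> 'k \<Rightarrow> 'k poly poly" where
  "linear_form u v = [:[:0, u:], [:v:]:]"

definition sym_coeff :: "nat \<Rightarrow> 'k::field^2^2 \<Rightarrow> nat \<Rightarrow> nat \<Rightarrow> 'k" where
  "sym_coeff n A l m =
     Polynomial.coeff (Polynomial.coeff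
       (linear_form (A$1$1) (A$2$1) ^ (n - l) * linear_form (A$1$2) (A$2$2) ^ l) m) (n - m)"

text \<open>The tensor product over \<open>i < e\<close> of the spaces \<open>Sym^(r i)\<close> has the basis
  \<open>\<Otimes>i<e. X^(r i - l i) Y^(l i)\<close>, indexed by the tuples \<open>l\<close> with \<open>l i \<le> r i\<close>; a vector is the
  family of its coordinates, and an element of \<open>SL2\<close> acts as the tensor product of its
  Frobenius-twisted actions on the factors.\<close>

definition weight_index :: "nat \<Rightarrow> (nat \<Rightarrow> nat) \<Rightarrow> (nat \<Rightarrow> nat) set" where
  "weight_index e r = (\<Pi>\<^sub>E i\<in>{..<e}. {..r i})"

definition weight_space :: "nat \<Rightarrow> (nat \<Rightarrow> nat) \<Rightarrow> ((nat \<Rightarrow> nat) \<Rightarrow> 'k::field) set" where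
  "weight_space e r = {w. \<forall>l. l \<notin> weight_index e r \<longrightarrow> w l = 0}"

definition weight_action ::
    "nat \<Rightarrow> nat \<Rightarrow> (nat \<Rightarrow> nat) \<Rightarrow> 'k::field^2^2 \<Rightarrow> ((nat \<Rightarrow> nat) \<Rightarrow> 'k) \<Rightarrow> (nat \<Rightarrow> nat) \<Rightarrow> 'k" where
  "weight_action p e r A w =
     (\<lambda>m. if m \<in> weight_index e r
          then (\<Sum>l\<in>weight_index e r.
                  w l * (\<Prod>i<e. sym_coeff (r i) (frob_matrix p i A) (l i) (m i)))
          else 0)"

section \<open>Compact induction and its endomorphism algebra\<close>

text \<open>The representation space \<open>V\<close> consists of coordinate families; functions on the group \<open>G\<close> of
  matrices are extended by zero to all matrices.\<close>

definition compact_ind ::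
    "('f::field^2^2) set \<Rightarrow> ('f^2^2) set \<Rightarrow> ('i \<Rightarrow> 'k::field) set \<Rightarrow> ('f^2^2 \<Rightarrow> ('i \<Rightarrow> 'k) \<Rightarrow> 'i \<Rightarrow> 'k) \<Rightarrow>
     ('f^2^2 \<Rightarrow> 'i \<Rightarrow> 'k) set" where
  "compact_ind G K V \<sigma> =
     {f. (\<forall>g. g \<notin> G \<longrightarrow> f g = (\<lambda>_. 0)) \<and>
         (\<forall>g\<in>G. f g \<in> V) \<and>
         (\<forall>k\<in>K. \<forall>g\<in>G. f (k ** g) = \<sigma> k (f g)) \<and>
         (\<exists>S\<subseteq>G. finite S \<and> {g\<in>G. f g \<noteq> (\<lambda>_. 0)} = (\<Union>g\<in>S. (\<lambda>k. k ** g) ` K))}"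

definition right_translate :: "'f::field^2^2 \<Rightarrow> ('f^2^2 \<Rightarrow> 'v) \<Rightarrow> 'f^2^2 \<Rightarrow> 'v" where
  "right_translate g f = (\<lambda>g'. f (g' ** g))"

text \<open>The \<open>G\<close>-equivariant linear endomorphisms of \<open>I\<close>; as functions they are \<open>undefined\<close> outside
  \<open>I\<close>, so that equality is equality on \<open>I\<close>.\<close>

definition End_ring ::
    "('f::field^2^2) set \<Rightarrow> ('f^2^2 \<Rightarrow> 'i \<Rightarrow> 'k::field) set \<Rightarrow>
     (('f^2^2 \<Rightarrow> 'i \<Rightarrow> 'k) \<Rightarrow> 'f^2^2 \<Rightarrow> 'i \<Rightarrow> 'k) ring" where
  "End_ring G I =
     \<lparr>carrier =
        {T \<in> I \<rightarrow>\<^sub>E I.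
           (\<forall>f\<in>I. \<forall>f'\<in>I. T (\<lambda>g i. f g i + f' g i) = (\<lambda>g i. T f g i + T f' g i)) \<and>
           (\<forall>c. \<forall>f\<in>I. T (\<lambda>g i. c * f g i) = (\<lambda>g i. c * T f g i)) \<and>
           (\<forall>g\<in>G. \<forall>f\<in>I. T (right_translate g f) = right_translate g (T f))},
      monoid.mult = (\<lambda>S T. compose I S T),
      one = (\<lambda>f\<in>I. f),
      ring.zero = (\<lambda>f\<in>I. \<lambda>g i. 0),
      add = (\<lambda>S T. \<lambda>f\<in>I. \<lambda>g i. S f g i + T f g i)\<rparr>"

text \<open>\<open>I\<close> as a left module over its endomorphisms by evaluation.  The fields \<open>mult\<close> and \<open>one\<close> of the
  record carry no meaning for a module.\<close>

definition evaluation_module ::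
    "('f::field^2^2 \<Rightarrow> 'i \<Rightarrow> 'k::field) set \<Rightarrow>
     (('f^2^2 \<Rightarrow> 'i \<Rightarrow> 'k) \<Rightarrow> 'f^2^2 \<Rightarrow> 'i \<Rightarrow> 'k, 'f^2^2 \<Rightarrow> 'i \<Rightarrow> 'k) module" where
  "evaluation_module I =
     \<lparr>carrier = I,
      monoid.mult = undefined,
      one = undefined,
      ring.zero = (\<lambda>g i. 0),
      add = (\<lambda>f f'. \<lambda>g i. f g i + f' g i),
      smult = (\<lambda>T f. T f)\<rparr>"

definition ind_weight ::
    "('f::field \<Rightarrow> real) \<Rightarrow> ('f set \<Rightarrow> 'k::field) \<Rightarrow> nat \<Rightarrow> nat \<Rightarrow> (nat \<Rightarrow> nat) \<Rightarrow>
     ('f^2^2 \<Rightarrow> (nat \<Rightarrow> nat) \<Rightarrow> 'k) set" where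
  "ind_weight av \<iota> p e r =
     compact_ind (SL2 UNIV) (SL2 (carrier (valuation_ring av)))
       (weight_space e r) (\<lambda>k. weight_action p e r (reduction av \<iota> k))"

definition hecke_algebra ::
    "('f::field \<Rightarrow> real) \<Rightarrow> ('f set \<Rightarrow> 'k::field) \<Rightarrow> nat \<Rightarrow> nat \<Rightarrow> (nat \<Rightarrow> nat) \<Rightarrow>
     (('f^2^2 \<Rightarrow> (nat \<Rightarrow> nat) \<Rightarrow> 'k) \<Rightarrow> 'f^2^2 \<Rightarrow> (nat \<Rightarrow> nat) \<Rightarrow> 'k) ring" where
  "hecke_algebra av \<iota> p e r = End_ring (SL2 UNIV) (ind_weight av \<iota> p e r)"

section \<open>Free modules\<close>

text \<open>The library's \<open>module\<close> requires a commutative ring, which an endomorphism ring is not by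
  definition.\<close>

locale left_module = R?: ring R + M?: abelian_group M
  for R :: "('a, 'c) ring_scheme" (structure) and M :: "('a, 'b, 'd) module_scheme" (structure) +
  assumes smult_closed: "\<lbrakk>a \<in> carrier R; x \<in> carrier M\<rbrakk> \<Longrightarrow> a \<odot>\<^bsub>M\<^esub> x \<in> carrier M"
    and smult_l_distr: "\<lbrakk>a \<in> carrier R; b \<in> carrier R; x \<in> carrier M\<rbrakk> \<Longrightarrow>
      (a \<oplus>\<^bsub>R\<^esub> b) \<odot>\<^bsub>M\<^esub> x = a \<odot>\<^bsub>M\<^esub> x \<oplus>\<^bsub>M\<^esub> b \<odot>\<^bsub>M\<^esub> x"
    and smult_r_distr: "\<lbrakk>a \<in> carrier R; x \<in> carrier M; y \<in> carrier M\<rbrakk> \<Longrightarrow>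
      a \<odot>\<^bsub>M\<^esub> (x \<oplus>\<^bsub>M\<^esub> y) = a \<odot>\<^bsub>M\<^esub> x \<oplus>\<^bsub>M\<^esub> a \<odot>\<^bsub>M\<^esub> y"
    and smult_assoc: "\<lbrakk>a \<in> carrier R; b \<in> carrier R; x \<in> carrier M\<rbrakk> \<Longrightarrow>
      (a \<otimes>\<^bsub>R\<^esub> b) \<odot>\<^bsub>M\<^esub> x = a \<odot>\<^bsub>M\<^esub> (b \<odot>\<^bsub>M\<^esub> x)"
    and smult_one: "x \<in> carrier M \<Longrightarrow> \<one>\<^bsub>R\<^esub> \<odot>\<^bsub>M\<^esub> x = x"

definition module_basis :: "('a, 'c) ring_scheme \<Rightarrow> ('a, 'b, 'd) module_scheme \<Rightarrow> 'b set \<Rightarrow> bool" where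
  "module_basis R M B \<longleftrightarrow>
     B \<subseteq> carrier M \<and>
     (\<forall>x\<in>carrier M. \<exists>S c. finite S \<and> S \<subseteq> B \<and> c \<in> S \<rightarrow> carrier R \<and>
        x = (\<Oplus>\<^bsub>M\<^esub>b\<in>S. c b \<odot>\<^bsub>M\<^esub> b)) \<and>
     (\<forall>S c. finite S \<longrightarrow> S \<subseteq> B \<longrightarrow> c \<in> S \<rightarrow> carrier R \<longrightarrow>
        (\<Oplus>\<^bsub>M\<^esub>b\<in>S. c b \<odot>\<^bsub>M\<^esub> b) = \<zero>\<^bsub>M\<^esub> \<longrightarrow> (\<forall>b\<in>S. c b = \<zero>\<^bsub>R\<^esub>))"

definition free_of_infinite_rank :: "('a, 'c) ring_scheme \<Rightarrow> ('a, 'b, 'd) module_scheme \<Rightarrow> bool" where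
  "free_of_infinite_rank R M \<longleftrightarrow> left_module R M \<and> (\<exists>B. module_basis R M B \<and> infinite B)"

end

theory Submission
  imports Defs "HOL-Library.Function_Algebras"
begin

text \<open>
The group \<open>G = SL2(F)\<close> acts on the vertices \<open>K g\<close> in \<open>K \ G\<close> of one type of the tree of \<open>SL2(F)\<close>, and an
element of the compactly induced representation is a finitely supported section over these vertices with
values in the weight \<open>V\<close>.  With \<open>\<pi>\<close> a uniformizer and \<open>torus n = diag(\<pi>^-n, \<pi>^n)\<close>, the vertex \<open>K g\<close> lies at
distance \<open>n = deg g\<close> from the origin if \<open>g \<in> K torus(n) K\<close>; this filters the representation by the subspaces
\<open>filt n\<close> of sections supported at distance less than \<open>n\<close>.  Vertices at relative distance \<open>1\<close> in this sense are
called neighbours; in the tree they are two edges apart.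

Let \<open>T\<close> be the Hecke operator of the double coset of \<open>torus 1\<close>.  It raises the degree by at most one, and the
point is that it raises it by exactly one (\<open>T_strict\<close>).  At a vertex of distance \<open>n + 1\<close> only one neighbour is
closer to the origin (\<open>descending_neighbour\<close>), so the leading part of \<open>T f\<close> at the vertex of
\<open>torus (n + 1) k\<close> is just the coordinate of \<open>f (torus n k)\<close> at the highest weight vector \<open>X^r\<close>
(\<open>T_outermost\<close>).  Letting the vertex vary around a fixed neighbour with value \<open>w\<close>, one sees that coordinate for all
translates of \<open>w\<close> by upper unipotent elements.  For the parameter \<open>b\<close> in the residue field it is the sum of
\<open>w l * b^(l 0 + l 1 * p + ... )\<close> over the multi-indices \<open>l\<close>: a polynomial in \<open>b\<close> of degree less than \<open>q\<close> in which, by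
uniqueness of base \<open>p\<close> digits, no two coordinates of \<open>w\<close> share an exponent.  As it has \<open>q\<close> zeros if all these
coordinates vanish, \<open>w = 0\<close>.

Strictness makes the representation a free \<open>k[T]\<close>-module by linear algebra alone: choosing in every degree a
complement of what is reached from lower degrees yields a basis (locale \<open>strict_filtration\<close>).  The basis is
infinite since the leading part of an element of the image of \<open>T\<close> takes the same value at all vertices that are
reached from the same neighbour through the same vertex of the other type, so that a section supported at a single vertex is never such a
leading part (\<open>not_descent\<close>).

It remains to see that every equivariant endomorphism \<open>S\<close> is a polynomial in \<open>T\<close> (\<open>hecke_polynomial\<close>).  It is
determined by its values on the sections \<open>delta v\<close> supported at the origin.  The map \<open>v \<mapsto> S (delta v) (torus n)\<close>
intertwines enough unipotent elements to be a scalar multiple of the one for \<open>T^n\<close> (\<open>hecke_leading_scalar\<close>): its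
image is fixed by the upper unipotent elements and it factors through the coinvariants of the lower ones, and both
of these are lines by the same polynomial argument.  Subtracting that multiple of \<open>T^n\<close> from the top degree downwards
exhausts \<open>S\<close>.
\<close>

no_notation fps_nth (infixl "$" 75)
hide_const (open) Polynomials.degree up_ring.coeff up_ring.monom Module.module.smult

section \<open>Bases from strict filtrations\<close>

text \<open>An operator that raises the degree of every nonzero vector by exactly one, for a filtration that starts with
  \<open>0\<close>.  It makes the union of the filtration a free module over the polynomials in \<open>T\<close>: a basis is obtained by
  choosing, in every degree, a complement of what lower degrees and their images under \<open>T\<close> contribute.\<close>

locale strict_filtration = vector_space scale
  for scale :: "'a::field \<Rightarrow> 'b::ab_group_add \<Rightarrow> 'b" (infixr "*\<^sub>v" 75) +
  fixes A :: "nat \<Rightarrow> 'b set" and T :: "'b \<Rightarrow> 'b"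
  assumes A_subspace: "subspace (A n)"
    and A_0: "A 0 = {0}"
    and A_Suc: "A n \<subseteq> A (Suc n)"
    and T_add: "T (x + y) = T x + T y"
    and T_scale: "T (c *\<^sub>v x) = c *\<^sub>v T x"
    and T_A: "x \<in> A n \<Longrightarrow> T x \<in> A (Suc n)"
    and T_strict: "x \<in> A m \<Longrightarrow> T x \<in> A (Suc n) \<Longrightarrow> x \<in> A n"
begin

lemma A_mono: "m \<le> n \<Longrightarrow> A m \<subseteq> A n"
  by (rule lift_Suc_mono_le[of A, OF A_Suc])

lemma T_0: "T 0 = 0" and T_minus: "T (- x) = - T x"
  using T_scale[of 0 0] T_scale[of "- 1" x] by simp_all

lemma T_sum: "T (sum f S) = (\<Sum>x\<in>S. T (f x))"
proof (induction S rule: infinite_finite_induct)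
  case (insert x S) then show ?case by (simp add: T_add)
qed (simp_all add: T_0)

text \<open>The part of degree \<open>n\<close> that is already accounted for by lower degrees.\<close>

definition descent :: "nat \<Rightarrow> 'b set" where
  "descent n = {x + T y | x y. x \<in> A n \<and> y \<in> A n}"

lemma descent_subspace: "subspace (descent n)"
proof (rule subspaceI)
  have "0 + T 0 \<in> descent n"
    unfolding descent_def using subspace_0[OF A_subspace] by force
  then show "0 \<in> descent n"
    by (simp add: T_0)
next
  fix u v assume "u \<in> descent n" "v \<in> descent n"
  then obtain x y x' y' where "u = x + T y" "v = x' + T y'" "x \<in> A n" "y \<in> A n" "x' \<in> A n" "y' \<in> A n"
    unfolding descent_def by blast
  moreover from this have "u + v = (x + x') + T (y + y')" by (simp add: T_add algebra_simps)
  ultimately show "u + v \<in> descent n"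
    unfolding descent_def using subspace_add[OF A_subspace] by blast
next
  fix c u assume "u \<in> descent n"
  then obtain x y where "u = x + T y" "x \<in> A n" "y \<in> A n" unfolding descent_def by blast
  moreover from this have "c *\<^sub>v u = c *\<^sub>v x + T (c *\<^sub>v y)" by (simp add: T_scale scale_right_distrib)
  ultimately show "c *\<^sub>v u \<in> descent n"
    unfolding descent_def using subspace_scale[OF A_subspace] by blast
qed

lemma A_descent: "A n \<subseteq> descent n"
  unfolding descent_def using subspace_0[OF A_subspace] T_scale[of 0 0] by force

lemma descent_A: "descent n \<subseteq> A (Suc n)"
  unfolding descent_def using A_Suc T_A subspace_add[OF A_subspace] by blast

lemma complement_exists:
  "\<exists>C. C \<subseteq> A (Suc n) \<and> independent C \<and> span C \<inter> descent n = {0} \<and>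
       (\<forall>x\<in>A (Suc n). \<exists>u\<in>span C. \<exists>v\<in>descent n. x = u + v)"
proof -
  obtain D where D: "D \<subseteq> descent n" "independent D" "span D = descent n"
    using maximal_independent_subset[of "descent n"] span_subspace descent_subspace by metis
  obtain E where E: "D \<subseteq> E" "E \<subseteq> A (Suc n)" "independent E" "A (Suc n) \<subseteq> span E"
    using maximal_independent_subset_extend[of D "A (Suc n)"] D descent_A by blast
  have "span (E - D) \<inter> span D = {0}"
  proof -
    have "x = 0" if x: "x \<in> span (E - D)" "x \<in> span D" for x
    proof -
      have "representation E x = representation (E - D) x"
        using representation_extend[of E x "E - D"] E x by auto
      moreover have "representation E x = representation D x"
        using representation_extend[of E x D] E x by auto
      ultimately have "representation E x b = 0" for b
        using representation_ne_zero[of "E - D" x b] representation_ne_zero[of D x b] by auto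
      moreover have "x \<in> span E" using x E span_mono by blast
      ultimately show "x = 0"
        using sum_nonzero_representation_eq[OF E(3)] by fastforce
    qed
    then show ?thesis using span_zero by blast
  qed
  moreover have "\<exists>u\<in>span (E - D). \<exists>v\<in>descent n. x = u + v" if "x \<in> A (Suc n)" for x
  proof -
    have "x \<in> span ((E - D) \<union> D)" using that E(1,4) by (auto simp: Un_absorb2)
    then show ?thesis unfolding span_Un D(3) by blast
  qed
  ultimately show ?thesis
    using E D independent_mono[of E "E - D"] by (intro exI[of _ "E - D"]) auto
qed

definition layer :: "nat \<Rightarrow> 'b set" where
  "layer n = (SOME C. C \<subseteq> A (Suc n) \<and> independent C \<and> span C \<inter> descent n = {0} \<and>
       (\<forall>x\<in>A (Suc n). \<exists>u\<in>span C. \<exists>v\<in>descent n. x = u + v))"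

definition free_basis :: "'b set" where "free_basis = (\<Union>n. layer n)"

lemma layer:
  "layer n \<subseteq> A (Suc n)" "independent (layer n)" "span (layer n) \<inter> descent n = {0}"
  "x \<in> A (Suc n) \<Longrightarrow> \<exists>u\<in>span (layer n). \<exists>v\<in>descent n. x = u + v"
proof -
  note C = someI_ex[OF complement_exists[of n], folded layer_def]
  show "layer n \<subseteq> A (Suc n)" "independent (layer n)" "span (layer n) \<inter> descent n = {0}"
    using C by blast+
  show "\<exists>u\<in>span (layer n). \<exists>v\<in>descent n. x = u + v" if "x \<in> A (Suc n)"
    using C that by blast
qed

lemma layer_not_A:
  assumes "b \<in> layer n"
  shows "b \<notin> A n"
proof
  assume "b \<in> A n"
  then have "b \<in> span (layer n) \<inter> descent n" using A_descent assms span_base by blast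
  then have "b = 0" using layer(3) by blast
  then show False using layer(2) dependent_zero assms by blast
qed

lemma free_basis_subset: "free_basis \<subseteq> (\<Union>n. A n)"
  unfolding free_basis_def using layer(1) by blast

text \<open>Strictness bounds the degree of a preimage \<open>h\<close> of a linear combination by that of the combination,
  so the part of the combination in the highest layer would lie in \<open>descent\<close>, to which the layer is complementary.\<close>

lemma independent_mod_image:
  assumes S: "finite S" "S \<subseteq> free_basis" and h: "h \<in> A m"
    and eq: "(\<Sum>b\<in>S. c b *\<^sub>v b) = T h" and b: "b \<in> S"
  shows "c b = 0"
proof (rule ccontr)
  assume "c b \<noteq> 0"
  define S' where "S' = {b\<in>S. c b \<noteq> 0}"
  have S': "finite S'" "b \<in> S'" using S b \<open>c b \<noteq> 0\<close> by (auto simp: S'_def)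
  have "\<exists>n. x \<in> layer n" if "x \<in> S'" for x using that S by (auto simp: S'_def free_basis_def)
  then obtain d where d: "\<And>x. x \<in> S' \<Longrightarrow> x \<in> layer (d x)" by metis
  \<comment> \<open>the highest layer that occurs in the combination\<close>
  define n where "n = Max (d ` S')"
  have dn: "d x \<le> n" if "x \<in> S'" for x using that S' by (auto simp: n_def)
  have "n \<in> d ` S'" unfolding n_def using S' by (intro Max_in) auto
  then obtain b0 where b0: "b0 \<in> S'" "d b0 = n" by blast
  have eq': "(\<Sum>b\<in>S'. c b *\<^sub>v b) = T h"
    unfolding eq[symmetric] S'_def using S by (intro sum.mono_neutral_left) auto
  have inA: "x \<in> A (Suc n)" if "x \<in> S'" for x
    using layer(1)[of "d x"] d[OF that] A_mono[of "Suc (d x)" "Suc n"] dn[OF that] by auto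
  have "T h \<in> A (Suc n)"
    unfolding eq'[symmetric] by (intro subspace_sum[OF A_subspace] subspace_scale[OF A_subspace] inA)
  then have hn: "h \<in> A n" using T_strict h by blast
  define U where "U = {b\<in>S'. d b = n}"
  have split: "(\<Sum>b\<in>S'. c b *\<^sub>v b) = (\<Sum>b\<in>U. c b *\<^sub>v b) + (\<Sum>b\<in>S' - U. c b *\<^sub>v b)"
    by (subst add.commute, rule sum.subset_diff) (auto simp: U_def S')
  have low: "(\<Sum>b\<in>S' - U. c b *\<^sub>v b) \<in> A n"
  proof (intro subspace_sum[OF A_subspace] subspace_scale[OF A_subspace])
    fix x assume "x \<in> S' - U"
    then have "x \<in> S'" "Suc (d x) \<le> n" using dn[of x] by (auto simp: U_def)
    then show "x \<in> A n" using layer(1)[of "d x"] d[of x] A_mono[of "Suc (d x)" n] by auto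
  qed
  have "(\<Sum>b\<in>U. c b *\<^sub>v b) = (- 1 :: 'a) *\<^sub>v (\<Sum>b\<in>S' - U. c b *\<^sub>v b) + T h"
    using eq' split by (simp add: algebra_simps)
  then have "(\<Sum>b\<in>U. c b *\<^sub>v b) \<in> descent n"
    unfolding descent_def using hn subspace_scale[OF A_subspace low] by blast
  moreover have U: "U \<subseteq> layer n" "finite U" "b0 \<in> U"
  proof -
    have "x \<in> layer n" if "x \<in> U" for x using d[of x] that by (auto simp: U_def)
    then show "U \<subseteq> layer n" by blast
  qed (use S' b0 in \<open>auto simp: U_def\<close>)
  moreover have "(\<Sum>b\<in>U. c b *\<^sub>v b) \<in> span (layer n)"
    using U by (intro span_sum span_scale span_base) auto
  ultimately have "(\<Sum>b\<in>U. c b *\<^sub>v b) = 0" using layer(3)[of n] by blast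
  then have "c b0 = 0" using layer(2)[of n] U unfolding independent_explicit_module by blast
  then show False using b0 by (auto simp: S'_def)
qed

lemma T_inj: "x \<in> A m \<Longrightarrow> T x = 0 \<Longrightarrow> x = 0"
  using T_strict[of x m 0] A_0 subspace_0[OF A_subspace] by auto

lemma T_funpow_A: "x \<in> A n \<Longrightarrow> (T ^^ m) x \<in> A (n + m)"
  by (induction m) (auto simp: T_A)

lemma polynomial_combination_A:
  assumes "finite S" "S \<subseteq> (\<Union>n. A n)"
  shows "\<exists>n. (\<Sum>b\<in>S. \<Sum>m<N. a b m *\<^sub>v (T ^^ m) b) \<in> A n"
proof -
  have "\<forall>b\<in>S. \<exists>n. b \<in> A n" using assms by blast
  then obtain d where d: "\<And>b. b \<in> S \<Longrightarrow> b \<in> A (d b)" by metis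
  have "(T ^^ m) b \<in> A (Max (d ` S) + N)" if "b \<in> S" "m < N" for b m
    using T_funpow_A[OF d[OF that(1)], of m] A_mono[of "d b + m" "Max (d ` S) + N"] that assms(1)
    by (meson Max_ge add_mono finite_imageI image_eqI less_imp_le subsetD)
  then show ?thesis
    by (intro exI[of _ "Max (d ` S) + N"] subspace_sum[OF A_subspace] subspace_scale[OF A_subspace]) auto
qed

text \<open>The constant coefficients vanish because the basis is independent modulo the image of \<open>T\<close>; as \<open>T\<close> is
  injective it can then be cancelled, which lowers the degree of all the coefficients.\<close>

lemma free_basis_independent:
  assumes "finite S" "S \<subseteq> free_basis" "(\<Sum>b\<in>S. \<Sum>m<N. a b m *\<^sub>v (T ^^ m) b) = 0" "b \<in> S" "m < N"
  shows "a b m = 0"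
  using assms(3-5)
proof (induction N arbitrary: a b m)
  case (Suc N)
  \<comment> \<open>split off the constant coefficients, as in Horner's scheme\<close>
  define h where "h = (\<Sum>b\<in>S. \<Sum>m<N. a b (Suc m) *\<^sub>v (T ^^ m) b)"
  have "0 = (\<Sum>b\<in>S. a b 0 *\<^sub>v b) + T h"
    unfolding h_def using Suc.prems(1)
    by (subst (asm) sum.lessThan_Suc_shift) (simp add: T_sum T_scale sum.distrib)
  then have e: "(\<Sum>b\<in>S. a b 0 *\<^sub>v b) = T (- h)"
    by (simp add: T_minus eq_neg_iff_add_eq_0)
  obtain n where n: "h \<in> A n"
    using polynomial_combination_A[where S = S and N = N and a = "\<lambda>b m. a b (Suc m)"] assms free_basis_subset
    unfolding h_def by (metis dual_order.trans)
  have z: "a b 0 = 0" if "b \<in> S" for b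
    using independent_mod_image[OF assms(1,2) subspace_neg[OF A_subspace n] e that] .
  then have "T h = 0" using e by (simp add: T_minus)
  then have "h = 0" using T_inj n by blast
  then have "a b (Suc m) = 0" if "m < N" "b \<in> S" for b m
    using Suc.IH[of "\<lambda>b m. a b (Suc m)"] that unfolding h_def by blast
  then show ?case using z Suc.prems by (cases m) auto
qed simp

text \<open>By induction on the degree: modulo \<open>descent\<close> an element lies in the span of a layer, and \<open>descent\<close> is
  made of lower degrees and \<open>T\<close>.\<close>

lemma free_basis_spans:
  assumes "x \<in> A n"
  shows "\<exists>S N a. finite S \<and> S \<subseteq> free_basis \<and> x = (\<Sum>b\<in>S. \<Sum>m<N. a b m *\<^sub>v (T ^^ m) b)"
proof -
  define V where "V = span (\<Union>m. (T ^^ m) ` free_basis)"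
  have TV: "T y \<in> V" if "y \<in> V" for y
    using that unfolding V_def
  proof (induction rule: span_induct_alt)
    case base then show ?case using T_scale[of 0 0] span_zero by auto
  next
    case (step c x y)
    then obtain m b where "x = (T ^^ m) b" "b \<in> free_basis" by auto
    then have "T x \<in> (\<Union>m. (T ^^ m) ` free_basis)"
      using UN_I[of "Suc m" UNIV "T x" "\<lambda>m. (T ^^ m) ` free_basis"] by auto
    then show ?case using step by (simp add: T_add T_scale span_add span_scale span_base)
  qed
  have AV: "A n \<subseteq> V" for n
  proof (induction n)
    case 0 show ?case using A_0 span_zero by (auto simp: V_def)
  next
    case (Suc n)
    show ?case
    proof
      fix x assume "x \<in> A (Suc n)"
      then obtain u v where x: "u \<in> span (layer n)" "v \<in> descent n" "x = u + v" using layer(4) by blast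
      have "layer n \<subseteq> (T ^^ 0) ` free_basis" by (auto simp: free_basis_def)
      then have "u \<in> V" using x(1) span_mono unfolding V_def by (metis (no_types) UNIV_I SUP_upper2 subsetD)
      moreover have "v \<in> V" using x(2) Suc TV span_add unfolding descent_def V_def by blast
      ultimately show "x \<in> V" using x(3) span_add unfolding V_def by blast
    qed
  qed
  have "x \<in> V" using AV assms by blast
  then show ?thesis unfolding V_def
  proof (induction rule: span_induct_alt)
    case base then show ?case by (intro exI[of _ "{}"]) auto
  next
    case (step c x y)
    then obtain S N a m0 b0 where s: "finite S" "S \<subseteq> free_basis"
      "y = (\<Sum>b\<in>S. \<Sum>m<N. a b m *\<^sub>v (T ^^ m) b)" "x = (T ^^ m0) b0" "b0 \<in> free_basis"
      by auto
    \<comment> \<open>both summands are padded to a common index set before they are added\<close>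
    define a1 where "a1 b m = (if b \<in> S \<and> m < N then a b m else 0)" for b m
    define a2 where "a2 b m = (if b = b0 \<and> m = m0 then c else 0)" for b m
    define S' where "S' = insert b0 S"
    define N' where "N' = max N (Suc m0)"
    have "(\<Sum>b\<in>S'. \<Sum>m<N'. a1 b m *\<^sub>v (T ^^ m) b) = (\<Sum>b\<in>S. \<Sum>m<N'. a1 b m *\<^sub>v (T ^^ m) b)"
      using s by (intro sum.mono_neutral_right) (auto simp: S'_def a1_def)
    also have "\<dots> = y"
      unfolding s(3)
      by (intro sum.cong refl sum.mono_neutral_cong_right) (auto simp: N'_def a1_def)
    finally have y: "(\<Sum>b\<in>S'. \<Sum>m<N'. a1 b m *\<^sub>v (T ^^ m) b) = y" .
    have "(\<Sum>b\<in>S'. \<Sum>m<N'. a2 b m *\<^sub>v (T ^^ m) b) = (\<Sum>b\<in>{b0}. \<Sum>m\<in>{m0}. c *\<^sub>v (T ^^ m) b)"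
      using s by (intro sum.mono_neutral_cong_right)
        (auto simp: S'_def N'_def a2_def intro!: sum.neutral sum.mono_neutral_cong_right)
    then have "c *\<^sub>v x + y = (\<Sum>b\<in>S'. \<Sum>m<N'. (a1 b m + a2 b m) *\<^sub>v (T ^^ m) b)"
      using s(4) y by (simp add: scale_left_distrib sum.distrib)
    then show ?case
      using s by (intro exI[of _ S'] exI[of _ N'] exI[of _ "\<lambda>b m. a1 b m + a2 b m"]) (auto simp: S'_def)
  qed
qed

text \<open>By assumption all layers but possibly the first are nonempty, and layers are disjoint.\<close>

lemma infinite_free_basis:
  assumes "\<And>n. \<exists>x\<in>A (Suc (Suc n)). x \<notin> descent (Suc n)"
  shows "infinite free_basis"
proof -
  have "\<exists>b. b \<in> layer (Suc n)" for n
  proof (rule ccontr)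
    assume "\<nexists>b. b \<in> layer (Suc n)"
    then have "layer (Suc n) = {}" by blast
    then show False using assms[of n] layer(4)[of _ "Suc n"] by (auto simp: span_empty)
  qed
  then obtain b where b: "\<And>n. b n \<in> layer (Suc n)" by metis
  have "b m \<noteq> b n" if "m < n" for m n
  proof
    assume "b m = b n"
    then have "b n \<in> A (Suc (Suc m))" using b[of m] layer(1) by auto
    then have "b n \<in> A (Suc n)" using A_mono[of "Suc (Suc m)" "Suc n"] that by auto
    then show False using layer_not_A b by blast
  qed
  then have "inj b" by (metis injI linorder_neqE_nat)
  moreover have "range b \<subseteq> free_basis" using b by (auto simp: free_basis_def)
  ultimately show ?thesis using infinite_super range_inj_infinite by blast
qed

end

section \<open>Symmetric powers as representations of all matrices\<close>

definition mat2 :: "'a \<Rightarrow> 'a \<Rightarrow> 'a \<Rightarrow> 'a \<Rightarrow> 'a^2^2" where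
  "mat2 a b c d = (\<chi> i j. if i = 1 then (if j = 1 then a else b) else (if j = 1 then c else d))"

lemma mat2_nth [simp]:
  "mat2 a b c d $ 1 $ 1 = a" "mat2 a b c d $ 1 $ 2 = b"
  "mat2 a b c d $ 2 $ 1 = c" "mat2 a b c d $ 2 $ 2 = d"
  by (simp_all add: mat2_def)

lemma mat2_eq_iff:
  "A = B \<longleftrightarrow> A $ 1 $ 1 = B $ 1 $ 1 \<and> A $ 1 $ 2 = B $ 1 $ 2 \<and> A $ 2 $ 1 = B $ 2 $ 1 \<and> A $ 2 $ 2 = B $ 2 $ 2"
  for A B :: "'a^2^2"
  by (auto simp: vec_eq_iff forall_2)

lemma matrix_mult_2: "(A ** B) $ i $ j = A $ i $ 1 * B $ 1 $ j + A $ i $ 2 * B $ 2 $ j"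
  for A B :: "'a::semiring_1^2^2"
  by (simp add: matrix_matrix_mult_def sum_2)

lemma mat_2_nth [simp]:
  "(mat c :: 'a::zero^2^2) $ 1 $ 1 = c" "(mat c :: 'a::zero^2^2) $ 1 $ 2 = 0"
  "(mat c :: 'a::zero^2^2) $ 2 $ 1 = 0" "(mat c :: 'a::zero^2^2) $ 2 $ 2 = c"
  by (simp_all add: mat_def)

text \<open>\<open>F\<close> is the homogenization to degree \<open>n\<close> of \<open>f\<close>, with \<open>Y\<close> for the variable of \<open>f\<close> and \<open>X\<close> for the
  homogenizing variable.  Passing to \<open>f\<close> replaces coefficients of polynomials in two variables by coefficients of
  polynomials in one.\<close>

definition homogenization :: "nat \<Rightarrow> 'k::field poly \<Rightarrow> 'k poly poly \<Rightarrow> bool" where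
  "homogenization n f F \<longleftrightarrow>
     degree f \<le> n \<and> (\<forall>m. coeff F m = (if m \<le> n then monom (coeff f m) (n - m) else 0))"

lemma homogenization_linear_form_mult:
  assumes "homogenization n f F"
  shows "homogenization (Suc n) ([:u, v:] * f) (linear_form u v * F)"
proof -
  have F: "coeff F m = (if m \<le> n then monom (coeff f m) (n - m) else 0)" for m
    using assms by (simp add: homogenization_def)
  have f: "degree f \<le> n" using assms by (simp add: homogenization_def)
  have "coeff f (Suc n) = 0" using f by (simp add: coeff_eq_0)
  have "coeff (linear_form u v * F) m =
      (if m \<le> Suc n then monom (coeff ([:u, v:] * f) m) (Suc n - m) else 0)" for m
  proof (cases m)
    case 0
    then show ?thesis by (simp add: linear_form_def F monom_Suc smult_monom mult.commute)
  next
    case (Suc k)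
    consider "k < n" | "k = n" | "n < k" by linarith
    then show ?thesis
    proof cases
      case 1
      then have "n - k = Suc (n - Suc k)" by simp
      then show ?thesis using Suc 1
        by (simp add: linear_form_def F monom_Suc smult_monom add_monom)
    qed (use Suc \<open>coeff f (Suc n) = 0\<close> in \<open>simp_all add: linear_form_def F smult_monom\<close>)
  qed
  moreover have "degree ([:u, v:] * f) \<le> Suc n"
    using degree_mult_le[of "[:u, v:]" f] f degree_pCons_le[of u "[:v:]"] by simp
  ultimately show ?thesis by (simp add: homogenization_def)
qed

lemma homogenization_linear_form_power_mult:
  "homogenization n f F \<Longrightarrow> homogenization (k + n) ([:u, v:] ^ k * f) (linear_form u v ^ k * F)"
  by (induction k) (simp_all only: power_Suc mult.assoc add_Suc homogenization_linear_form_mult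
      power_0 mult_1 add_0)

lemma homogenization_one: "homogenization 0 1 1"
  by (auto simp: homogenization_def monom_0 coeff_1)

lemma sym_coeff_dehomogenize:
  assumes "l \<le> n" "m \<le> n"
  shows "sym_coeff n A l m = coeff ([:A$1$1, A$2$1:] ^ (n - l) * [:A$1$2, A$2$2:] ^ l) m"
proof -
  have "homogenization ((n - l) + (l + 0)) ([:A$1$1, A$2$1:] ^ (n - l) * ([:A$1$2, A$2$2:] ^ l * 1))
      (linear_form (A$1$1) (A$2$1) ^ (n - l) * (linear_form (A$1$2) (A$2$2) ^ l * 1))"
    by (intro homogenization_linear_form_power_mult homogenization_one)
  then show ?thesis using assms by (simp add: homogenization_def sym_coeff_def)
qed

text \<open>The value at \<open>(x, y)\<close> of the homogenization of \<open>q\<close> to degree \<open>n\<close>.\<close>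

definition subst_homogeneous :: "nat \<Rightarrow> 'k::field poly \<Rightarrow> 'k poly \<Rightarrow> 'k poly \<Rightarrow> 'k poly" where
  "subst_homogeneous n q x y = (\<Sum>l\<le>n. smult (coeff q l) (x ^ (n - l) * y ^ l))"

lemma subst_homogeneous_linear_mult:
  assumes "degree q \<le> n"
  shows "subst_homogeneous (Suc n) ([:u, v:] * q) x y = (smult u x + smult v y) * subst_homogeneous n q x y"
proof -
  have z: "coeff q (Suc n) = 0" using assms by (simp add: coeff_eq_0)
  have "subst_homogeneous (Suc n) ([:u, v:] * q) x y =
      (\<Sum>l\<le>Suc n. smult (u * coeff q l) (x ^ (Suc n - l) * y ^ l)) +
      (\<Sum>l\<le>Suc n. smult (v * (case l of 0 \<Rightarrow> 0 | Suc k \<Rightarrow> coeff q k)) (x ^ (Suc n - l) * y ^ l))"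
    unfolding subst_homogeneous_def sum.distrib[symmetric]
    by (intro sum.cong refl) (auto simp: coeff_pCons smult_add_left split: nat.splits)
  also have "(\<Sum>l\<le>Suc n. smult (u * coeff q l) (x ^ (Suc n - l) * y ^ l)) =
      (\<Sum>l\<le>n. smult u x * smult (coeff q l) (x ^ (n - l) * y ^ l))"
    using z by (simp add: Suc_diff_le mult.assoc mult.commute[of u])
  also have "(\<Sum>l\<le>Suc n. smult (v * (case l of 0 \<Rightarrow> 0 | Suc k \<Rightarrow> coeff q k)) (x ^ (Suc n - l) * y ^ l)) =
      (\<Sum>l\<le>n. smult v y * smult (coeff q l) (x ^ (n - l) * y ^ l))"
    by (subst sum.atMost_Suc_shift) (simp add: mult.left_commute mult.commute[of v])
  finally show ?thesis
    unfolding sum_distrib_left[symmetric] distrib_right[symmetric] subst_homogeneous_def[symmetric] .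
qed

lemma degree_linear_power_le: "degree ([:u, v:] ^ k) \<le> k" for u v :: "'k::field"
proof -
  have "degree ([:u, v:] ^ k) \<le> degree [:u, v:] * k" by (rule degree_power_le)
  also have "\<dots> \<le> 1 * k" by (intro mult_right_mono) auto
  finally show ?thesis by simp
qed

lemma subst_homogeneous_linear_power_mult:
  assumes "degree q \<le> n"
  shows "subst_homogeneous (k + n) ([:u, v:] ^ k * q) x y = (smult u x + smult v y) ^ k * subst_homogeneous n q x y"
proof (induction k)
  case (Suc k)
  have "degree ([:u, v:] ^ k * q) \<le> k + n"
  proof -
    show ?thesis
      using degree_mult_le[of "[:u, v:] ^ k" q] degree_linear_power_le[of u v k] assms by linarith
  qed
  from subst_homogeneous_linear_mult[OF this, of u v x y] Suc show ?case by (simp only: power_Suc mult.assoc add_Suc)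
qed simp

text \<open>Functoriality of the symmetric power, for all matrices and not only for invertible ones: applying \<open>B\<close> and then
  substituting the linear forms of \<open>A\<close> is the substitution for the product \<open>A ** B\<close>, because the action is the
  substitution of \<open>(X, Y) A\<close> for \<open>(X, Y)\<close>.\<close>

lemma sym_coeff_mult:
  assumes "j \<le> n" "m \<le> n"
  shows "(\<Sum>l\<le>n. sym_coeff n B j l * sym_coeff n A l m) = sym_coeff n (A ** B) j m"
proof -
  let ?x = "[:A$1$1, A$2$1:]" and ?y = "[:A$1$2, A$2$2:]"
  let ?q = "[:B$1$1, B$2$1:] ^ (n - j) * ([:B$1$2, B$2$2:] ^ j * 1)"
  have "degree ([:B$1$2, B$2$2:] ^ j * 1) \<le> j + 0" using degree_linear_power_le by simp
  note subst_homogeneous_linear_power_mult[OF this, of "n - j" "B$1$1" "B$2$1" ?x ?y]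
  also have "subst_homogeneous (j + 0) ([:B$1$2, B$2$2:] ^ j * 1) ?x ?y =
      (smult (B$1$2) ?x + smult (B$2$2) ?y) ^ j * subst_homogeneous 0 1 ?x ?y"
    by (rule subst_homogeneous_linear_power_mult) simp
  finally have "subst_homogeneous ((n - j) + (j + 0)) ?q ?x ?y =
      (smult (B$1$1) ?x + smult (B$2$1) ?y) ^ (n - j) * ((smult (B$1$2) ?x + smult (B$2$2) ?y) ^ j *
        subst_homogeneous 0 1 ?x ?y)" .
  moreover have "subst_homogeneous 0 1 ?x ?y = 1" by (simp add: subst_homogeneous_def)
  moreover have "smult (B$1$i) ?x + smult (B$2$i) ?y = [:(A**B)$1$i, (A**B)$2$i:]" for i
    by (simp add: matrix_mult_2 mult.commute)
  ultimately have "subst_homogeneous n ?q ?x ?y =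
      [:(A**B)$1$1, (A**B)$2$1:] ^ (n - j) * [:(A**B)$1$2, (A**B)$2$2:] ^ j"
    using assms by simp
  then have "sym_coeff n (A ** B) j m = coeff (subst_homogeneous n ?q ?x ?y) m"
    using assms by (simp add: sym_coeff_dehomogenize)
  also have "\<dots> = (\<Sum>l\<le>n. sym_coeff n B j l * sym_coeff n A l m)"
    unfolding subst_homogeneous_def coeff_sum using assms
    by (intro sum.cong refl) (simp add: sym_coeff_dehomogenize)
  finally show ?thesis by simp
qed

lemma sym_coeff_one:
  assumes "l \<le> n" "m \<le> n"
  shows "sym_coeff n (mat 1) l m = (if l = m then 1 else 0)"
proof -
  have "[:1, 0:] ^ (n - l) * [:0, 1:] ^ l = (monom 1 l :: 'a poly)"
    by (simp add: monom_altdef flip: one_pCons)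
  then show ?thesis using assms by (simp add: sym_coeff_dehomogenize)
qed

lemma sym_coeff_upper:
  assumes "l \<le> n"
  shows "sym_coeff n (mat2 1 b 0 1) l 0 = b ^ l"
  using assms by (simp add: sym_coeff_dehomogenize coeff_mult coeff_0_power flip: one_pCons)

lemma sym_coeff_lower:
  assumes "m \<le> n"
  shows "sym_coeff n (mat2 1 0 c 1) 0 m = of_nat (n choose m) * c ^ m"
  using assms by (simp add: sym_coeff_dehomogenize coeff_linear_poly_power)

lemma sym_coeff_idempotent:
  assumes "l \<le> n" "m \<le> n"
  shows "sym_coeff n (mat2 1 0 0 0) l m = (if l = 0 \<and> m = 0 then 1 else 0)"
  using assms by (simp add: sym_coeff_dehomogenize power_0_left coeff_1 flip: one_pCons)

lemma frob_matrix_mult: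
  fixes A B :: "'k::field^2^2"
  assumes "Factorial_Ring.prime p" "CHAR('k) = p"
  shows "frob_matrix p i (A ** B) = frob_matrix p i A ** frob_matrix p i B"
  using assms by (simp add: mat2_eq_iff frob_matrix_def matrix_mult_2 freshmans_dream' power_mult_distrib)

lemma frob_matrix_mat2: "Factorial_Ring.prime p \<Longrightarrow> frob_matrix p i (mat2 a b c d) = mat2 (a^p^i) (b^p^i) (c^p^i) (d^p^i)"
  by (simp add: mat2_eq_iff frob_matrix_def)

lemma zero_power_prime_power: "Factorial_Ring.prime p \<Longrightarrow> (0 :: 'k::field) ^ p ^ i = 0"
  by (simp add: power_0_left prime_gt_0_nat)

lemma weight_index_le: "l \<in> weight_index e r \<Longrightarrow> i < e \<Longrightarrow> l i \<le> r i"
  by (auto simp: weight_index_def dest: PiE_mem)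

lemma frob_matrix_one: "Factorial_Ring.prime p \<Longrightarrow> frob_matrix p i (mat 1 :: 'k::field^2^2) = mat 1"
  by (auto simp: mat2_eq_iff frob_matrix_def power_0_left prime_gt_0_nat)

lemma finite_weight_index [simp]: "finite (weight_index e r)"
  by (simp add: weight_index_def finite_PiE)

lemma weight_action_space: "weight_action p e r A w \<in> weight_space e r"
  by (simp add: weight_action_def weight_space_def)

lemma weight_action_add:
  "weight_action p e r A (\<lambda>l. v l + w l) = (\<lambda>l. weight_action p e r A v l + weight_action p e r A w l)"
  by (auto simp: weight_action_def distrib_right sum.distrib)

lemma weight_action_scale:
  "weight_action p e r A (\<lambda>l. c * w l) = (\<lambda>l. c * weight_action p e r A w l)"
  by (auto simp: weight_action_def sum_distrib_left mult.assoc)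

lemma weight_action_zero [simp]: "weight_action p e r A (\<lambda>_. 0) = (\<lambda>_. 0)"
  by (auto simp: weight_action_def fun_eq_iff)

text \<open>On every tensor factor this is functoriality of the symmetric power, and the Frobenius twists are ring
  homomorphisms.  The product is over arbitrary matrices, which makes the kernel of the Hecke operator below
  equivariant for free.\<close>

lemma weight_action_mult:
  fixes A B :: "'k::field^2^2"
  assumes "Factorial_Ring.prime p" "CHAR('k) = p"
  shows "weight_action p e r A (weight_action p e r B w) = weight_action p e r (A ** B) w"
proof
  fix m
  let ?s = "\<lambda>A i. sym_coeff (r i) (frob_matrix p i A)"
  let ?I = "weight_index e r"
  show "weight_action p e r A (weight_action p e r B w) m = weight_action p e r (A ** B) w m"
  proof (cases "m \<in> ?I")
    case True
    have "weight_action p e r A (weight_action p e r B w) m =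
        (\<Sum>l\<in>?I. (\<Sum>j\<in>?I. w j * (\<Prod>i<e. ?s B i (j i) (l i))) * (\<Prod>i<e. ?s A i (l i) (m i)))"
      using True by (simp add: weight_action_def)
    also have "\<dots> = (\<Sum>l\<in>?I. \<Sum>j\<in>?I. w j * (\<Prod>i<e. ?s B i (j i) (l i) * ?s A i (l i) (m i)))"
      by (simp only: sum_distrib_right prod.distrib mult.assoc)
    also have "\<dots> = (\<Sum>j\<in>?I. w j * (\<Sum>l\<in>?I. \<Prod>i<e. ?s B i (j i) (l i) * ?s A i (l i) (m i)))"
      by (subst sum.swap) (simp only: sum_distrib_left)
    also have "\<dots> = (\<Sum>j\<in>?I. w j * (\<Prod>i<e. \<Sum>l\<le>r i. ?s B i (j i) l * ?s A i l (m i)))"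
      unfolding weight_index_def by (subst prod_sum_PiE) auto
    also have "\<dots> = (\<Sum>j\<in>?I. w j * (\<Prod>i<e. ?s (A ** B) i (j i) (m i)))"
      using True by (intro sum.cong prod.cong arg_cong2[of _ _ _ _ "(*)"] refl)
        (simp add: sym_coeff_mult frob_matrix_mult[OF assms] weight_index_le)
    finally show ?thesis using True by (simp add: weight_action_def)
  qed (simp add: weight_action_def)
qed

text \<open>The index of the basis vector \<open>X^r\<close>, the highest weight vector.\<close>

definition zero_index :: "nat \<Rightarrow> nat \<Rightarrow> nat" where "zero_index e = (\<lambda>i\<in>{..<e}. 0)"

definition weight_unit :: "(nat \<Rightarrow> nat) \<Rightarrow> (nat \<Rightarrow> nat) \<Rightarrow> 'k::field" where
  "weight_unit l = (\<lambda>m. if m = l then 1 else 0)"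

lemma zero_index_in [simp]: "zero_index e \<in> weight_index e r"
  by (auto simp: zero_index_def weight_index_def)

lemma weight_unit_space: "l \<in> weight_index e r \<Longrightarrow> weight_unit l \<in> weight_space e r"
  by (auto simp: weight_unit_def weight_space_def)

lemma weight_index_eq_iff:
  "l \<in> weight_index e r \<Longrightarrow> m \<in> weight_index e r \<Longrightarrow> l = m \<longleftrightarrow> (\<forall>i<e. l i = m i)"
  unfolding weight_index_def by (metis PiE_ext lessThan_iff)

lemma weight_action_unit:
  assumes "l \<in> weight_index e r" "m \<in> weight_index e r"
  shows "weight_action p e r A (weight_unit l) m = (\<Prod>i<e. sym_coeff (r i) (frob_matrix p i A) (l i) (m i))"
  using assms by (simp add: weight_action_def weight_unit_def if_distrib[of "\<lambda>x. x * _"] sum.delta cong: if_cong)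

lemma weight_action_one:
  assumes "Factorial_Ring.prime p" "w \<in> weight_space e r"
  shows "weight_action p e r (mat 1) w = w"
proof
  fix m show "weight_action p e r (mat 1) w m = w m"
  proof (cases "m \<in> weight_index e r")
    case True
    have "(\<Prod>i<e. sym_coeff (r i) (frob_matrix p i (mat 1 :: 'a^2^2)) (l i) (m i)) = (if l = m then 1 else 0)"
      if "l \<in> weight_index e r" for l
    proof -
      have "(\<Prod>i<e. sym_coeff (r i) (frob_matrix p i (mat 1 :: 'a^2^2)) (l i) (m i)) =
          (\<Prod>i<e. if l i = m i then 1 else 0)"
        using that True by (intro prod.cong refl)
          (auto simp: frob_matrix_one[OF assms(1)] sym_coeff_one weight_index_def dest!: PiE_mem)
      also have "\<dots> = (if l = m then 1 else 0)"
        unfolding weight_index_eq_iff[OF that True] by (auto intro!: prod.neutral)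
      finally show ?thesis .
    qed
    then have "weight_action p e r (mat 1) w m = (\<Sum>l\<in>weight_index e r. w l * (if l = m then 1 else 0))"
      using True by (simp add: weight_action_def)
    also have "\<dots> = w m" using True by (simp add: if_distrib[of "\<lambda>x. _ * x"] cong: if_cong)
    finally show ?thesis .
  qed (use assms in \<open>auto simp: weight_action_def weight_space_def\<close>)
qed

text \<open>The symmetric power of \<open>diag(1, 0)\<close> substitutes \<open>0\<close> for \<open>Y\<close>, so it is the projection to \<open>X^r\<close>.\<close>

lemma weight_action_idempotent:
  assumes "Factorial_Ring.prime p"
  shows "weight_action p e r (mat2 1 0 0 0) w = (\<lambda>m. w (zero_index e) * weight_unit (zero_index e) m)"
proof
  fix m
  show "weight_action p e r (mat2 1 0 0 0) w m = w (zero_index e) * weight_unit (zero_index e) m"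
  proof (cases "m \<in> weight_index e r")
    case True
    have "(\<Prod>i<e. sym_coeff (r i) (frob_matrix p i (mat2 1 0 0 0 :: 'a^2^2)) (l i) (m i)) =
        (if l = zero_index e then weight_unit (zero_index e) m else 0)"
      if "l \<in> weight_index e r" for l
    proof -
      have "(\<Prod>i<e. sym_coeff (r i) (frob_matrix p i (mat2 1 0 0 0 :: 'a^2^2)) (l i) (m i)) =
          (\<Prod>i<e. if l i = 0 \<and> m i = 0 then 1 else 0)"
        using that True
        by (intro prod.cong refl) (simp add: frob_matrix_mat2[OF assms] zero_power_prime_power[OF assms]
          sym_coeff_idempotent weight_index_le)
      also have "\<dots> = (if l = zero_index e \<and> m = zero_index e then 1 else 0)"
        unfolding weight_index_eq_iff[OF that zero_index_in] weight_index_eq_iff[OF True zero_index_in]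
        by (auto intro!: prod.neutral simp: zero_index_def)
      finally show ?thesis by (simp add: weight_unit_def)
    qed
    then have "weight_action p e r (mat2 1 0 0 0) w m =
        (\<Sum>l\<in>weight_index e r. w l * (if l = zero_index e then weight_unit (zero_index e) m else 0))"
      using True by (simp add: weight_action_def)
    also have "\<dots> = w (zero_index e) * weight_unit (zero_index e) m"
      by (simp add: if_distrib[of "\<lambda>x. _ * x"] cong: if_cong)
    finally show ?thesis .
  qed (auto simp: weight_action_def weight_unit_def)
qed

definition base_p :: "nat \<Rightarrow> nat \<Rightarrow> (nat \<Rightarrow> nat) \<Rightarrow> nat" where
  "base_p p e l = (\<Sum>i<e. l i * p ^ i)"

text \<open>Setting \<open>Y = 0\<close> after the substitution \<open>Y := b X + Y\<close> leaves \<open>b\<close> to the exponent that has the multi-index as its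
  base \<open>p\<close> digits.\<close>

lemma weight_action_upper:
  assumes "Factorial_Ring.prime p"
  shows "weight_action p e r (mat2 1 b 0 1) w (zero_index e) =
    (\<Sum>l\<in>weight_index e r. w l * b ^ base_p p e l)"
proof -
  have "(\<Prod>i<e. sym_coeff (r i) (frob_matrix p i (mat2 1 b 0 1)) (l i) (zero_index e i)) = b ^ base_p p e l"
    if "l \<in> weight_index e r" for l
  proof -
    have "(\<Prod>i<e. sym_coeff (r i) (frob_matrix p i (mat2 1 b 0 1)) (l i) (zero_index e i)) = (\<Prod>i<e. (b ^ p ^ i) ^ l i)"
      using that
      by (intro prod.cong refl) (simp add: frob_matrix_mat2[OF assms] zero_power_prime_power[OF assms]
        zero_index_def sym_coeff_upper weight_index_le)
    then show ?thesis by (simp add: base_p_def power_sum mult.commute flip: power_mult)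
  qed
  then show ?thesis by (simp add: weight_action_def)
qed

lemma weight_action_lower:
  assumes "Factorial_Ring.prime p" "m \<in> weight_index e r"
  shows "weight_action p e r (mat2 1 0 c 1) (weight_unit (zero_index e)) m =
    (\<Prod>i<e. of_nat (r i choose m i)) * c ^ base_p p e m"
proof -
  have "weight_action p e r (mat2 1 0 c 1) (weight_unit (zero_index e)) m = (\<Prod>i<e. of_nat (r i choose m i) * (c ^ p ^ i) ^ m i)"
    using assms(2)
    unfolding weight_action_unit[OF zero_index_in assms(2)]
    by (intro prod.cong refl) (simp add: frob_matrix_mat2[OF assms(1)]
      zero_power_prime_power[OF assms(1)] zero_index_def sym_coeff_lower weight_index_le)
  then show ?thesis by (simp add: prod.distrib base_p_def power_sum mult.commute flip: power_mult)
qed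

lemma base_p_less:
  assumes "\<And>i. i < e \<Longrightarrow> l i < p"
  shows "base_p p e l < p ^ e"
  using assms
proof (induction e)
  case (Suc e)
  then have "base_p p e l < p ^ e" "l e + 1 \<le> p" by (auto simp: Suc_le_eq)
  then have "base_p p e l + l e * p ^ e < (l e + 1) * p ^ e" by simp
  also have "\<dots> \<le> p * p ^ e" using \<open>l e + 1 \<le> p\<close> by (intro mult_right_mono) auto
  finally show ?case by (simp add: base_p_def)
qed (simp add: base_p_def)

lemma base_p_inj:
  assumes "base_p p e l = base_p p e m" "\<And>i. i < e \<Longrightarrow> l i < p" "\<And>i. i < e \<Longrightarrow> m i < p" "i < e"
  shows "l i = m i"
  using assms
proof (induction e arbitrary: i)
  case (Suc e)
  have s: "base_p p e l < p ^ e" "base_p p e m < p ^ e" using Suc.prems by (auto intro!: base_p_less)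
  have eq: "base_p p e l + l e * p ^ e = base_p p e m + m e * p ^ e"
    using Suc.prems(1) by (simp add: base_p_def)
  have "(a + c * q) div q = c" if "a < q" for a c q :: nat using that by simp
  from this[OF s(1), of "l e"] this[OF s(2), of "m e"]
  have e: "l e = m e" using eq by simp
  then show ?case using eq Suc by (auto simp: less_Suc_eq)
qed simp

text \<open>The combination is a polynomial of degree less than \<open>p ^ e\<close>, so it has too many zeros; distinct
  multi-indices contribute to distinct coefficients by uniqueness of base \<open>p\<close> digits.  This is where the bound
  \<open>r i < p\<close> is essential.\<close>

lemma base_p_combination_eq_0:
  fixes a :: "(nat \<Rightarrow> nat) \<Rightarrow> 'k::field"
  assumes r: "\<And>i. i < e \<Longrightarrow> r i < p"
    and Z: "finite Z" "card Z \<ge> p ^ e"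
    and zero: "\<And>x. x \<in> Z \<Longrightarrow> (\<Sum>l\<in>weight_index e r. a l * x ^ base_p p e l) = 0"
    and l: "l \<in> weight_index e r"
  shows "a l = 0"
proof -
  define P where "P = (\<Sum>l\<in>weight_index e r. monom (a l) (base_p p e l))"
  have small: "l i < p" if "l \<in> weight_index e r" "i < e" for l i
    using that r[of i] by (force simp: weight_index_def dest: PiE_mem)
  have "degree P \<le> p ^ e - 1"
    unfolding P_def
  proof (intro degree_sum_le)
    fix l assume "l \<in> weight_index e r"
    then have "base_p p e l < p ^ e" using small by (intro base_p_less) auto
    then show "degree (monom (a l) (base_p p e l)) \<le> p ^ e - 1"
      using degree_monom_le[of "a l" "base_p p e l"] by linarith
  qed simp
  moreover have "p ^ e > 0" using base_p_less[of e l p] small l by (metis gr_zeroI not_less0)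
  ultimately have deg: "degree P < p ^ e" by linarith
  have "P = 0"
  proof (rule ccontr)
    assume "P \<noteq> 0"
    have "poly P x = 0" if "x \<in> Z" for x
      using zero[OF that] by (simp add: P_def poly_sum poly_monom)
    then have "card Z \<le> card {x. poly P x = 0}"
      by (intro card_mono poly_roots_finite \<open>P \<noteq> 0\<close>) auto
    then show False using card_poly_roots_bound[OF \<open>P \<noteq> 0\<close>] deg Z by linarith
  qed
  then have "0 = coeff P (base_p p e l)" by simp
  also have "\<dots> = (\<Sum>j\<in>weight_index e r. if j = l then a j else 0)"
    unfolding P_def coeff_sum
  proof (intro sum.cong refl)
    fix j assume j: "j \<in> weight_index e r"
    have "base_p p e j = base_p p e l \<longleftrightarrow> j = l"
      using base_p_inj[of p e j l] small j l weight_index_eq_iff[OF j l] by blast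
    then show "coeff (monom (a j) (base_p p e j)) (base_p p e l) = (if j = l then a j else 0)"
      by (simp add: coeff_monom)
  qed
  finally show ?thesis using l by simp
qed

lemma of_nat_binomial_nonzero:
  assumes "Factorial_Ring.prime p" "CHAR('k::field) = p" "n < p" "m \<le> n"
  shows "of_nat (n choose m) \<noteq> (0 :: 'k)"
proof
  assume "of_nat (n choose m) = (0 :: 'k)"
  then have "p dvd (n choose m)" using assms(2) by (simp add: of_nat_eq_0_iff_char_dvd)
  then have "p dvd fact n" using binomial_fact_lemma[OF assms(4)] by (metis dvd_triv_right dvd_trans)
  then show False using prime_dvd_fact_iff[OF assms(1)] assms(3) by simp
qed

section \<open>Matrices over a discretely valued field\<close>

context nonarch_local_field
begin

lemma av_0 [simp]: "av 0 = 0"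
  by (simp add: av_eq_0_iff)

lemma av_1 [simp]: "av 1 = 1"
  using av_mult[of 1 1] av_eq_0_iff[of 1] by simp

lemma av_minus [simp]: "av (- x) = av x"
proof -
  have "av (- 1) * av (- 1) = 1" using av_mult[of "- 1" "- 1"] by simp
  then have "av (- 1) = 1" using av_nonneg[of "- 1"] by (simp add: square_eq_1_iff)
  then show ?thesis using av_mult[of "- 1" x] by simp
qed

lemma av_diff: "av (x - y) \<le> max (av x) (av y)"
  using av_add[of x "- y"] by simp

lemma av_power: "av (x ^ n) = av x ^ n"
  by (induction n) (simp_all add: av_mult)

lemma av_inverse: "av (inverse x) = inverse (av x)"
proof (cases "x = 0")
  case False
  then have "av x * av (inverse x) = 1" using av_mult[of x "inverse x"] by simp
  then show ?thesis by (metis inverse_unique)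
qed simp

lemma av_divide: "av (x / y) = av x / av y"
  by (simp add: divide_inverse av_mult av_inverse)

lemma av_le_1_mult: "av x \<le> 1 \<Longrightarrow> av y \<le> 1 \<Longrightarrow> av (x * y) \<le> 1"
  using mult_le_one[of "av x" "av y"] av_nonneg[of y] by (simp add: av_mult)

lemma av_le_add: "av x \<le> c \<Longrightarrow> av y \<le> c \<Longrightarrow> av (x + y) \<le> c"
  using av_add[of x y] by linarith

lemma av_less_add: "av x < c \<Longrightarrow> av y < c \<Longrightarrow> av (x + y) < c"
  using av_add[of x y] by linarith

lemma av_le_diff: "av x \<le> c \<Longrightarrow> av y \<le> c \<Longrightarrow> av (x - y) \<le> c"
  using av_diff[of x y] by linarith

lemma uniformizer_exists:
  "\<exists>\<pi>. 0 < av \<pi> \<and> av \<pi> < 1 \<and> (\<forall>x. av x < 1 \<longrightarrow> av x \<le> av \<pi>)"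
proof -
  obtain c where c: "0 < c" "c < 1" "av ` (UNIV - {0}) = range (\<lambda>n::int. c powi n)"
    using discrete by blast
  have "c powi 1 \<in> av ` (UNIV - {0})" unfolding c(3) by (rule rangeI)
  then obtain \<pi> where \<pi>: "av \<pi> = c" by auto
  have "av x \<le> c" if "av x < 1" for x
  proof (cases "x = 0")
    case False
    then have "av x \<in> range (\<lambda>n::int. c powi n)" using c(3) by blast
    then obtain n :: int where n: "av x = c powi n" by blast
    have "\<not> n \<le> 0"
    proof
      assume "n \<le> 0"
      then have "c powi 0 \<le> c powi n" using c by (intro power_int_decreasing) auto
      then show False using that n by simp
    qed
    then have "c powi n \<le> c powi 1" using c by (intro power_int_decreasing) auto
    then show ?thesis using n by simp
  qed (use c in simp)
  then show ?thesis using \<pi> c by blast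
qed

lemma valuation_ring_simps [simp]:
  "carrier (valuation_ring av) = {x. av x \<le> 1}"
  "monoid.mult (valuation_ring av) = (*)" "one (valuation_ring av) = 1"
  "ring.zero (valuation_ring av) = 0" "add (valuation_ring av) = (+)"
  by (simp_all add: valuation_ring_def ring_of_type_algebra_def)

lemma valuation_ring_cring: "cring (valuation_ring av)"
proof (intro cringI abelian_groupI comm_monoidI)
  fix x assume "x \<in> carrier (valuation_ring av)"
  then show "\<exists>y\<in>carrier (valuation_ring av). y \<oplus>\<^bsub>valuation_ring av\<^esub> x = \<zero>\<^bsub>valuation_ring av\<^esub>"
    by (intro bexI[of _ "- x"]) auto
qed (auto simp: algebra_simps intro: av_le_add av_le_1_mult)

lemma max_ideal_ideal: "ideal (max_ideal av) (valuation_ring av)"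
proof (rule idealI)
  interpret cring "valuation_ring av" by (rule valuation_ring_cring)
  show "ring (valuation_ring av)" by (rule ring_axioms)
  have neg: "\<ominus>\<^bsub>valuation_ring av\<^esub> x = - x" if "av x \<le> 1" for x
    using that by (intro minus_equality) auto
  show "subgroup (max_ideal av) (add_monoid (valuation_ring av))"
  proof (rule subgroup.intro)
    show "inv\<^bsub>add_monoid (valuation_ring av)\<^esub> x \<in> max_ideal av" if "x \<in> max_ideal av" for x
      unfolding a_inv_def[symmetric] using that neg[of x] by (simp add: max_ideal_def)
  qed (auto simp: max_ideal_def av_less_add)
  have "av (x * y) < 1" if "av x < 1" "av y \<le> 1" for x y
    using that mult_mono[of "av x" "av x" "av y" 1] av_nonneg by (simp add: av_mult)
  then show "x \<otimes>\<^bsub>valuation_ring av\<^esub> a \<in> max_ideal av" "a \<otimes>\<^bsub>valuation_ring av\<^esub> x \<in> max_ideal av"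
    if "a \<in> max_ideal av" "x \<in> carrier (valuation_ring av)" for a x
    using that by (auto simp: max_ideal_def mult.commute[of x])
qed

lemma residue_class_eq:
  assumes "av (x - y) < 1"
  shows "max_ideal av +>\<^bsub>valuation_ring av\<^esub> x = max_ideal av +>\<^bsub>valuation_ring av\<^esub> y"
proof -
  have "\<exists>h. av h < 1 \<and> z = h + y" if "av (z - x) < 1" for z
    using av_less_add[OF that assms] by (intro exI[of _ "z - y"]) simp
  moreover have "\<exists>h. av h < 1 \<and> z = h + x" if "av (z - y) < 1" for z
    using av_diff[of "z - y" "x - y"] that assms by (intro exI[of _ "z - x"]) simp
  ultimately show ?thesis
    by (auto simp: a_r_coset_def' max_ideal_def)
qed

lemma finite_residue_representatives: "\<exists>R. finite R \<and> (\<forall>x. av x \<le> 1 \<longrightarrow> (\<exists>\<rho>\<in>R. av (x - \<rho>) < 1))"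
proof -
  let ?c = "\<lambda>x. max_ideal av +>\<^bsub>valuation_ring av\<^esub> x"
  have "finite (?c ` {x. av x \<le> 1})"
    using finite_residue_field by (simp add: residue_field_def FactRing_def A_RCOSETS_def' UNION_singleton_eq_range)
  from finite_subset_image[OF this subset_refl] obtain R
    where R: "finite R" "R \<subseteq> {x. av x \<le> 1}" "?c ` {x. av x \<le> 1} = ?c ` R" by blast
  have "\<exists>\<rho>\<in>R. av (x - \<rho>) < 1" if "av x \<le> 1" for x
  proof -
    have "?c x \<in> ?c ` R" unfolding R(3)[symmetric] using that by (intro imageI) simp
    then obtain \<rho> where \<rho>: "\<rho> \<in> R" "?c x = ?c \<rho>" by (elim imageE)
    have "x \<in> ?c x" by (auto simp: a_r_coset_def' max_ideal_def intro!: exI[of _ 0])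
    then have "x \<in> ?c \<rho>" unfolding \<rho>(2) .
    then have "av (x - \<rho>) < 1" by (auto simp: a_r_coset_def' max_ideal_def)
    then show ?thesis using \<rho>(1) by blast
  qed
  then show ?thesis using R(1) by blast
qed

text \<open>Expansion in powers of \<open>\<pi>\<close> with \<open>n\<close> digits from a set of representatives of the residue field.\<close>

lemma finite_representatives:
  assumes "0 < av \<pi>" "\<forall>x. av x < 1 \<longrightarrow> av x \<le> av \<pi>"
  shows "\<exists>R. finite R \<and> (\<forall>x. av x \<le> 1 \<longrightarrow> (\<exists>\<rho>\<in>R. av (x - \<rho>) \<le> av \<pi> ^ n))"
proof (induction n)
  case 0 then show ?case by (intro exI[of _ "{0}"]) simp
next
  case (Suc n)
  then obtain R where R: "finite R" "\<And>x. av x \<le> 1 \<Longrightarrow> \<exists>\<rho>\<in>R. av (x - \<rho>) \<le> av \<pi> ^ n" by blast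
  obtain Q where Q: "finite Q" "\<And>x. av x \<le> 1 \<Longrightarrow> \<exists>\<rho>\<in>Q. av (x - \<rho>) < 1"
    using finite_residue_representatives by blast
  have "\<exists>\<rho>\<in>(\<lambda>(s, t). s + \<pi> ^ n * t) ` (R \<times> Q). av (x - \<rho>) \<le> av \<pi> ^ Suc n" if x: "av x \<le> 1" for x
  proof -
    obtain s where s: "s \<in> R" "av (x - s) \<le> av \<pi> ^ n" using R x by blast
    \<comment> \<open>the next digit of \<open>x\<close>\<close>
    define y where "y = (x - s) / \<pi> ^ n"
    have "\<pi> ^ n \<noteq> 0" using assms by auto
    then have xs: "x - s = \<pi> ^ n * y" by (simp add: y_def)
    have "av y \<le> 1" using s assms by (simp add: y_def av_divide av_power divide_le_eq_1)
    then obtain t where t: "t \<in> Q" "av (y - t) < 1" using Q by blast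
    have "x - (s + \<pi> ^ n * t) = \<pi> ^ n * (y - t)" using xs by (simp add: algebra_simps)
    then have "av (x - (s + \<pi> ^ n * t)) = av \<pi> ^ n * av (y - t)" by (simp add: av_mult av_power)
    also have "\<dots> \<le> av \<pi> ^ n * av \<pi>" using t assms by (intro mult_left_mono) auto
    finally have "av (x - (s + \<pi> ^ n * t)) \<le> av \<pi> ^ Suc n" by (simp add: mult.commute)
    then show ?thesis using s(1) t(1) by (intro bexI[of _ "s + \<pi> ^ n * t"]) auto
  qed
  then show ?case
    using R(1) Q(1) by (intro exI[of _ "(\<lambda>(s, t). s + \<pi> ^ n * t) ` (R \<times> Q)"] conjI allI impI) auto
qed

end

definition inv2 :: "'f::field^2^2 \<Rightarrow> 'f^2^2" where
  "inv2 A = mat2 (A$2$2) (- A$1$2) (- A$2$1) (A$1$1)"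

definition scale_mat :: "'f::field \<Rightarrow> 'f^2^2 \<Rightarrow> 'f^2^2" where
  "scale_mat c A = mat2 (c * A$1$1) (c * A$1$2) (c * A$2$1) (c * A$2$2)"

lemmas matrix_simps = mat2_eq_iff matrix_mult_2 inv2_def scale_mat_def

lemma scale_mat_mult: "scale_mat c (A ** B) = scale_mat c A ** B" "scale_mat c (A ** B) = A ** scale_mat c B"
  by (simp_all add: matrix_simps algebra_simps)

lemma SL2_iff: "A \<in> SL2 S \<longleftrightarrow> A$1$1 \<in> S \<and> A$1$2 \<in> S \<and> A$2$1 \<in> S \<and> A$2$2 \<in> S \<and>
    A$1$1 * A$2$2 - A$1$2 * A$2$1 = 1"
  by (auto simp: SL2_def forall_2 det_2)

lemma SL2_UNIV_iff: "A \<in> SL2 UNIV \<longleftrightarrow> A$1$1 * A$2$2 - A$1$2 * A$2$1 = 1"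
  by (simp add: SL2_iff)

lemma SL2_mult: "A \<in> SL2 UNIV \<Longrightarrow> B \<in> SL2 UNIV \<Longrightarrow> A ** B \<in> SL2 UNIV"
  by (auto simp: SL2_def det_mul)

lemma SL2_inv2: "A \<in> SL2 UNIV \<Longrightarrow> inv2 A \<in> SL2 UNIV"
  by (simp add: SL2_UNIV_iff inv2_def algebra_simps)

lemma inv2_left: "A \<in> SL2 UNIV \<Longrightarrow> inv2 A ** A = mat 1"
  by (simp add: SL2_UNIV_iff matrix_simps algebra_simps)

lemma inv2_right: "A \<in> SL2 UNIV \<Longrightarrow> A ** inv2 A = mat 1"
  by (simp add: SL2_UNIV_iff matrix_simps algebra_simps)

lemma inv2_cancel [simp]:
  assumes "A \<in> SL2 UNIV"
  shows "inv2 A ** (A ** B) = B" "A ** (inv2 A ** B) = B" "B ** A ** inv2 A = B" "B ** inv2 A ** A = B"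
  using assms by (simp_all add: matrix_mul_assoc[symmetric] inv2_left inv2_right)
    (simp_all add: matrix_mul_assoc inv2_left inv2_right)

lemma inv2_mult: "inv2 (A ** B) = inv2 B ** inv2 A"
  by (simp add: matrix_simps algebra_simps)

lemma inv2_inv2 [simp]: "inv2 (inv2 A) = A"
  by (simp add: matrix_simps)

lemma SL2_one: "mat 1 \<in> SL2 UNIV"
  by (simp add: SL2_UNIV_iff)

locale uniformized_field = nonarch_local_field av for av :: "'f::field \<Rightarrow> real" +
  fixes \<pi> :: 'f
  assumes uniformizer: "0 < av \<pi>" "av \<pi> < 1" "av x < 1 \<Longrightarrow> av x \<le> av \<pi>"
begin

abbreviation "G \<equiv> SL2 (UNIV :: 'f set)"
abbreviation "K \<equiv> SL2 {x. av x \<le> 1}"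

lemma pi_nonzero [simp]: "\<pi> \<noteq> 0" using uniformizer(1) by auto

lemma K_sub_G: "k \<in> K \<Longrightarrow> k \<in> G" by (simp add: SL2_iff)

definition integral :: "'f^2^2 \<Rightarrow> bool" where "integral A \<longleftrightarrow> (\<forall>i j. av (A$i$j) \<le> 1)"

lemma integral_iff: "integral A \<longleftrightarrow> av (A$1$1) \<le> 1 \<and> av (A$1$2) \<le> 1 \<and> av (A$2$1) \<le> 1 \<and> av (A$2$2) \<le> 1"
  by (auto simp: integral_def forall_2)

lemma integral_mult: "integral A \<Longrightarrow> integral B \<Longrightarrow> integral (A ** B)"
  by (auto simp: integral_def matrix_mult_2 intro!: av_le_add av_le_1_mult)

lemma K_iff: "k \<in> K \<longleftrightarrow> k \<in> G \<and> integral k"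
  by (auto simp: SL2_iff integral_iff)

lemma integral_inv2: "integral A \<Longrightarrow> integral (inv2 A)"
  by (auto simp: integral_iff inv2_def)

lemma K_mult: "k \<in> K \<Longrightarrow> l \<in> K \<Longrightarrow> k ** l \<in> K"
  by (auto simp: K_iff integral_mult SL2_mult)

lemma K_inv2: "k \<in> K \<Longrightarrow> inv2 k \<in> K"
  by (auto simp: K_iff integral_inv2 SL2_inv2)

lemma K_one: "mat 1 \<in> K"
  by (simp add: K_iff SL2_one integral_iff)

lemma integral_scale_mat: "av c \<le> 1 \<Longrightarrow> integral A \<Longrightarrow> integral (scale_mat c A)"
  by (auto simp: integral_iff scale_mat_def intro: av_le_1_mult)

lemma av_pi_power_le_1: "av (\<pi> ^ n) \<le> 1"
  using uniformizer by (simp add: av_power power_le_one)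

lemma integral_scale_mat_mono:
  assumes "integral (scale_mat (\<pi> ^ m) A)" "m \<le> n"
  shows "integral (scale_mat (\<pi> ^ n) A)"
proof -
  have "scale_mat (\<pi> ^ n) A = scale_mat (\<pi> ^ (n - m)) (scale_mat (\<pi> ^ m) A)"
    using assms(2) by (simp add: scale_mat_def mult.assoc[symmetric] power_add[symmetric])
  then show ?thesis using integral_scale_mat assms(1) av_pi_power_le_1 by presburger
qed

lemma integral_scale_mat_exists: "\<exists>n. integral (scale_mat (\<pi> ^ n) A)"
proof -
  have "\<exists>n. av (\<pi> ^ n * x) \<le> 1" for x
  proof -
    obtain n where n: "av \<pi> ^ n < 1 / (av x + 1)"
      using real_arch_pow_inv[of "1 / (av x + 1)" "av \<pi>"] uniformizer av_nonneg[of x] by auto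
    have "av (\<pi> ^ n * x) \<le> (1 / (av x + 1)) * av x"
      unfolding av_mult av_power using n av_nonneg[of x] by (intro mult_right_mono) auto
    also have "\<dots> \<le> 1" using av_nonneg[of x] by simp
    finally show ?thesis by blast
  qed
  then obtain n where n: "\<And>x. av (\<pi> ^ n x * x) \<le> 1" by metis
  define N where "N = max (max (n (A$1$1)) (n (A$1$2))) (max (n (A$2$1)) (n (A$2$2)))"
  have "av (\<pi> ^ N * x) \<le> 1" if "n x \<le> N" for x
  proof -
    have "\<pi> ^ N * x = \<pi> ^ (N - n x) * (\<pi> ^ n x * x)"
      using that by (simp add: mult.assoc[symmetric] power_add[symmetric])
    moreover have "av (\<pi> ^ (N - n x) * (\<pi> ^ n x * x)) \<le> 1" by (intro av_le_1_mult av_pi_power_le_1 n)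
    ultimately show ?thesis by (simp only:)
  qed
  then have "integral (scale_mat (\<pi> ^ N) A)" by (auto simp: integral_iff scale_mat_def N_def)
  then show ?thesis by blast
qed

text \<open>The distance of the vertex \<open>K A\<close> from the origin, for \<open>A\<close> in \<open>G\<close>.  It is the logarithm of the maximum norm of the
  entries, which makes its behaviour under products and \<open>K\<close> immediate.\<close>

definition deg :: "'f^2^2 \<Rightarrow> nat" where "deg A = (LEAST n. integral (scale_mat (\<pi> ^ n) A))"

lemma deg_le_iff: "deg A \<le> n \<longleftrightarrow> integral (scale_mat (\<pi> ^ n) A)"
proof
  assume "deg A \<le> n"
  moreover have "integral (scale_mat (\<pi> ^ deg A) A)"
    unfolding deg_def using integral_scale_mat_exists by (rule LeastI_ex)
  ultimately show "integral (scale_mat (\<pi> ^ n) A)" using integral_scale_mat_mono by blast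
next
  assume "integral (scale_mat (\<pi> ^ n) A)"
  then show "deg A \<le> n" unfolding deg_def by (rule Least_le)
qed

lemma deg_mult_le: "deg (A ** B) \<le> deg A + deg B"
proof -
  have "scale_mat (\<pi> ^ (deg A + deg B)) (A ** B) = scale_mat (\<pi> ^ deg A) A ** scale_mat (\<pi> ^ deg B) B"
    by (simp add: matrix_simps power_add algebra_simps)
  then show ?thesis
    unfolding deg_le_iff using integral_mult deg_le_iff[of A "deg A"] deg_le_iff[of B "deg B"] by simp
qed

lemma scale_mat_1 [simp]: "scale_mat 1 A = A"
  by (simp add: matrix_simps)

lemma deg_eq_0_iff: "g \<in> G \<Longrightarrow> deg g = 0 \<longleftrightarrow> g \<in> K"
  using deg_le_iff[of g 0] by (simp add: K_iff)

lemma deg_K: "k \<in> K \<Longrightarrow> deg k = 0"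
  using deg_eq_0_iff K_sub_G by blast

lemma deg_K_left:
  assumes "k \<in> K"
  shows "deg (k ** A) = deg A"
proof (rule antisym)
  show "deg (k ** A) \<le> deg A" using deg_mult_le[of k A] deg_K[OF assms] by simp
  show "deg A \<le> deg (k ** A)"
    using deg_mult_le[of "inv2 k" "k ** A"] deg_K[OF K_inv2[OF assms]] K_sub_G[OF assms] by simp
qed

lemma deg_K_right:
  assumes "k \<in> K"
  shows "deg (A ** k) = deg A"
proof (rule antisym)
  show "deg (A ** k) \<le> deg A" using deg_mult_le[of A k] deg_K[OF assms] by simp
  show "deg A \<le> deg (A ** k)"
    using deg_mult_le[of "A ** k" "inv2 k"] deg_K[OF K_inv2[OF assms]] K_sub_G[OF assms] by simp
qed

lemma deg_inv2: "deg (inv2 A) = deg A"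
proof -
  have "deg (inv2 A) \<le> deg A" for A
    unfolding deg_le_iff using deg_le_iff[of A "deg A"] by (simp add: integral_iff inv2_def scale_mat_def)
  from this[of A] this[of "inv2 A"] show ?thesis by simp
qed

definition torus :: "nat \<Rightarrow> 'f^2^2" where "torus n = mat2 (inverse \<pi> ^ n) 0 0 (\<pi> ^ n)"

lemma torus_nth [simp]: "torus n $ 1 $ 1 = inverse \<pi> ^ n" "torus n $ 1 $ 2 = 0" "torus n $ 2 $ 1 = 0" "torus n $ 2 $ 2 = \<pi> ^ n"
  by (simp_all add: torus_def)

lemma torus_G: "torus n \<in> G"
  by (simp add: SL2_UNIV_iff flip: power_mult_distrib)

lemma torus_0: "torus 0 = mat 1"
  by (simp add: matrix_simps)

lemma torus_mult: "torus m ** torus n = torus (m + n)"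
  by (simp add: matrix_simps power_add)

lemma inv2_torus_mult: "inv2 (torus 1) ** torus (Suc n) = torus n"
  using inv2_cancel(1)[OF torus_G[of 1], of "torus n"] by (simp add: torus_mult)

lemma deg_torus: "deg (torus n) = n"
proof (rule antisym)
  show "deg (torus n) \<le> n"
    unfolding deg_le_iff using av_le_1_mult[OF av_pi_power_le_1[of n] av_pi_power_le_1[of n]]
    by (simp add: integral_iff scale_mat_def power_inverse)
  show "n \<le> deg (torus n)"
  proof (rule ccontr)
    assume "\<not> n \<le> deg (torus n)"
    then have "integral (scale_mat (\<pi> ^ (n - 1)) (torus n))" "n > 0" unfolding deg_le_iff[symmetric] by auto
    then have "av (\<pi> ^ (n - 1) * inverse \<pi> ^ n) \<le> 1" by (simp add: integral_iff scale_mat_def)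
    moreover have "\<pi> ^ (n - 1) * inverse \<pi> ^ n = inverse \<pi>"
      using \<open>n > 0\<close> by (cases n) (simp_all flip: power_mult_distrib add: mult.left_commute)
    ultimately have "inverse (av \<pi>) \<le> 1" by (simp add: av_inverse)
    then show False using uniformizer one_less_inverse[of "av \<pi>"] by simp
  qed
qed

lemma cartan_decomposition:
  assumes "g \<in> G"
  shows "\<exists>k\<in>K. \<exists>l\<in>K. g = k ** torus (deg g) ** l"
proof (cases "deg g = 0")
  case True
  then show ?thesis using deg_eq_0_iff[OF assms] K_one by (intro bexI[of _ g] bexI[of _ "mat 1"]) (simp_all add: torus_0)
next
  case False
  define n where "n = deg g"
  \<comment> \<open>if the upper left entry is a largest one, row and column elimination stay inside \<open>K\<close>\<close>
  have top: "\<exists>k\<in>K. \<exists>l\<in>K. h = k ** torus n ** l" if h: "h \<in> G" "deg h = n" "av (\<pi> ^ n * h$1$1) = 1" for h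
  proof -
    let ?a = "h$1$1" and ?u = "\<pi> ^ n * h$1$1"
    have a0: "?a \<noteq> 0" using h(3) by auto
    have av_a: "av ?a = inverse (av (\<pi> ^ n))"
      using h(3) av_mult by (metis inverse_unique)
    have int: "integral (scale_mat (\<pi> ^ n) h)" using deg_le_iff[of h n] h by simp
    have ratio: "av (x / ?a) \<le> 1" if "av (\<pi> ^ n * x) \<le> 1" for x
      using that by (simp add: av_inverse av_a av_mult mult.commute divide_inverse)
    define u where "u = ?u"
    let ?k = "mat2 u 0 (u * (h$2$1 / ?a)) (inverse u)" and ?l = "mat2 1 (h$1$2 / ?a) 0 1"
    have u: "u \<noteq> 0" "av u = 1" using h(3) by (auto simp: u_def)
    have "?k \<in> K"
    proof -
      have "av (h$2$1 / ?a) \<le> 1" using int ratio[of "h$2$1"] by (simp add: integral_iff scale_mat_def)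
      then have "av (u * (h$2$1 / ?a)) \<le> 1" using u by (intro av_le_1_mult) simp_all
      then show ?thesis using u by (simp add: K_iff SL2_UNIV_iff integral_iff av_inverse)
    qed
    moreover have "?l \<in> K"
      using int ratio[of "h$1$2"] by (auto simp: K_iff SL2_UNIV_iff integral_iff scale_mat_def)
    moreover have "h = ?k ** torus n ** ?l"
      using h(1) a0 by (simp add: SL2_UNIV_iff matrix_simps u_def field_simps)
    ultimately show ?thesis by blast
  qed
  \<comment> \<open>minimality of \<open>n\<close> and discreteness of the valuation\<close>
  have "\<exists>i j. av (\<pi> ^ n * g$i$j) = 1"
  proof -
    have "\<not> deg g \<le> n - 1" using False by (simp add: n_def)
    then obtain i j where ij: "\<not> av (\<pi> ^ (n - 1) * g$i$j) \<le> 1"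
      unfolding deg_le_iff by (auto simp: integral_iff scale_mat_def)
    have "av (\<pi> ^ n * g$i$j) \<le> 1"
      using deg_le_iff[of g n] exhaust_2[of i] exhaust_2[of j] by (auto simp: n_def integral_iff scale_mat_def)
    moreover have "\<not> av (\<pi> ^ n * g$i$j) < 1"
    proof
      assume "av (\<pi> ^ n * g$i$j) < 1"
      then have "av (\<pi> * (\<pi> ^ (n - 1) * g$i$j)) \<le> av \<pi> * 1"
        using uniformizer(3) False by (cases n) (auto simp: n_def mult.assoc)
      then show False using ij uniformizer(1) by (simp add: av_mult)
    qed
    ultimately show ?thesis by fastforce
  qed
  then obtain i j where ij: "av (\<pi> ^ n * g$i$j) = 1" by blast
  \<comment> \<open>the Weyl element moves that entry to the upper left corner\<close>
  let ?w = "mat2 0 1 (- 1) 0 :: 'f^2^2"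
  have w: "?w \<in> K" by (simp add: K_iff SL2_UNIV_iff integral_iff)
  have "\<exists>k\<in>K. \<exists>l\<in>K. av (\<pi> ^ n * (k ** g ** l) $1$1) = 1"
  proof -
    define s where "s i = (if i = 1 then mat 1 else ?w)" for i :: 2
    have "av (\<pi> ^ n * (s i ** g ** inv2 (s j)) $1$1) = 1"
      using ij exhaust_2[of i] exhaust_2[of j] by (auto simp: matrix_simps s_def)
    moreover have "s i \<in> K" "inv2 (s j) \<in> K" using w K_one K_inv2 by (auto simp: s_def)
    ultimately show ?thesis by blast
  qed
  then obtain k l where kl: "k \<in> K" "l \<in> K" "av (\<pi> ^ n * (k ** g ** l) $1$1) = 1" by blast
  then obtain k' l' where kl': "k' \<in> K" "l' \<in> K" "k ** g ** l = k' ** torus n ** l'"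
    using top[of "k ** g ** l"] assms by (auto simp: SL2_mult K_sub_G deg_K_left deg_K_right n_def)
  have "g ** l ** inv2 l = g" using kl(2) K_sub_G by (intro inv2_cancel(3)) auto
  moreover have "inv2 k ** (k ** (g ** l)) = g ** l" using kl(1) K_sub_G by (intro inv2_cancel(1)) auto
  ultimately have "g = inv2 k ** (k ** (g ** l)) ** inv2 l" by simp
  also have "\<dots> = inv2 k ** (k ** g ** l) ** inv2 l" by (simp only: matrix_mul_assoc)
  also have "\<dots> = (inv2 k ** k') ** torus n ** (l' ** inv2 l)"
    unfolding kl'(3) by (simp add: matrix_mul_assoc)
  finally have "g = (inv2 k ** k') ** torus (deg g) ** (l' ** inv2 l)" unfolding n_def .
  moreover have "inv2 k ** k' \<in> K" "l' ** inv2 l \<in> K" using kl kl' by (simp_all add: K_mult K_inv2)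
  ultimately show ?thesis by blast
qed

text \<open>The bound on \<open>x ** torus (Suc n)\<close> forces the first column of \<open>x\<close> to be divisible by \<open>\<pi>\<close>.  In the tree this says
  that \<open>torus n\<close> gives the only neighbour of the vertex of \<open>torus (n + 1)\<close> that is closer to the origin.\<close>

lemma descending_neighbour:
  assumes x: "x \<in> G" "deg x = 1" and le: "deg (x ** torus (Suc n)) \<le> n"
  shows "x ** torus 1 \<in> K"
proof -
  have "integral (scale_mat (\<pi> ^ n) (x ** torus (Suc n)))" using le by (simp add: deg_le_iff)
  then have le': "av (\<pi> ^ n * (x$i$1 * inverse \<pi> ^ Suc n)) \<le> 1" for i
    using exhaust_2[of i] by (auto simp: integral_iff matrix_simps)
  have "\<pi> ^ n * (y * inverse \<pi> ^ Suc n) = y * inverse \<pi>" for y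
    by (simp add: field_simps)
  then have "av (x$i$1 * inverse \<pi>) \<le> 1" for i using le'[of i] by (simp only:)
  moreover have "integral (scale_mat (\<pi> ^ 1) x)" using deg_le_iff[of x 1] x by simp
  ultimately show ?thesis
    using SL2_mult[OF x(1) torus_G[of 1]] by (auto simp: K_iff integral_iff matrix_simps mult.commute)
qed

abbreviation "upper b \<equiv> mat2 1 b 0 (1::'f)"
abbreviation "lower c \<equiv> mat2 1 0 c (1::'f)"

lemma upper_K: "av b \<le> 1 \<Longrightarrow> upper b \<in> K" and lower_K: "av b \<le> 1 \<Longrightarrow> lower b \<in> K"
  by (simp_all add: K_iff SL2_UNIV_iff integral_iff)

lemma upper_torus: "upper b ** torus n = torus n ** upper (\<pi> ^ (2 * n) * b)"
  by (simp add: matrix_simps field_simps power_mult power2_eq_square power_mult_distrib)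

lemma torus_lower: "torus n ** lower c = lower (\<pi> ^ (2 * n) * c) ** torus n"
  by (simp add: matrix_simps field_simps power_mult power2_eq_square power_mult_distrib)

definition coset :: "'f^2^2 \<Rightarrow> ('f^2^2) set" where "coset x = (\<lambda>k. k ** x) ` K"

lemma coset_self: "x \<in> coset x"
  unfolding coset_def using K_one by (intro image_eqI[of _ _ "mat 1"]) simp_all

lemma coset_eqI:
  assumes "k \<in> K" shows "coset (k ** x) = coset x"
proof (intro equalityI subsetI)
  fix y assume "y \<in> coset (k ** x)"
  then obtain l where "l \<in> K" "y = l ** (k ** x)" by (auto simp: coset_def)
  then show "y \<in> coset x" unfolding coset_def using K_mult assms by (intro image_eqI[of _ _ "l ** k"]) (simp_all add: matrix_mul_assoc)
next
  fix y assume "y \<in> coset x"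
  then obtain l where "l \<in> K" "y = l ** x" by (auto simp: coset_def)
  then show "y \<in> coset (k ** x)" unfolding coset_def using K_mult K_inv2 assms K_sub_G
    by (intro image_eqI[of _ _ "l ** inv2 k"]) (simp_all add: matrix_mul_assoc[symmetric])
qed

lemma coset_eq_iff:
  assumes "x \<in> G" "y \<in> G"
  shows "coset x = coset y \<longleftrightarrow> x ** inv2 y \<in> K"
proof
  assume "coset x = coset y"
  then have "x \<in> coset y" using coset_self by blast
  then show "x ** inv2 y \<in> K" using assms by (auto simp: coset_def)
next
  assume "x ** inv2 y \<in> K"
  from coset_eqI[OF this, of y] show "coset x = coset y"
    using assms by (simp add: matrix_mul_assoc[symmetric] inv2_left)
qed

text \<open>Balls in the tree are finite: the coset of \<open>x\<close> is determined by the entries of \<open>\<pi>^n x\<close> modulo \<open>\<pi>^(2 n)\<close>.\<close>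

lemma finite_cosets: "finite (coset ` {x\<in>G. deg x \<le> n})"
proof -
  obtain R where R: "finite R" "\<And>x. av x \<le> 1 \<Longrightarrow> \<exists>\<rho>\<in>R. av (x - \<rho>) \<le> av \<pi> ^ (2 * n)"
    using finite_representatives[of \<pi> "2 * n"] uniformizer by blast
  then obtain \<rho> where \<rho>: "\<And>x. av x \<le> 1 \<Longrightarrow> \<rho> x \<in> R \<and> av (x - \<rho> x) \<le> av \<pi> ^ (2 * n)" by metis
  define app where "app x = (\<rho> (\<pi> ^ n * x$1$1), \<rho> (\<pi> ^ n * x$1$2), \<rho> (\<pi> ^ n * x$2$1), \<rho> (\<pi> ^ n * x$2$2))"
    for x :: "'f^2^2"
  let ?D = "{x\<in>G. deg x \<le> n}"
  have "app ` ?D \<subseteq> R \<times> R \<times> R \<times> R"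
    using \<rho> by (auto simp: app_def deg_le_iff integral_iff scale_mat_def)
  then have fin: "finite (app ` ?D)" using R(1) finite_subset by blast
  \<comment> \<open>if \<open>x = y + \<pi>^n m\<close> with \<open>m\<close> integral then \<open>x y^-1 = 1 + m (\<pi>^n y^-1)\<close> is integral\<close>
  have eq: "coset x = coset y" if x: "x \<in> ?D" and y: "y \<in> ?D" and a: "app x = app y" for x y
  proof -
    let ?m = "\<lambda>i j. (x$i$j - y$i$j) * inverse \<pi> ^ n"
    define m where "m = mat2 (?m 1 1) (?m 1 2) (?m 2 1) (?m 2 2)"
    have "av (?m i j) \<le> 1" for i j
    proof -
      let ?x = "\<pi> ^ n * x$i$j" and ?y = "\<pi> ^ n * y$i$j"
      have xy: "av ?x \<le> 1" "av ?y \<le> 1"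
        using x y exhaust_2[of i] exhaust_2[of j] by (auto simp: deg_le_iff integral_iff scale_mat_def)
      have "\<rho> ?x = \<rho> ?y"
        using a exhaust_2[of i] exhaust_2[of j] by (auto simp: app_def)
      then have "av (?x - ?y) \<le> av \<pi> ^ (2 * n)"
        using av_le_diff[of "?x - \<rho> ?x" "av \<pi> ^ (2 * n)" "?y - \<rho> ?y"] \<rho>[OF xy(1)] \<rho>[OF xy(2)] by simp
      moreover have "?m i j = (?x - ?y) / \<pi> ^ (2 * n)"
        by (simp add: field_simps power_mult power2_eq_square power_mult_distrib)
      then have "av (?m i j) = av (?x - ?y) / av \<pi> ^ (2 * n)" by (simp only: av_divide av_power)
      ultimately show ?thesis
        using uniformizer by (simp add: divide_le_eq_1)
    qed
    then have m: "integral m" by (simp add: integral_iff m_def)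
    have "x = y + scale_mat (\<pi> ^ n) m"
      by (simp add: matrix_simps m_def field_simps)
    then have "x ** inv2 y = mat 1 + m ** scale_mat (\<pi> ^ n) (inv2 y)"
      using y by (simp add: SL2_UNIV_iff matrix_simps algebra_simps)
    moreover have "integral (m ** scale_mat (\<pi> ^ n) (inv2 y))"
      using m y by (intro integral_mult) (simp_all add: deg_inv2 flip: deg_le_iff)
    ultimately have "integral (x ** inv2 y)"
      by (auto simp: integral_iff intro!: av_le_add)
    then show ?thesis using x y by (simp add: coset_eq_iff K_iff SL2_mult SL2_inv2)
  qed
  define s where "s z = coset (SOME x. x \<in> ?D \<and> app x = z)" for z
  have "coset x = s (app x)" if "x \<in> ?D" for x
    unfolding s_def using someI[of "\<lambda>y. y \<in> ?D \<and> app y = app x" x] that by (intro eq) auto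
  then have "coset ` ?D \<subseteq> s ` app ` ?D" by auto
  then show ?thesis using finite_subset[OF _ finite_imageI[OF fin]] by blast
qed

end

section \<open>The weight on integral matrices\<close>

lemma sum_fun_apply: "(\<Sum>x\<in>A. f x) y = (\<Sum>x\<in>A. f x y)"
  for f :: "'a \<Rightarrow> 'b \<Rightarrow> 'c::comm_monoid_add"
  by (induction A rule: infinite_finite_induct) simp_all

abbreviation (input) vscale :: "'k \<Rightarrow> ('i \<Rightarrow> 'k) \<Rightarrow> 'i \<Rightarrow> 'k::field" where
  "vscale c w \<equiv> (\<lambda>i. c * w i)"

lemma lambda_zero: "(\<lambda>_. 0) = 0" 
  by (simp add: fun_eq_iff)

lemma zero_index_apply: "i < e \<Longrightarrow> zero_index e i = 0"
  by (simp add: zero_index_def)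

lemma weight_unit_apply: "weight_unit l m = (if m = l then 1 else 0)"
  by (simp add: weight_unit_def)

lemma weight_space_iff: "w \<in> weight_space e r \<longleftrightarrow> (\<forall>l. l \<notin> weight_index e r \<longrightarrow> w l = 0)"
  by (simp add: weight_space_def)

lemma weight_space_closed:
  "0 \<in> weight_space e r"
  "v \<in> weight_space e r \<Longrightarrow> w \<in> weight_space e r \<Longrightarrow> v + w \<in> weight_space e r"
  "w \<in> weight_space e r \<Longrightarrow> vscale c w \<in> weight_space e r"
  by (auto simp: weight_space_iff)

lemma weight_space_sum:
  "(\<And>x. x \<in> X' \<Longrightarrow> f x \<in> weight_space e r) \<Longrightarrow> sum f X' \<in> weight_space e r"
  by (induction X' rule: infinite_finite_induct) (auto simp: weight_space_closed)

lemma weight_space_expand: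
  assumes "w \<in> weight_space e r"
  shows "w = (\<Sum>l\<in>weight_index e r. vscale (w l) (weight_unit l))"
proof
  fix m
  have "(\<Sum>l\<in>weight_index e r. w l * weight_unit l m) = (\<Sum>l\<in>weight_index e r. if l = m then w l else 0)"
    by (intro sum.cong) (auto simp: weight_unit_def)
  also have "\<dots> = w m" using assms by (auto simp: weight_space_iff)
  finally show "w m = (\<Sum>l\<in>weight_index e r. vscale (w l) (weight_unit l)) m"
    by (simp add: sum_fun_apply)
qed

definition linear_on_weight :: "nat \<Rightarrow> (nat \<Rightarrow> nat) \<Rightarrow> (((nat \<Rightarrow> nat) \<Rightarrow> 'k::field) \<Rightarrow> 'i \<Rightarrow> 'k) \<Rightarrow> bool" where
  "linear_on_weight e r M \<longleftrightarrow>
     (\<forall>v\<in>weight_space e r. \<forall>w\<in>weight_space e r. M (v + w) = M v + M w) \<and>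
     (\<forall>c. \<forall>w\<in>weight_space e r. M (vscale c w) = vscale c (M w))"

lemma linear_on_weight_expand:
  assumes M: "linear_on_weight e r M" and w: "w \<in> weight_space e r"
  shows "M w j = (\<Sum>l\<in>weight_index e r. w l * M (weight_unit l) j)"
proof -
  have M0: "M 0 = 0"
    using M weight_space_closed(1)[of e r] unfolding linear_on_weight_def
    by (metis add_cancel_right_right add.right_neutral)
  have "M (sum f X') = (\<Sum>x\<in>X'. M (f x)) \<and> sum f X' \<in> weight_space e r"
    if "finite X'" "\<And>x. x \<in> X' \<Longrightarrow> f x \<in> weight_space e r" for f :: "(nat \<Rightarrow> nat) \<Rightarrow> _" and X'
    using that
  proof (induction X')
    case (insert x F)
    then have "M (sum f F) = (\<Sum>x\<in>F. M (f x))" "sum f F \<in> weight_space e r" "f x \<in> weight_space e r"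
      by auto
    then have "M (f x + sum f F) = M (f x) + (\<Sum>x\<in>F. M (f x))" "f x + sum f F \<in> weight_space e r"
      using M by (auto simp: linear_on_weight_def intro: weight_space_closed)
    then have "M (sum f (insert x F)) = (\<Sum>x\<in>insert x F. M (f x)) \<and> sum f (insert x F) \<in> weight_space e r"
      unfolding sum.insert[OF insert.hyps] by blast
    then show ?case .
  next
    case empty
    have "M (sum f {}) = (\<Sum>x\<in>{}. M (f x)) \<and> sum f {} \<in> weight_space e r"
      by (simp add: M0 weight_space_closed)
    then show ?case .
  qed
  moreover have "vscale (w l) (weight_unit l) \<in> weight_space e r" if "l \<in> weight_index e r" for l
    using that by (intro weight_space_closed weight_unit_space)
  ultimately have "M (\<Sum>l\<in>weight_index e r. vscale (w l) (weight_unit l)) =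
      (\<Sum>l\<in>weight_index e r. M (vscale (w l) (weight_unit l)))" by simp
  also have "\<dots> = (\<Sum>l\<in>weight_index e r. vscale (w l) (M (weight_unit l)))"
    using M by (intro sum.cong refl) (simp add: linear_on_weight_def weight_unit_space)
  finally show ?thesis using weight_space_expand[OF w] by (simp add: sum_fun_apply)
qed

locale weight_setting = uniformized_field av \<pi>
  for av :: "'f::field \<Rightarrow> real" and \<pi> :: 'f +
  fixes \<iota> :: "'f set \<Rightarrow> 'k::field" and p e :: nat and r :: "nat \<Rightarrow> nat"
  assumes prime_p: "Factorial_Ring.prime p"
    and card_residue_field: "card (carrier (residue_field av)) = p ^ e"
    and char_k: "CHAR('k) = p"
    and embedding: "\<iota> \<in> ring_hom (residue_field av) (ring_of_type_algebra :: 'k ring)"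
    and restricted: "i < e \<Longrightarrow> r i < p"
begin

abbreviation "V \<equiv> weight_space e r :: ((nat \<Rightarrow> nat) \<Rightarrow> 'k) set"
abbreviation "index \<equiv> weight_index e r"
abbreviation "l0 \<equiv> zero_index e"

definition red :: "'f \<Rightarrow> 'k" where "red x = \<iota> (max_ideal av +>\<^bsub>valuation_ring av\<^esub> x)"

lemma red_hom: "red \<in> ring_hom (valuation_ring av) (ring_of_type_algebra :: 'k ring)"
  using ring_hom_trans[OF ideal.rcos_ring_hom[OF max_ideal_ideal] embedding[unfolded residue_field_def]]
  by (simp add: red_def[abs_def] comp_def)

lemma red_simps:
  "av x \<le> 1 \<Longrightarrow> av y \<le> 1 \<Longrightarrow> red (x + y) = red x + red y"
  "av x \<le> 1 \<Longrightarrow> av y \<le> 1 \<Longrightarrow> red (x * y) = red x * red y"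
  "red 1 = 1"
  using red_hom by (auto simp: ring_hom_def ring_of_type_algebra_def)

lemma red_cong: "av (x - y) < 1 \<Longrightarrow> red x = red y"
  unfolding red_def by (simp add: residue_class_eq)

lemma red_0 [simp]: "red 0 = 0"
  using red_simps(1)[of 0 0] by (metis add_0 add_cancel_left_left av_0 zero_le_one)

lemma red_eq_0: "av x < 1 \<Longrightarrow> red x = 0"
  using red_cong[of x 0] by simp

lemma red_eq_0_iff:
  assumes "av x \<le> 1" shows "red x = 0 \<longleftrightarrow> av x < 1"
proof
  assume "red x = 0"
  show "av x < 1"
  proof (rule ccontr)
    assume "\<not> av x < 1"
    then have "av x = 1" using assms by simp
    then have "x \<noteq> 0" "av (inverse x) = 1" by (auto simp: av_inverse)
    then have "red x * red (inverse x) = 1" using red_simps(2)[of x "inverse x"] \<open>av x = 1\<close> red_simps(3) by simp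
    then show False using \<open>red x = 0\<close> by simp
  qed
qed (rule red_eq_0)

lemma finite_residues: "finite (red ` {x. av x \<le> 1})"
  and card_residues: "card (red ` {x. av x \<le> 1}) = p ^ e"
proof -
  let ?c = "\<lambda>x. max_ideal av +>\<^bsub>valuation_ring av\<^esub> x"
  have carrier: "carrier (residue_field av) = ?c ` {x. av x \<le> 1}"
    by (simp add: residue_field_def FactRing_def A_RCOSETS_def' UNION_singleton_eq_range)
  have "inj_on \<iota> (carrier (residue_field av))"
  proof (rule inj_onI)
    fix X' Y assume "X' \<in> carrier (residue_field av)" "Y \<in> carrier (residue_field av)" and eq: "\<iota> X' = \<iota> Y"
    then obtain x y where xy: "X' = ?c x" "Y = ?c y" "av x \<le> 1" "av y \<le> 1"
      unfolding carrier by blast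
    then have "red x = red y" using eq by (simp add: red_def)
    moreover have "red x = red (x - y) + red y" using red_simps(1)[of "x - y" y] xy av_le_diff by simp
    ultimately have "red (x - y) = 0" by simp
    then have "av (x - y) < 1" using red_eq_0_iff[of "x - y"] av_le_diff xy by simp
    then show "X' = Y" using residue_class_eq xy by simp
  qed
  moreover have "red ` {x. av x \<le> 1} = \<iota> ` carrier (residue_field av)"
    unfolding carrier by (simp add: image_image red_def)
  ultimately show "finite (red ` {x. av x \<le> 1})" "card (red ` {x. av x \<le> 1}) = p ^ e"
    using finite_residue_field card_residue_field by (simp_all add: card_image)
qed

lemma reduction_nth: "reduction av \<iota> A $ i $ j = red (A $ i $ j)"
  by (simp add: reduction_def red_def)

lemma reduction_mat2: "reduction av \<iota> (mat2 a b c d) = mat2 (red a) (red b) (red c) (red d)"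
  by (simp add: mat2_eq_iff reduction_nth)

lemma reduction_mult:
  "integral A \<Longrightarrow> integral B \<Longrightarrow> reduction av \<iota> (A ** B) = reduction av \<iota> A ** reduction av \<iota> B"
  by (simp add: mat2_eq_iff reduction_nth matrix_mult_2 red_simps av_le_1_mult integral_iff)

text \<open>The weight, extended from \<open>K\<close> to all integral matrices.\<close>

definition rho :: "'f^2^2 \<Rightarrow> ((nat \<Rightarrow> nat) \<Rightarrow> 'k) \<Rightarrow> (nat \<Rightarrow> nat) \<Rightarrow> 'k" where
  "rho A = weight_action p e r (reduction av \<iota> A)"

lemma rho_V: "rho A w \<in> V"
  by (simp add: rho_def weight_action_space)

lemma rho_add: "rho A (v + w) = rho A v + rho A w"
  unfolding rho_def plus_fun_def by (rule weight_action_add)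

lemma rho_scale: "rho A (vscale c w) = vscale c (rho A w)"
  by (simp add: rho_def weight_action_scale)

lemma rho_0 [simp]: "rho A 0 = 0"
  using weight_action_zero[of p e r "reduction av \<iota> A"] by (simp add: rho_def lambda_zero)

lemma rho_sum: "rho A (sum f X') = (\<Sum>x\<in>X'. rho A (f x))"
  using sum_comp_morphism[of "rho A" f X'] by (simp add: rho_add comp_def)

lemma rho_mult: "integral A \<Longrightarrow> integral B \<Longrightarrow> rho A (rho B w) = rho (A ** B) w"
  by (simp add: rho_def weight_action_mult[OF prime_p char_k] reduction_mult)

lemma rho_one: "w \<in> V \<Longrightarrow> rho (mat 1) w = w"
proof -
  assume "w \<in> V"
  moreover have "reduction av \<iota> (mat 1) = mat 1"
    by (simp add: mat2_eq_iff reduction_nth red_simps)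
  ultimately show ?thesis using weight_action_one[OF prime_p] by (simp add: rho_def)
qed

lemma rho_inv2: "k \<in> K \<Longrightarrow> w \<in> V \<Longrightarrow> rho (inv2 k) (rho k w) = w"
  using K_sub_G[of k] by (simp add: rho_mult K_iff integral_inv2 inv2_left rho_one)

lemma rho_eq_0_iff: "k \<in> K \<Longrightarrow> w \<in> V \<Longrightarrow> rho k w = 0 \<longleftrightarrow> w = 0"
  using rho_inv2[of k w] by auto

lemma rho_small_upper: "av b < 1 \<Longrightarrow> w \<in> V \<Longrightarrow> rho (upper b) w = w"
proof -
  assume "av b < 1" "w \<in> V"
  moreover from this have "reduction av \<iota> (upper b) = reduction av \<iota> (mat 1)"
    by (simp add: mat2_eq_iff reduction_nth red_eq_0)
  ultimately show ?thesis using rho_one[of w] by (simp add: rho_def)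
qed

lemma rho_small_lower: "av b < 1 \<Longrightarrow> w \<in> V \<Longrightarrow> rho (lower b) w = w"
proof -
  assume "av b < 1" "w \<in> V"
  moreover from this have "reduction av \<iota> (lower b) = reduction av \<iota> (mat 1)"
    by (simp add: mat2_eq_iff reduction_nth red_eq_0)
  ultimately show ?thesis using rho_one[of w] by (simp add: rho_def)
qed

text \<open>Modulo \<open>\<pi>\<close> the matrix is \<open>diag(1, 0)\<close>.\<close>

lemma rho_edge: "rho (scale_mat \<pi> (torus 1)) w = vscale (w l0) (weight_unit l0)"
proof -
  have "av (\<pi> * \<pi>) < 1 * 1"
    unfolding av_mult using uniformizer by (intro mult_strict_mono) auto
  then have "reduction av \<iota> (scale_mat \<pi> (torus 1)) = mat2 1 0 0 0"
    by (simp add: mat2_eq_iff reduction_nth scale_mat_def red_simps red_eq_0)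
  then show ?thesis by (simp add: rho_def weight_action_idempotent[OF prime_p])
qed

lemma rho_upper:
  "rho (upper b) w l0 = (\<Sum>l\<in>index. w l * red b ^ base_p p e l)"
  by (simp add: rho_def reduction_mat2 red_simps weight_action_upper[OF prime_p])

lemma rho_lower:
  "l \<in> index \<Longrightarrow> rho (lower c) (weight_unit l0) l = (\<Prod>i<e. of_nat (r i choose l i)) * red c ^ base_p p e l"
  by (simp add: rho_def reduction_mat2 red_simps weight_action_lower[OF prime_p])

lemma residue_combination_eq_0:
  assumes "\<And>x. av x \<le> 1 \<Longrightarrow> (\<Sum>l\<in>index. a l * red x ^ base_p p e l) = 0" "l \<in> index"
  shows "a l = 0"
proof (rule base_p_combination_eq_0[where r = r and e = e and a = a and l = l, OF restricted finite_residues])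
  show "p ^ e \<le> card (red ` {x. av x \<le> 1})" by (simp add: card_residues)
qed (use assms in auto)

lemma base_p_l0 [simp]: "base_p p e l0 = 0"
  by (simp add: base_p_def zero_index_def)

text \<open>The highest weight coordinates of all upper unipotent translates determine a vector: they are the values of a polynomial
  that has the coordinates of \<open>w\<close> as coefficients.\<close>

lemma detected_by_upper:
  assumes w: "w \<in> V" and zero: "\<And>b. av b \<le> 1 \<Longrightarrow> rho (upper b) w l0 = 0"
  shows "w = 0"
proof
  fix l show "w l = 0 l"
    using residue_combination_eq_0[of w l] zero w by (cases "l \<in> index") (auto simp: rho_upper weight_space_iff)
qed

text \<open>The coordinate at \<open>X^r\<close> of the translates of a fixed vector is constant, and a polynomial of degree less than \<open>q\<close>
  that is constant on the residues has no coefficients but the constant one.\<close>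

lemma upper_invariant:
  assumes w: "w \<in> V" and inv: "\<And>b. av b \<le> 1 \<Longrightarrow> rho (upper b) w = w"
  shows "w = vscale (w l0) (weight_unit l0)"
proof
  fix l
  define a where "a j = w j - w l0 * weight_unit l0 j" for j
  have "(\<Sum>j\<in>index. a j * red x ^ base_p p e j) = 0" if "av x \<le> 1" for x
  proof -
    have "(\<Sum>j\<in>index. a j * red x ^ base_p p e j) =
        rho (upper x) w l0 - (\<Sum>j\<in>index. if j = l0 then w l0 else 0)"
      unfolding rho_upper sum_subtractf[symmetric]
      by (intro sum.cong refl) (simp add: a_def weight_unit_def left_diff_distrib)
    then show ?thesis using inv[OF that] by simp
  qed
  then have "l \<in> index \<Longrightarrow> a l = 0" using residue_combination_eq_0 by blast
  then show "w l = w l0 * weight_unit l0 l"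
    using w by (cases "l \<in> index") (auto simp: a_def weight_unit_def weight_space_iff)
qed

text \<open>The lower unipotent translates of \<open>X^r\<close> span the weight: their coordinates are monomials in the parameter with
  distinct exponents, multiplied by binomial coefficients that are nonzero modulo \<open>p\<close>.\<close>

lemma lower_combination_eq_0:
  assumes zero: "\<And>c. av c \<le> 1 \<Longrightarrow> (\<Sum>l\<in>index. rho (lower c) (weight_unit l0) l * a l) = 0" and l: "l \<in> index"
  shows "a l = 0"
proof -
  define b where "b l = a l * (\<Prod>i<e. of_nat (r i choose l i))" for l
  have "(\<Sum>l\<in>index. b l * red x ^ base_p p e l) = 0" if "av x \<le> 1" for x
    unfolding zero[OF that, symmetric] by (intro sum.cong refl) (simp add: b_def rho_lower mult_ac)
  then have "b l = 0" using residue_combination_eq_0 l by blast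
  moreover have "(\<Prod>i<e. of_nat (r i choose l i) :: 'k) \<noteq> 0"
    using of_nat_binomial_nonzero[OF prime_p char_k] restricted weight_index_le[OF l] by simp
  ultimately show ?thesis by (simp add: b_def)
qed

lemma rho_l0_V [simp]: "weight_unit l0 \<in> V"
  by (simp add: weight_unit_space)

text \<open>A map whose image is fixed by the upper unipotent matrices and that is constant on orbits of the lower ones is
  determined by its value on \<open>X^r\<close>, which has to be a multiple of \<open>X^r\<close>.\<close>

lemma edge_map_scalar:
  assumes M: "linear_on_weight e r M" "\<And>v. v \<in> V \<Longrightarrow> M v \<in> V"
    and up: "\<And>b v. av b \<le> 1 \<Longrightarrow> v \<in> V \<Longrightarrow> rho (upper b) (M v) = M v"
    and lo: "\<And>c v. av c \<le> 1 \<Longrightarrow> v \<in> V \<Longrightarrow> M (rho (lower c) v) = M v"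
  shows "\<exists>c. \<forall>v\<in>V. M v = vscale (c * v l0) (weight_unit l0)"
proof -
  define c where "c = M (weight_unit l0) l0"
  \<comment> \<open>\<open>M\<close> is constant on the lower unipotent translates of \<open>X^r\<close>; expanding these in the standard basis shows
    that the differences below vanish\<close>
  define a where "a j l = M (weight_unit l) j - weight_unit l0 l * M (weight_unit l0) j" for j l
  have "(\<Sum>l\<in>index. rho (lower x) (weight_unit l0) l * a j l) = 0" if x: "av x \<le> 1" for x j
  proof -
    have "(\<Sum>l\<in>index. rho (lower x) (weight_unit l0) l * M (weight_unit l) j) = M (weight_unit l0) j"
      using linear_on_weight_expand[OF M(1) rho_V, of "lower x" "weight_unit l0" j] lo[OF x, of "weight_unit l0"] by simp
    moreover have "(\<Sum>l\<in>index. rho (lower x) (weight_unit l0) l * (weight_unit l0 l * M (weight_unit l0) j)) =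
        (\<Sum>l\<in>index. if l = l0 then M (weight_unit l0) j else 0)"
    proof (intro sum.cong refl)
      fix l
      have "rho (lower x) (weight_unit l0) l0 = 1"
        by (simp add: rho_lower zero_index_apply)
      then show "rho (lower x) (weight_unit l0) l * (weight_unit l0 l * M (weight_unit l0) j) =
          (if l = l0 then M (weight_unit l0) j else 0)"
        by (cases "l = l0") (simp_all add: weight_unit_apply)
    qed
    ultimately show ?thesis by (simp add: a_def right_diff_distrib sum_subtractf)
  qed
  then have a0: "a j l = 0" if "l \<in> index" for j l
    using lower_combination_eq_0[of "a j" l] that by simp
  have eq: "M (weight_unit l) j = weight_unit l0 l * M (weight_unit l0) j" if "l \<in> index" for j l
    using a0[OF that, of j] unfolding a_def by simp
  have "M v = vscale (c * v l0) (weight_unit l0)" if v: "v \<in> V" for v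
  proof -
    have "M v j = v l0 * M (weight_unit l0) j" for j
    proof -
      have "M v j = (\<Sum>l\<in>index. v l * (weight_unit l0 l * M (weight_unit l0) j))"
        unfolding linear_on_weight_expand[OF M(1) v] by (rule sum.cong[OF refl]) (simp only: eq)
      also have "\<dots> = (\<Sum>l\<in>index. if l = l0 then v l0 * M (weight_unit l0) j else 0)"
        by (intro sum.cong refl) (simp add: weight_unit_def)
      finally show ?thesis by simp
    qed
    moreover have "M (weight_unit l0) = vscale c (weight_unit l0)"
      unfolding c_def by (intro upper_invariant M up) simp_all
    then have "M (weight_unit l0) j = c * weight_unit l0 j" for j by (rule fun_cong)
    ultimately have "M v j = c * v l0 * weight_unit l0 j" for j by (simp only: mult_ac)
    then show ?thesis by (intro ext)
  qed
  then show ?thesis by blast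
qed

text \<open>Schur's lemma for the weight.  The scalar is the eigenvalue at \<open>X^r\<close>, the only vector up to scalars that is fixed by the upper
  unipotent matrices, and \<open>X^r\<close> generates the weight.\<close>

lemma vertex_map_scalar:
  assumes M: "linear_on_weight e r M" "\<And>v. v \<in> V \<Longrightarrow> M v \<in> V"
    and K: "\<And>k v. k \<in> K \<Longrightarrow> v \<in> V \<Longrightarrow> M (rho k v) = rho k (M v)"
  shows "\<exists>c. \<forall>v\<in>V. M v = vscale c v"
proof -
  define c where "c = M (weight_unit l0) l0"
  \<comment> \<open>\<open>N\<close> kills \<open>X^r\<close>, whose lower unipotent translates span the weight\<close>
  define N where "N v = M v - vscale c v" for v
  have N: "linear_on_weight e r N"
    using M(1) by (auto simp: linear_on_weight_def N_def fun_eq_iff algebra_simps)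
  \<comment> \<open>\<open>X^r\<close> is fixed by \<open>upper b\<close>: it is the image of \<open>\<pi> torus(1)\<close>, which conjugates \<open>upper b\<close> into a
    matrix congruent to \<open>1\<close>\<close>
  have "rho (upper b) (weight_unit l0) = weight_unit l0" if b: "av b \<le> 1" for b
  proof -
    have fixed: "rho (scale_mat \<pi> (torus 1)) (weight_unit l0) = weight_unit l0"
      unfolding rho_edge by (simp add: fun_eq_iff weight_unit_def)
    have int: "integral (scale_mat \<pi> (torus 1))" using deg_le_iff[of "torus 1" 1] by (simp add: deg_torus)
    have small: "av (\<pi> ^ 2 * b) < 1"
    proof -
      have "av (\<pi> ^ 2 * b) \<le> av \<pi> ^ 2 * 1"
        unfolding av_mult av_power using b by (intro mult_left_mono) auto
      also have "\<dots> < 1" using uniformizer by (simp add: power_less_one_iff)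
      finally show ?thesis .
    qed
    have "rho (upper b) (rho (scale_mat \<pi> (torus 1)) (weight_unit l0)) = rho (scale_mat \<pi> (upper b ** torus 1)) (weight_unit l0)"
      using upper_K[OF b] int by (simp add: rho_mult K_iff scale_mat_mult(2))
    also have "\<dots> = rho (scale_mat \<pi> (torus 1)) (rho (upper (\<pi> ^ 2 * b)) (weight_unit l0))"
      using upper_K[of "\<pi> ^ 2 * b"] small int by (simp add: upper_torus rho_mult K_iff scale_mat_mult(1))
    finally show ?thesis using small fixed by (simp add: rho_small_upper)
  qed
  then have "M (weight_unit l0) = vscale c (weight_unit l0)"
    unfolding c_def by (intro upper_invariant M) (simp_all add: K[symmetric] upper_K)
  then have N0: "N (weight_unit l0) = 0" by (simp add: N_def fun_eq_iff)
  have NK: "N (rho k v) = rho k (N v)" if "k \<in> K" "v \<in> V" for k v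
  proof -
    have "rho k (M v) = rho k (N v + vscale c v)" by (simp add: N_def fun_eq_iff)
    then show ?thesis using K[OF that] by (simp only: rho_add rho_scale) (simp add: N_def fun_eq_iff)
  qed
  have "N (weight_unit l) j = 0" if "l \<in> index" for l j
  proof (rule lower_combination_eq_0[OF _ that])
    fix x assume x: "av x \<le> 1"
    have "N (rho (lower x) (weight_unit l0)) j = 0" using NK[OF lower_K[OF x]] N0 by simp
    then show "(\<Sum>l\<in>index. rho (lower x) (weight_unit l0) l * N (weight_unit l) j) = 0"
      using linear_on_weight_expand[OF N rho_V, of "lower x" "weight_unit l0" j] by simp
  qed
  then have "N v j = 0" if "v \<in> V" for v j
    using linear_on_weight_expand[OF N that, of j] by simp
  then have "\<forall>v\<in>V. M v = vscale c v" by (auto simp: N_def fun_eq_iff)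
  then show ?thesis by blast
qed

end

section \<open>Compact induction and the Hecke operator\<close>

abbreviation (input) fscale :: "'k::field \<Rightarrow> ('g \<Rightarrow> 'i \<Rightarrow> 'k) \<Rightarrow> 'g \<Rightarrow> 'i \<Rightarrow> 'k" where
  "fscale c f \<equiv> (\<lambda>g i. c * f g i)"

context weight_setting
begin

abbreviation "ind \<equiv> ind_weight av \<iota> p e r"

lemma G_cancel_left:
  assumes "k \<in> G" shows "k ** g \<in> G \<longleftrightarrow> g \<in> G"
proof
  assume "k ** g \<in> G"
  then have "inv2 k ** (k ** g) \<in> G" by (rule SL2_mult[OF SL2_inv2[OF assms]])
  then show "g \<in> G" using assms by simp
qed (rule SL2_mult[OF assms])

lemma K_cancel_left:
  assumes "k \<in> K" shows "k ** g \<in> K \<longleftrightarrow> g \<in> K"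
proof
  assume "k ** g \<in> K"
  then have "inv2 k ** (k ** g) \<in> K" by (rule K_mult[OF K_inv2[OF assms]])
  then show "g \<in> K" using K_sub_G[OF assms] by simp
qed (rule K_mult[OF assms])

text \<open>As balls in the tree are finite, the support is a finite union of cosets if and only if its degree is bounded.\<close>

lemma ind_iff:
  "f \<in> ind \<longleftrightarrow> (\<forall>g. g \<notin> G \<longrightarrow> f g = 0) \<and> (\<forall>g. f g \<in> V) \<and>
     (\<forall>k\<in>K. \<forall>g. f (k ** g) = rho k (f g)) \<and> (\<exists>n. \<forall>g. f g \<noteq> 0 \<longrightarrow> deg g < n)"
    (is "_ \<longleftrightarrow> ?R")
proof -
  have unfold: "f \<in> ind \<longleftrightarrow> (\<forall>g. g \<notin> G \<longrightarrow> f g = 0) \<and> (\<forall>g\<in>G. f g \<in> V) \<and>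
     (\<forall>k\<in>K. \<forall>g\<in>G. f (k ** g) = rho k (f g)) \<and>
     (\<exists>S\<subseteq>G. finite S \<and> {g\<in>G. f g \<noteq> 0} = (\<Union>g\<in>S. coset g))"
    unfolding ind_weight_def compact_ind_def rho_def coset_def lambda_zero by simp
  show ?thesis
  proof
    assume "f \<in> ind"
    note f' = this[unfolded unfold]
    note f = f'[THEN conjunct1, rule_format] f'[THEN conjunct2, THEN conjunct1, rule_format]
      f'[THEN conjunct2, THEN conjunct2, THEN conjunct1, rule_format]
    from f'[THEN conjunct2, THEN conjunct2, THEN conjunct2]
    obtain S where S: "finite S" "{g\<in>G. f g \<noteq> 0} = (\<Union>g\<in>S. coset g)"
      by (elim exE conjE)
    have "f g \<in> V" for g
    proof (cases "g \<in> G")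
      case False
      show ?thesis unfolding f(1)[OF False] by (rule weight_space_closed(1))
    qed (rule f(2))
    moreover have "f (k ** g) = rho k (f g)" if "k \<in> K" for k g
    proof (cases "g \<in> G")
      case False
      then have "k ** g \<notin> G" using G_cancel_left[OF K_sub_G[OF that]] by simp
      then show ?thesis using f(1)[OF False] f(1) by simp
    qed (use f that in blast)
    moreover have "deg g < Suc (Max (deg ` S))" if "f g \<noteq> 0" for g
    proof -
      have "g \<in> (\<Union>g\<in>S. coset g)" using that f(1) S(2) by blast
      then obtain s k where "s \<in> S" "k \<in> K" "g = k ** s" by (auto simp: coset_def)
      then show ?thesis using S(1) by (simp add: deg_K_left less_Suc_eq_le)
    qed
    ultimately show ?R using f(1) by blast
  next
    assume R: ?R
    then obtain n where n: "\<And>g. f g \<noteq> 0 \<Longrightarrow> deg g < n" by blast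
    let ?X = "{g\<in>G. f g \<noteq> 0}"
    define S where "S = (\<lambda>C. SOME x. x \<in> ?X \<and> coset x = C) ` coset ` ?X"
    have "coset ` ?X \<subseteq> coset ` {x\<in>G. deg x \<le> n}" using n less_imp_le by blast
    then have finite_S: "finite S" unfolding S_def using finite_cosets finite_subset by blast
    have S: "\<exists>s\<in>S. s \<in> ?X \<and> coset s = coset x" if "x \<in> ?X" for x
      using someI[of "\<lambda>y. y \<in> ?X \<and> coset y = coset x" x] that unfolding S_def by blast
    have SX: "s \<in> ?X" if "s \<in> S" for s
      using that someI[of "\<lambda>y. y \<in> ?X \<and> coset y = coset x" x for x] unfolding S_def by fastforce
    have "?X = (\<Union>g\<in>S. coset g)"
    proof (intro equalityI subsetI)
      fix x assume "x \<in> ?X"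
      then obtain s where "s \<in> S" "coset s = coset x" using S by blast
      then show "x \<in> (\<Union>g\<in>S. coset g)" using coset_self[of x] by auto
    next
      fix x assume "x \<in> (\<Union>g\<in>S. coset g)"
      then obtain s k where s: "s \<in> S" "k \<in> K" "x = k ** s" by (auto simp: coset_def)
      then have "f x = rho k (f s)" "f s \<in> V" "f s \<noteq> 0" "s \<in> G" using R SX by blast+
      then show "x \<in> ?X" using s(2,3) rho_eq_0_iff SL2_mult[OF K_sub_G[OF s(2)]] by simp
    qed
    moreover have "S \<subseteq> G" using SX by blast
    moreover note finite_S
    ultimately have "\<exists>S\<subseteq>G. finite S \<and> ?X = (\<Union>g\<in>S. coset g)" by blast
    then show "f \<in> ind" unfolding unfold using R by simp
  qed
qed

definition filt :: "nat \<Rightarrow> ('f^2^2 \<Rightarrow> (nat \<Rightarrow> nat) \<Rightarrow> 'k) set" where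
  "filt n = {f \<in> ind. \<forall>g. f g \<noteq> 0 \<longrightarrow> deg g < n}"

lemma filt_iff:
  "f \<in> filt n \<longleftrightarrow> (\<forall>g. g \<notin> G \<longrightarrow> f g = 0) \<and> (\<forall>g. f g \<in> V) \<and>
     (\<forall>k\<in>K. \<forall>g. f (k ** g) = rho k (f g)) \<and> (\<forall>g. f g \<noteq> 0 \<longrightarrow> deg g < n)"
  unfolding filt_def ind_iff by blast

lemma ind_filt: "ind = (\<Union>n. filt n)"
proof (intro equalityI subsetI)
  fix f assume f: "f \<in> ind"
  then obtain n where "\<forall>g. f g \<noteq> 0 \<longrightarrow> deg g < n" unfolding ind_iff by blast
  then have "f \<in> filt n" using f unfolding filt_def by blast
  then show "f \<in> (\<Union>n. filt n)" by blast
qed (auto simp: filt_def)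

lemma indD:
  assumes "f \<in> ind"
  shows "g \<notin> G \<Longrightarrow> f g = 0" "f g \<in> V" "k \<in> K \<Longrightarrow> f (k ** g) = rho k (f g)"
  using assms unfolding ind_iff by blast+

lemma filt_ind: "f \<in> filt n \<Longrightarrow> f \<in> ind" and filt_bound: "f \<in> filt n \<Longrightarrow> n \<le> deg g \<Longrightarrow> f g = 0"
  unfolding filt_def by (auto simp: not_less[symmetric])

text \<open>By the Cartan decomposition and equivariance, the values on the sphere of radius \<open>n\<close> are determined by those at \<open>torus n ** k\<close>.\<close>

lemma filt_eqI:
  assumes f: "f \<in> filt (Suc n)" and zero: "\<And>k. k \<in> K \<Longrightarrow> f (torus n ** k) = 0"
  shows "f \<in> filt n"
proof -
  have "deg g < n" if "f g \<noteq> 0" for g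
  proof (rule ccontr)
    assume "\<not> deg g < n"
    moreover have g: "g \<in> G" "deg g < Suc n" using f that unfolding filt_iff by blast+
    ultimately have "deg g = n" by simp
    then obtain k l where kl: "k \<in> K" "l \<in> K" "g = k ** torus n ** l" using cartan_decomposition[OF g(1)] by blast
    then have "f g = rho k (f (torus n ** l))"
      using indD(3)[OF filt_ind[OF f] kl(1), of "torus n ** l"] by (simp only: matrix_mul_assoc)
    then show False using zero[OF kl(2)] that by simp
  qed
  then show ?thesis using filt_ind[OF f] unfolding filt_def by blast
qed

lemma filt_subspace:
  "0 \<in> filt n"
  "f \<in> filt n \<Longrightarrow> f' \<in> filt n \<Longrightarrow> f + f' \<in> filt n"
  "f \<in> filt n \<Longrightarrow> fscale c f \<in> filt n"
proof -
  show "0 \<in> filt n" by (simp add: filt_iff weight_space_closed)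
  show "f + f' \<in> filt n" if f: "f \<in> filt n" "f' \<in> filt n"
    unfolding filt_iff
  proof (intro conjI allI ballI impI)
    show "deg g < n" if "(f + f') g \<noteq> 0" for g
    proof (rule ccontr)
      assume "\<not> deg g < n"
      then show False using that filt_bound[OF f(1), of g] filt_bound[OF f(2), of g] by simp
    qed
  qed (use indD[OF filt_ind[OF f(1)]] indD[OF filt_ind[OF f(2)]] in \<open>simp_all add: weight_space_closed rho_add\<close>)
  show "fscale c f \<in> filt n" if f: "f \<in> filt n"
    unfolding filt_iff
  proof (intro conjI allI ballI impI)
    show "deg g < n" if "vscale c (f g) \<noteq> 0" for g
    proof (rule ccontr)
      assume "\<not> deg g < n"
      then have "f g = 0" using filt_bound[OF f, of g] by simp
      then show False using that by (simp add: lambda_zero)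
    qed
    show "vscale c (f g) = 0" if "g \<notin> G" for g
      using indD(1)[OF filt_ind[OF f] that] by (simp add: lambda_zero)
    show "vscale c (f (k ** g)) = rho k (vscale c (f g))" if "k \<in> K" for k g
      unfolding rho_scale using indD(3)[OF filt_ind[OF f] that] by simp
  qed (use indD(2)[OF filt_ind[OF f]] in \<open>simp add: weight_space_closed\<close>)
qed

lemma filt_Suc: "filt n \<subseteq> filt (Suc n)"
  unfolding filt_def by auto

lemma filt_0: "filt 0 = {0}"
  using filt_subspace(1)[of 0] by (auto simp: filt_def fun_eq_iff)

lemma filt_mono: "m \<le> n \<Longrightarrow> filt m \<subseteq> filt n"
  by (rule lift_Suc_mono_le[of filt, OF filt_Suc])

lemma ind_subspace:
  "0 \<in> ind" "f \<in> ind \<Longrightarrow> f' \<in> ind \<Longrightarrow> f + f' \<in> ind" "f \<in> ind \<Longrightarrow> fscale c f \<in> ind"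
proof -
  show "0 \<in> ind" using filt_subspace(1) filt_ind by blast
  show "f + f' \<in> ind" if f: "f \<in> ind" "f' \<in> ind"
  proof -
    obtain m n where "f \<in> filt m" "f' \<in> filt n" using f[unfolded ind_filt] by blast
    then have "f \<in> filt (max m n)" "f' \<in> filt (max m n)"
      using filt_mono[of m "max m n"] filt_mono[of n "max m n"] by auto
    then show ?thesis using filt_subspace(2) filt_ind by blast
  qed
  show "fscale c f \<in> ind" if "f \<in> ind" using that filt_subspace(3) unfolding ind_filt by blast
qed

lemma right_translate_ind:
  assumes f: "f \<in> filt n" and h: "h \<in> G"
  shows "right_translate h f \<in> filt (n + deg h)"
  unfolding filt_iff
proof (intro conjI allI ballI impI)
  show "right_translate h f g = 0" if "g \<notin> G" for g
  proof -
    have "g ** h \<notin> G" using that h SL2_mult[of "g ** h" "inv2 h"] SL2_inv2[OF h] by auto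
    then show ?thesis using indD(1)[OF filt_ind[OF f]] by (simp add: right_translate_def)
  qed
  show "right_translate h f g \<in> V" for g
    using indD(2)[OF filt_ind[OF f]] by (simp add: right_translate_def)
  show "right_translate h f (k ** g) = rho k (right_translate h f g)" if "k \<in> K" for k g
    using indD(3)[OF filt_ind[OF f] that, of "g ** h"] by (simp add: right_translate_def matrix_mul_assoc)
  show "deg g < n + deg h" if "right_translate h f g \<noteq> 0" for g
  proof -
    have "deg (g ** h) < n" using that filt_bound[OF f, of "g ** h"] by (auto simp: right_translate_def not_less[symmetric])
    then show ?thesis using deg_mult_le[of "g ** h" "inv2 h"] h by (simp add: deg_inv2)
  qed
qed

text \<open>These sections supported at the origin generate the compactly induced representation, so an equivariant map is
  determined by its values on them; this is Frobenius reciprocity.\<close>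

definition delta :: "((nat \<Rightarrow> nat) \<Rightarrow> 'k) \<Rightarrow> 'f^2^2 \<Rightarrow> (nat \<Rightarrow> nat) \<Rightarrow> 'k" where
  "delta v = (\<lambda>g. if g \<in> K then rho g v else 0)"

lemma delta_filt: "delta v \<in> filt 1"
  unfolding filt_iff
proof (intro conjI allI ballI impI)
  show "delta v (k ** g) = rho k (delta v g)" if "k \<in> K" for k g
    using that by (simp add: delta_def K_cancel_left) (simp add: rho_mult K_iff)
qed (auto simp: delta_def K_sub_G rho_V weight_space_closed deg_K split: if_splits)

lemma delta_one: "v \<in> V \<Longrightarrow> delta v (mat 1) = v"
  by (simp add: delta_def K_one rho_one)

lemma delta_add: "delta (v + w) = delta v + delta w"
  by (auto simp: delta_def rho_add fun_eq_iff)

lemma delta_scale: "delta (vscale c w) = fscale c (delta w)"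
  by (auto simp: delta_def rho_scale fun_eq_iff)

lemma delta_translate:
  assumes "k \<in> K" shows "right_translate k (delta v) = delta (rho k v)"
proof
  fix g
  have "g ** k \<in> K \<longleftrightarrow> g \<in> K"
    using assms K_mult[of g k] K_mult[of "g ** k" "inv2 k"] K_inv2[OF assms] K_sub_G[OF assms] by auto
  then show "right_translate k (delta v) g = delta (rho k v) g"
    using assms by (auto simp: right_translate_def delta_def rho_mult K_iff)
qed

definition coset_rep :: "('f^2^2) set \<Rightarrow> 'f^2^2" where "coset_rep C = (SOME x. x \<in> C)"

lemma coset_rep_exists: "\<exists>k\<in>K. coset_rep (coset x) = k ** x"
proof -
  have "coset_rep (coset x) \<in> coset x" unfolding coset_rep_def using coset_self by (rule someI)
  then show ?thesis by (auto simp: coset_def)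
qed

text \<open>A section is the sum of its restrictions to single vertices, and each of these is a translate of a
  section supported at the origin.\<close>

lemma ind_generated:
  assumes f: "f \<in> filt n"
  shows "f = (\<Sum>C\<in>coset ` {x\<in>G. deg x \<le> n}. right_translate (inv2 (coset_rep C)) (delta (f (coset_rep C))))"
proof
  fix g
  let ?N = "coset ` {x\<in>G. deg x \<le> n}"
  let ?t = "\<lambda>C. right_translate (inv2 (coset_rep C)) (delta (f (coset_rep C))) g"
  have rG: "coset_rep C \<in> G \<and> coset (coset_rep C) = C" if C: "C \<in> ?N" for C
  proof -
    obtain x where x: "x \<in> G" "C = coset x" using C by blast
    then obtain k where "k \<in> K" "coset_rep C = k ** x" using coset_rep_exists by blast
    then show ?thesis using x coset_eqI SL2_mult K_sub_G by metis
  qed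
  have "?t C = (if C = coset g then f g else 0)" if C: "C \<in> ?N" for C
  proof (cases "g ** inv2 (coset_rep C) \<in> K")
    case True
    have r: "coset_rep C \<in> G" "coset (coset_rep C) = C" using rG[OF C] by auto
    have g: "g = (g ** inv2 (coset_rep C)) ** coset_rep C" using r by simp
    then have "coset g = C" using coset_eqI[OF True, of "coset_rep C"] r by simp
    moreover have "?t C = rho (g ** inv2 (coset_rep C)) (f (coset_rep C))" using True by (simp add: right_translate_def delta_def)
    moreover have "\<dots> = f g" using indD(3)[OF filt_ind[OF f] True, of "coset_rep C"] g by simp
    ultimately show ?thesis by simp
  next
    case False
    then have t0: "?t C = 0" by (simp add: right_translate_def delta_def)
    show ?thesis
    proof (cases "C = coset g")
      case True
      have "g \<notin> G"
      proof
        assume "g \<in> G"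
        then show False using False coset_eq_iff[of g "coset_rep C"] rG[OF C] True by simp
      qed
      then show ?thesis using t0 indD(1)[OF filt_ind[OF f]] by simp
    qed (use t0 in simp)
  qed
  then have "(\<Sum>C\<in>?N. ?t C) = (\<Sum>C\<in>?N. if C = coset g then f g else 0)" by simp
  also have "\<dots> = (if coset g \<in> ?N then f g else 0)" using finite_cosets by simp
  also have "\<dots> = f g"
  proof (cases "f g = 0")
    case False
    then have "g \<in> G" "deg g < n" using f unfolding filt_iff by blast+
    then show ?thesis by (auto intro!: imageI)
  qed simp
  finally show "f g = (\<Sum>C\<in>?N. right_translate (inv2 (coset_rep C)) (delta (f (coset_rep C)))) g" by (simp add: sum_fun_apply)
qed

definition neighbours :: "('f^2^2) set set" where "neighbours = coset ` {x\<in>G. deg x = 1}"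

text \<open>The Hecke operator has to come from a function \<open>\<phi>\<close> on \<open>K torus(1) K\<close> with values in the endomorphisms of
  the weight that satisfies \<open>\<phi> (k g l) = rho k \<circ> \<phi> g \<circ> rho l\<close>.  Taking for \<open>\<phi> g\<close> the symmetric power of the
  singular matrix \<open>\<pi> g\<close> modulo \<open>\<pi>\<close> makes this an instance of multiplicativity.  The term below is the contribution of
  the vertex \<open>K x g\<close> to the value at \<open>g\<close>.\<close>

definition contrib :: "('f^2^2 \<Rightarrow> (nat \<Rightarrow> nat) \<Rightarrow> 'k) \<Rightarrow> 'f^2^2 \<Rightarrow> 'f^2^2 \<Rightarrow> (nat \<Rightarrow> nat) \<Rightarrow> 'k" where
  "contrib f g x = rho (scale_mat \<pi> (inv2 x)) (f (x ** g))"

definition T :: "('f^2^2 \<Rightarrow> (nat \<Rightarrow> nat) \<Rightarrow> 'k) \<Rightarrow> 'f^2^2 \<Rightarrow> (nat \<Rightarrow> nat) \<Rightarrow> 'k" where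
  "T f g = (\<Sum>C\<in>neighbours. contrib f g (coset_rep C))"

lemma finite_neighbours: "finite neighbours"
  unfolding neighbours_def by (rule finite_subset[OF _ finite_cosets[of 1]]) auto

lemma neighbour_rep:
  assumes "C \<in> neighbours" shows "coset_rep C \<in> G" "deg (coset_rep C) = 1" "coset (coset_rep C) = C"
proof -
  obtain x where x: "x \<in> G" "deg x = 1" "C = coset x" using assms by (auto simp: neighbours_def)
  then obtain k where "k \<in> K" "coset_rep C = k ** x" using coset_rep_exists by blast
  then show "coset_rep C \<in> G" "deg (coset_rep C) = 1" "coset (coset_rep C) = C"
    using x by (simp_all add: SL2_mult K_sub_G deg_K_left coset_eqI)
qed

lemma integral_neighbour: "deg x = 1 \<Longrightarrow> integral (scale_mat \<pi> (inv2 x))"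
  using deg_le_iff[of "inv2 x" 1] by (simp add: deg_inv2)

text \<open>The factor \<open>k\<close> cancels between the kernel and \<open>f\<close>, so that the contribution is well defined for the vertex
  \<open>K x g\<close>.\<close>

lemma contrib_left:
  assumes f: "f \<in> ind" and k: "k \<in> K" and x: "deg x = 1"
  shows "contrib f g (k ** x) = contrib f g x"
proof -
  have "contrib f g (k ** x) = rho (scale_mat \<pi> (inv2 x) ** inv2 k) (rho k (f (x ** g)))"
    using indD(3)[OF f k, of "x ** g"] by (simp add: contrib_def inv2_mult scale_mat_mult(1) matrix_mul_assoc)
  also have "\<dots> = contrib f g x"
    using k x K_sub_G[OF k] by (simp add: contrib_def rho_mult integral_mult integral_neighbour integral_inv2 K_iff)
  finally show ?thesis .
qed

lemma contrib_coset:
  assumes "f \<in> ind" "deg x = 1"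
  shows "contrib f g (coset_rep (coset x)) = contrib f g x"
  using coset_rep_exists[of x] contrib_left[OF assms(1) _ assms(2)] by auto

lemma T_add: "T (f + f') = T f + T f'"
  by (rule ext) (simp add: T_def contrib_def rho_add sum.distrib)

lemma T_scale: "T (fscale c f) = fscale c (T f)"
  by (rule ext) (simp add: T_def contrib_def rho_scale sum_fun_apply sum_distrib_left fun_eq_iff)

lemma T_translate: "T (right_translate h f) = right_translate h (T f)"
  by (rule ext) (simp add: T_def contrib_def right_translate_def matrix_mul_assoc)

lemma T_equivariant:
  assumes f: "f \<in> ind" and k: "k \<in> K"
  shows "T f (k ** g) = rho k (T f g)"
proof -
  have kG: "k \<in> G" using K_sub_G[OF k] .
  \<comment> \<open>right translation by \<open>k\<close> permutes the cosets over which the sum extends\<close>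
  let ?b = "\<lambda>C. coset (coset_rep C ** k)"
  have bij: "bij_betw ?b neighbours neighbours"
  proof (rule bij_betw_byWitness[where f' = "\<lambda>C. coset (coset_rep C ** inv2 k)"])
    have inv: "coset (coset_rep (coset (coset_rep C ** l)) ** inv2 l) = C" if C: "C \<in> neighbours" and l: "l \<in> K" for C l
    proof -
      obtain m where m: "m \<in> K" "coset_rep (coset (coset_rep C ** l)) = m ** (coset_rep C ** l)" using coset_rep_exists by blast
      then have "coset_rep (coset (coset_rep C ** l)) ** inv2 l = m ** coset_rep C"
        using K_sub_G[OF l] by (simp add: matrix_mul_assoc)
      then show ?thesis using coset_eqI[OF m(1)] neighbour_rep(3)[OF C] by simp
    qed
    show "\<forall>C\<in>neighbours. coset (coset_rep (?b C) ** inv2 k) = C" using inv k by blast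
    show "\<forall>C\<in>neighbours. coset (coset_rep (coset (coset_rep C ** inv2 k)) ** k) = C"
      using inv[OF _ K_inv2[OF k]] by simp
    have im: "coset (coset_rep C ** l) \<in> neighbours" if "C \<in> neighbours" "l \<in> K" for C l
      unfolding neighbours_def using neighbour_rep[OF that(1)] that(2) by (intro imageI) (simp add: SL2_mult K_sub_G deg_K_right)
    show "?b ` neighbours \<subseteq> neighbours" "(\<lambda>C. coset (coset_rep C ** inv2 k)) ` neighbours \<subseteq> neighbours"
      using im k K_inv2[OF k] by auto
  qed
  have "T f (k ** g) = (\<Sum>C\<in>neighbours. rho k (contrib f g (coset_rep (?b C))))"
    unfolding T_def
  proof (rule sum.cong[OF refl])
    fix C assume C: "C \<in> neighbours"
    have d: "deg (coset_rep C ** k) = 1" using neighbour_rep(2)[OF C] deg_K_right[OF k] by simp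
    have "rho k (contrib f g (coset_rep C ** k)) = rho (k ** scale_mat \<pi> (inv2 (coset_rep C ** k))) (f (coset_rep C ** (k ** g)))"
      using k integral_neighbour[OF d] by (simp add: contrib_def rho_mult K_iff matrix_mul_assoc)
    also have "k ** scale_mat \<pi> (inv2 (coset_rep C ** k)) = scale_mat \<pi> (inv2 (coset_rep C))"
      using kG by (simp add: scale_mat_mult(2)[symmetric] inv2_mult)
    finally show "contrib f (k ** g) (coset_rep C) = rho k (contrib f g (coset_rep (?b C)))"
      using contrib_coset[OF f d] by (simp add: contrib_def)
  qed
  also have "\<dots> = rho k (\<Sum>C\<in>neighbours. contrib f g (coset_rep (?b C)))" by (simp add: rho_sum)
  also have "(\<Sum>C\<in>neighbours. contrib f g (coset_rep (?b C))) = T f g"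
    unfolding T_def by (rule sum.reindex_bij_betw[OF bij])
  finally show ?thesis .
qed

lemma T_filt:
  assumes f: "f \<in> filt n"
  shows "T f \<in> filt (Suc n)"
  unfolding filt_iff
proof (intro conjI allI ballI impI)
  show "T f g = 0" if "g \<notin> G" for g
    unfolding T_def
  proof (intro sum.neutral ballI)
    fix C assume "C \<in> neighbours"
    then have "coset_rep C ** g \<notin> G" using that neighbour_rep(1) G_cancel_left by blast
    then show "contrib f g (coset_rep C) = 0" using indD(1)[OF filt_ind[OF f]] by (simp add: contrib_def)
  qed
  show "T f g \<in> V" for g
    unfolding T_def contrib_def by (intro weight_space_sum rho_V)
  show "T f (k ** g) = rho k (T f g)" if "k \<in> K" for k g
    using T_equivariant[OF filt_ind[OF f] that] .
  show "deg g < Suc n" if "T f g \<noteq> 0" for g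
  proof (rule ccontr)
    assume g: "\<not> deg g < Suc n"
    have "T f g = 0"
      unfolding T_def
    proof (intro sum.neutral ballI)
      fix C assume C: "C \<in> neighbours"
      have "deg g \<le> deg (inv2 (coset_rep C)) + deg (coset_rep C ** g)"
        using deg_mult_le[of "inv2 (coset_rep C)" "coset_rep C ** g"] neighbour_rep(1)[OF C] by simp
      then have "n \<le> deg (coset_rep C ** g)" using g neighbour_rep(2)[OF C] by (simp add: deg_inv2)
      then show "contrib f g (coset_rep C) = 0" using filt_bound[OF f] by (simp add: contrib_def)
    qed
    then show False using that by simp
  qed
qed

lemma T_ind: "f \<in> ind \<Longrightarrow> T f \<in> ind"
  using T_filt filt_ind unfolding ind_filt by blast

text \<open>Among the vertices adjacent to an outermost one only the one closer to the origin lies in the support, and its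
  contribution is the projection to \<open>X^r\<close>.\<close>

lemma T_outermost:
  assumes f: "f \<in> filt (Suc n)" and k: "k \<in> K"
  shows "T f (torus (Suc n) ** k) = vscale (f (torus n ** k) l0) (weight_unit l0)"
proof -
  let ?g = "torus (Suc n) ** k" and ?C = "coset (inv2 (torus 1))"
  have a1: "inv2 (torus 1) \<in> G" "deg (inv2 (torus 1)) = 1"
    using torus_G by (auto simp: SL2_inv2 deg_inv2 deg_torus)
  then have C: "?C \<in> neighbours" unfolding neighbours_def by blast
  have "contrib f ?g (coset_rep C) = 0" if "C \<in> neighbours - {?C}" for C
  proof -
    have r: "coset_rep C \<in> G" "deg (coset_rep C) = 1" "coset (coset_rep C) = C" using neighbour_rep that by auto
    have "\<not> deg (coset_rep C ** torus (Suc n)) \<le> n"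
    proof
      assume "deg (coset_rep C ** torus (Suc n)) \<le> n"
      then have "coset_rep C ** torus 1 \<in> K" using descending_neighbour r by blast
      then have "coset (coset_rep C) = ?C" using coset_eq_iff[OF r(1) a1(1)] by simp
      then show False using r(3) that by blast
    qed
    then have "Suc n \<le> deg (coset_rep C ** ?g)" using deg_K_right[OF k] by (simp add: matrix_mul_assoc)
    then show ?thesis using filt_bound[OF f] by (simp add: contrib_def)
  qed
  then have "T f ?g = contrib f ?g (coset_rep ?C)"
    unfolding T_def using sum.mono_neutral_right[OF finite_neighbours, of "{?C}" "\<lambda>C. contrib f ?g (coset_rep C)"] C by simp
  also have "\<dots> = contrib f ?g (inv2 (torus 1))" using contrib_coset[OF filt_ind[OF f] a1(2)] .
  also have "\<dots> = rho (scale_mat \<pi> (torus 1)) (f (torus n ** k))"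
    using inv2_torus_mult[of n] by (simp add: contrib_def matrix_mul_assoc)
  finally show ?thesis unfolding rho_edge .
qed

text \<open>The outermost values of \<open>T f\<close> around the vertex of \<open>torus n ** k\<close> are the highest weight coordinates of all upper
  unipotent translates of \<open>f (torus n ** k)\<close>.\<close>

lemma T_strict_step:
  assumes f: "f \<in> filt (Suc n)" and Tf: "T f \<in> filt (Suc n)"
  shows "f \<in> filt n"
proof (rule filt_eqI[OF f])
  fix k assume k: "k \<in> K"
  show "f (torus n ** k) = 0"
  proof (rule detected_by_upper)
    show "f (torus n ** k) \<in> V" using indD(2)[OF filt_ind[OF f]] .
    fix b assume b: "av b \<le> 1"
    \<comment> \<open>conjugate to \<open>upper b\<close> under \<open>torus n\<close>: the vertex of \<open>torus (n + 1) ** (?u ** k)\<close> varies with \<open>b\<close>, but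
      its neighbour closer to the origin is always that of \<open>torus n ** k\<close>\<close>
    let ?u = "upper (\<pi> ^ (2 * n) * b)"
    have u: "?u \<in> K" using upper_K av_le_1_mult[OF av_pi_power_le_1 b] by blast
    have "deg (torus (Suc n) ** (?u ** k)) = Suc n" using deg_K_right[OF K_mult[OF u k]] by (simp add: deg_torus)
    then have "T f (torus (Suc n) ** (?u ** k)) = 0" using filt_bound[OF Tf] by simp
    then have "vscale (f (torus n ** (?u ** k)) l0) (weight_unit l0) = 0"
      unfolding T_outermost[OF f K_mult[OF u k]] .
    from fun_cong[OF this, of l0] have "f (torus n ** (?u ** k)) l0 = 0" by (simp add: weight_unit_apply)
    moreover have "torus n ** (?u ** k) = upper b ** (torus n ** k)" by (simp add: matrix_mul_assoc upper_torus)
    moreover have "f (upper b ** (torus n ** k)) = rho (upper b) (f (torus n ** k))"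
      using indD(3)[OF filt_ind[OF f] upper_K[OF b]] .
    ultimately show "rho (upper b) (f (torus n ** k)) l0 = 0" by simp
  qed
qed

lemma T_strict:
  assumes "f \<in> filt m" "T f \<in> filt (Suc n)"
  shows "f \<in> filt n"
  using assms(1)
proof (induction m)
  case 0
  then have "f = 0" using filt_0 by auto
  then have "f \<in> filt n" using filt_subspace(1)[of n] by simp
  then show ?case .
next
  case (Suc m)
  show ?case
  proof (cases "m < n")
    case True then show ?thesis using Suc.prems filt_mono[of "Suc m" n] by auto
  next
    case False
    then have "T f \<in> filt (Suc m)" using assms(2) filt_mono[of "Suc n" "Suc m"] by auto
    then show ?thesis using Suc.IH T_strict_step[OF Suc.prems] by blast
  qed
qed

end

section \<open>Equivariant endomorphisms are polynomials in the Hecke operator\<close>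

context weight_setting
begin

lemma vector_space_fscale: "vector_space (\<lambda>c (f :: 'f^2^2 \<Rightarrow> (nat \<Rightarrow> nat) \<Rightarrow> 'k). fscale c f)"
  by unfold_locales (auto simp: fun_eq_iff algebra_simps)

sublocale SF: strict_filtration "\<lambda>c f. fscale c f" filt T
proof -
  interpret vector_space "\<lambda>c (f :: 'f^2^2 \<Rightarrow> (nat \<Rightarrow> nat) \<Rightarrow> 'k). fscale c f"
    by (rule vector_space_fscale)
  show "strict_filtration (\<lambda>c f. fscale c f) filt T"
  proof
    show "subspace (filt n)" for n
      using filt_subspace by (intro subspaceI) blast+
  qed (fact filt_0 filt_Suc T_add T_scale T_filt T_strict)+
qed

lemma Tpow_add: "(T ^^ m) (f + f') = (T ^^ m) f + (T ^^ m) f'"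
  by (induction m) (simp_all only: funpow.simps id_apply comp_apply T_add)

lemma Tpow_scale: "(T ^^ m) (fscale c f) = fscale c ((T ^^ m) f)"
  by (induction m) (simp_all only: funpow.simps id_apply comp_apply T_scale)

lemma Tpow_translate: "(T ^^ m) (right_translate h f) = right_translate h ((T ^^ m) f)"
  by (induction m) (simp_all only: funpow.simps id_apply comp_apply T_translate)

lemma Tpow_ind: "f \<in> ind \<Longrightarrow> (T ^^ m) f \<in> ind"
  by (induction m) (simp_all only: funpow.simps id_apply comp_apply T_ind)

lemma Tpow_delta_filt: "(T ^^ m) (delta v) \<in> filt (Suc m)"
  using SF.T_funpow_A[OF delta_filt[of v], of m] by simp

text \<open>All positive powers of \<open>T\<close> have the same leading value at \<open>delta v\<close>, because the projection to \<open>X^r\<close> is idempotent.\<close>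

lemma Tpow_delta_torus: "v \<in> V \<Longrightarrow> (T ^^ Suc m) (delta v) (torus (Suc m)) = vscale (v l0) (weight_unit l0)"
proof (induction m)
  case 0
  have "T (delta v) (torus (Suc 0) ** mat 1) = vscale (delta v (torus 0 ** mat 1) l0) (weight_unit l0)"
    by (rule T_outermost) (simp_all add: delta_filt K_one flip: One_nat_def)
  then show ?case using delta_one[OF 0] by (simp add: torus_0)
next
  case (Suc m)
  have "T ((T ^^ Suc m) (delta v)) (torus (Suc (Suc m)) ** mat 1) =
      vscale ((T ^^ Suc m) (delta v) (torus (Suc m) ** mat 1) l0) (weight_unit l0)"
    by (rule T_outermost[OF Tpow_delta_filt K_one])
  then have "(T ^^ Suc (Suc m)) (delta v) (torus (Suc (Suc m))) =
      vscale ((T ^^ Suc m) (delta v) (torus (Suc m)) l0) (weight_unit l0)"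
    by (simp only: funpow.simps comp_apply matrix_mul_rid)
  also have "\<dots> = vscale (v l0) (weight_unit l0)"
    unfolding Suc.IH[OF Suc.prems] by (simp add: weight_unit_apply)
  finally show ?case .
qed

definition T_poly :: "nat \<Rightarrow> (nat \<Rightarrow> 'k) \<Rightarrow> ('f^2^2 \<Rightarrow> (nat \<Rightarrow> nat) \<Rightarrow> 'k) \<Rightarrow> 'f^2^2 \<Rightarrow> (nat \<Rightarrow> nat) \<Rightarrow> 'k" where
  "T_poly N a f = (\<Sum>m<N. fscale (a m) ((T ^^ m) f))"

lemma T_poly_apply: "T_poly N a f g i = (\<Sum>m<N. a m * (T ^^ m) f g i)"
  by (simp add: T_poly_def sum_fun_apply)

lemma T_poly_0: "T_poly 0 a f = 0"
  by (simp add: T_poly_def)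

lemma T_poly_Suc: "T_poly (Suc N) a f = T_poly N a f + fscale (a N) ((T ^^ N) f)"
  by (simp add: T_poly_def)

lemma T_poly_cong: "(\<And>m. m < N \<Longrightarrow> a m = a' m) \<Longrightarrow> T_poly N a f = T_poly N a' f"
  unfolding T_poly_def by (intro sum.cong) auto

abbreviation "H \<equiv> hecke_algebra av \<iota> p e r"

lemma hecke_carrier_iff:
  "S \<in> carrier H \<longleftrightarrow> S \<in> extensional ind \<and> (\<forall>f\<in>ind. S f \<in> ind) \<and>
     (\<forall>f\<in>ind. \<forall>f'\<in>ind. S (f + f') = S f + S f') \<and> (\<forall>c. \<forall>f\<in>ind. S (fscale c f) = fscale c (S f)) \<and>
     (\<forall>g\<in>G. \<forall>f\<in>ind. S (right_translate g f) = right_translate g (S f))"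
proof -
  have "(\<lambda>g i. f g i + f' g i) = f + f'" for f f' :: "'f^2^2 \<Rightarrow> (nat \<Rightarrow> nat) \<Rightarrow> 'k"
    by (simp add: fun_eq_iff)
  then show ?thesis unfolding hecke_algebra_def End_ring_def PiE_def Pi_def by (simp add: conj_ac Ball_def)
qed

lemma heckeD:
  assumes "S \<in> carrier H"
  shows "S \<in> extensional ind" "f \<in> ind \<Longrightarrow> S f \<in> ind"
    "f \<in> ind \<Longrightarrow> f' \<in> ind \<Longrightarrow> S (f + f') = S f + S f'" "f \<in> ind \<Longrightarrow> S (fscale c f) = fscale c (S f)"
    "g \<in> G \<Longrightarrow> f \<in> ind \<Longrightarrow> S (right_translate g f) = right_translate g (S f)"
  using assms unfolding hecke_carrier_iff by simp_all

lemma delta_ind: "delta v \<in> ind"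
  using filt_ind[OF delta_filt] .

lemma right_translate_closed: "f \<in> ind \<Longrightarrow> h \<in> G \<Longrightarrow> right_translate h f \<in> ind"
  using right_translate_ind filt_ind unfolding ind_filt by blast

lemma heckeI:
  assumes "\<And>f. f \<in> ind \<Longrightarrow> S f \<in> ind"
    "\<And>f f'. f \<in> ind \<Longrightarrow> f' \<in> ind \<Longrightarrow> S (f + f') = S f + S f'"
    "\<And>c f. f \<in> ind \<Longrightarrow> S (fscale c f) = fscale c (S f)"
    "\<And>g f. g \<in> G \<Longrightarrow> f \<in> ind \<Longrightarrow> S (right_translate g f) = right_translate g (S f)"
  shows "restrict S ind \<in> carrier H"
  unfolding hecke_carrier_iff using assms
  by (simp add: ind_subspace right_translate_closed)

lemma hecke_add_Tpow:
  assumes S: "S \<in> carrier H"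
  shows "(\<lambda>f\<in>ind. S f + fscale c ((T ^^ m) f)) \<in> carrier H"
proof (rule heckeI)
  fix f assume f: "f \<in> ind"
  show "S f + fscale c ((T ^^ m) f) \<in> ind"
    by (intro ind_subspace Tpow_ind heckeD(2)[OF S] f)
  show "S (fscale d f) + fscale c ((T ^^ m) (fscale d f)) = fscale d (S f + fscale c ((T ^^ m) f))" for d
    unfolding Tpow_scale heckeD(4)[OF S f]
    by (intro ext) (simp only: plus_fun_apply distrib_left mult.left_commute)
  show "S (right_translate g f) + fscale c ((T ^^ m) (right_translate g f)) =
      right_translate g (S f + fscale c ((T ^^ m) f))" if "g \<in> G" for g
    unfolding Tpow_translate heckeD(5)[OF S that f] by (simp add: fun_eq_iff right_translate_def)
  show "S (f + f') + fscale c ((T ^^ m) (f + f')) = (S f + fscale c ((T ^^ m) f)) + (S f' + fscale c ((T ^^ m) f'))"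
    if "f' \<in> ind" for f'
    unfolding Tpow_add heckeD(3)[OF S f that] by (simp add: fun_eq_iff algebra_simps)
qed

lemma hecke_zero: "(\<lambda>f\<in>ind. 0) \<in> carrier H"
proof (rule heckeI)
  show "0 \<in> ind" by (rule ind_subspace)
  show "0 = 0 + (0 :: 'f^2^2 \<Rightarrow> (nat \<Rightarrow> nat) \<Rightarrow> 'k)" by simp
  show "0 = fscale c (0 :: 'f^2^2 \<Rightarrow> (nat \<Rightarrow> nat) \<Rightarrow> 'k)" for c by (intro ext) simp
  show "0 = right_translate g (0 :: 'f^2^2 \<Rightarrow> (nat \<Rightarrow> nat) \<Rightarrow> 'k)" for g
    by (intro ext) (simp add: right_translate_def)
qed

lemma T_poly_hecke: "(\<lambda>f\<in>ind. T_poly N a f) \<in> carrier H"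
proof (induction N)
  case 0 show ?case using hecke_zero by (simp only: T_poly_0)
next
  case (Suc N)
  have "(\<lambda>f\<in>ind. T_poly (Suc N) a f) = (\<lambda>f\<in>ind. (\<lambda>f\<in>ind. T_poly N a f) f + fscale (a N) ((T ^^ N) f))"
    by (rule restrict_ext) (simp add: T_poly_Suc)
  then show ?case using hecke_add_Tpow[OF Suc.IH, of "a N" N] by (simp only:)
qed

lemma hecke_sum:
  assumes S: "S \<in> carrier H" and "finite Z" "\<And>x. x \<in> Z \<Longrightarrow> F x \<in> ind"
  shows "sum F Z \<in> ind \<and> S (sum F Z) = (\<Sum>x\<in>Z. S (F x))"
  using assms(2,3)
proof (induction Z rule: finite_induct)
  case empty
  have "S (fscale 0 0) = fscale 0 (S 0)" using heckeD(4)[OF S ind_subspace(1)] .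
  then have "S 0 = 0" by (simp add: lambda_zero)
  then have "sum F {} \<in> ind \<and> S (sum F {}) = (\<Sum>x\<in>{}. S (F x))" by (simp add: ind_subspace)
  then show ?case .
next
  case (insert x Z)
  then have IH: "sum F Z \<in> ind" "S (sum F Z) = (\<Sum>x\<in>Z. S (F x))" and x: "F x \<in> ind" by auto
  have "sum F (insert x Z) \<in> ind \<and> S (sum F (insert x Z)) = (\<Sum>x\<in>insert x Z. S (F x))"
    unfolding sum.insert[OF insert.hyps] using IH x heckeD(3)[OF S x IH(1)] ind_subspace(2)[OF x IH(1)] by simp
  then show ?case .
qed

lemma hecke_determined_by_delta:
  assumes S: "S \<in> carrier H" and zero: "\<And>v. v \<in> V \<Longrightarrow> S (delta v) = 0" and f: "f \<in> ind"
  shows "S f = 0"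
proof -
  obtain n where n: "f \<in> filt n" using f[unfolded ind_filt] by blast
  let ?N = "coset ` {x\<in>G. deg x \<le> n}" and ?F = "\<lambda>C. right_translate (inv2 (coset_rep C)) (delta (f (coset_rep C)))"
  have rG: "inv2 (coset_rep C) \<in> G" if C: "C \<in> ?N" for C
  proof -
    obtain x where x: "x \<in> G" "C = coset x" using C by blast
    then obtain k where "k \<in> K" "coset_rep C = k ** x" using coset_rep_exists by blast
    then show ?thesis using x by (simp add: SL2_inv2 SL2_mult K_sub_G)
  qed
  have "S (?F C) = 0" if "C \<in> ?N" for C
    using heckeD(5)[OF S rG[OF that] delta_ind, of "f (coset_rep C)"] zero[OF indD(2)[OF f], of "coset_rep C"]
    by (simp add: right_translate_def fun_eq_iff)
  moreover have "S (sum ?F ?N) = (\<Sum>C\<in>?N. S (?F C))"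
    using hecke_sum[OF S finite_cosets, of n ?F] rG by (simp add: right_translate_closed delta_ind)
  ultimately have "S (sum ?F ?N) = 0" by simp
  then show ?thesis using ind_generated[OF n] by simp
qed

lemma hecke_delta_linear:
  assumes S: "S \<in> carrier H"
  shows "linear_on_weight e r (\<lambda>v. S (delta v) g)"
  unfolding linear_on_weight_def delta_add delta_scale heckeD(3)[OF S delta_ind delta_ind] heckeD(4)[OF S delta_ind] by simp

lemma hecke_delta_right:
  assumes S: "S \<in> carrier H" and k: "k \<in> K"
  shows "S (delta (rho k v)) g = S (delta v) (g ** k)"
  using heckeD(5)[OF S K_sub_G[OF k] delta_ind, of v] delta_translate[OF k, of v] by (simp add: right_translate_def)

lemma hecke_delta_left:
  assumes S: "S \<in> carrier H" and k: "k \<in> K"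
  shows "S (delta v) (k ** g) = rho k (S (delta v) g)"
  using indD(3)[OF heckeD(2)[OF S delta_ind] k] .

text \<open>For \<open>n = 0\<close> the map \<open>v \<mapsto> S (delta v) 1\<close> commutes with \<open>K\<close>.  For \<open>n > 0\<close>, moving unipotent elements across
  \<open>torus n\<close> multiplies their parameter by \<open>\<pi>^(2 n)\<close>, after which they act trivially on the weight.  So the value at \<open>torus n\<close> is
  invariant on the left under upper and on the right under lower unipotent elements.\<close>

lemma hecke_leading_scalar:
  assumes S: "S \<in> carrier H"
  shows "\<exists>c. \<forall>v\<in>V. S (delta v) (torus n) = vscale c ((T ^^ n) (delta v) (torus n))"
proof (cases n)
  case 0
  have "\<exists>c. \<forall>v\<in>V. S (delta v) (mat 1) = vscale c v"
  proof (rule vertex_map_scalar[OF hecke_delta_linear[OF S]])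
    show "S (delta v) (mat 1) \<in> V" for v using indD(2)[OF heckeD(2)[OF S delta_ind]] .
    show "S (delta (rho k v)) (mat 1) = rho k (S (delta v) (mat 1))" if "k \<in> K" for k v
      using hecke_delta_right[OF S that, of v "mat 1"] hecke_delta_left[OF S that, of v "mat 1"] by simp
  qed
  then show ?thesis using 0 delta_one by (simp add: torus_0)
next
  case (Suc m)
  have small: "av (\<pi> ^ (2 * n) * b) < 1" if "av b \<le> 1" for b
  proof -
    have "av (\<pi> ^ (2 * n) * b) \<le> av \<pi> ^ (2 * n) * 1"
      unfolding av_mult av_power using that by (intro mult_left_mono) auto
    also have "\<dots> < 1"
    proof -
      have "0 < n" using Suc by simp
      then show ?thesis using uniformizer by (simp add: power_less_one_iff)
    qed
    finally show ?thesis .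
  qed
  have SV: "S (delta v) g \<in> V" for v g using indD(2)[OF heckeD(2)[OF S delta_ind]] .
  have "\<exists>c. \<forall>v\<in>V. S (delta v) (torus n) = vscale (c * v l0) (weight_unit l0)"
  proof (rule edge_map_scalar[OF hecke_delta_linear[OF S] SV])
    fix b :: 'f and v assume b: "av b \<le> 1" and v: "v \<in> V"
    have s: "upper (\<pi> ^ (2 * n) * b) \<in> K" "lower (\<pi> ^ (2 * n) * b) \<in> K"
      using small[OF b] by (simp_all add: upper_K lower_K)
    have "rho (upper b) (S (delta v) (torus n)) = S (delta v) (torus n ** upper (\<pi> ^ (2 * n) * b))"
      using hecke_delta_left[OF S upper_K[OF b], of v "torus n"] by (simp only: upper_torus)
    also have "\<dots> = S (delta v) (torus n)"
      using hecke_delta_right[OF S s(1), of v "torus n"] rho_small_upper[OF small[OF b] v] by simp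
    finally show "rho (upper b) (S (delta v) (torus n)) = S (delta v) (torus n)" .
    have "S (delta (rho (lower b) v)) (torus n) = S (delta v) (lower (\<pi> ^ (2 * n) * b) ** torus n)"
      using hecke_delta_right[OF S lower_K[OF b], of v "torus n"] by (simp only: torus_lower)
    also have "\<dots> = S (delta v) (torus n)"
      using hecke_delta_left[OF S s(2), of v "torus n"] rho_small_lower[OF small[OF b] SV] by simp
    finally show "S (delta (rho (lower b) v)) (torus n) = S (delta v) (torus n)" .
  qed
  then show ?thesis unfolding Suc using Tpow_delta_torus by (simp add: mult.assoc)
qed

text \<open>Subtracting a scalar multiple of \<open>T^n\<close> cancels the values at \<open>torus n\<close>, hence the whole leading part.\<close>

lemma hecke_polynomial_bounded:
  assumes "S \<in> carrier H" "\<And>v. v \<in> V \<Longrightarrow> S (delta v) \<in> filt n"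
  shows "\<exists>a. \<forall>f\<in>ind. S f = T_poly n a f"
  using assms
proof (induction n arbitrary: S)
  case 0
  then have "S f = 0" if "f \<in> ind" for f
    using hecke_determined_by_delta[OF 0(1) _ that] filt_0 by blast
  then show ?case by (simp add: T_poly_0)
next
  case (Suc n)
  note S = Suc.prems(1)
  obtain c where c: "\<And>v. v \<in> V \<Longrightarrow> S (delta v) (torus n) = vscale c ((T ^^ n) (delta v) (torus n))"
    using hecke_leading_scalar[OF S, of n] by blast
  define S' where "S' = (\<lambda>f\<in>ind. S f + fscale (- c) ((T ^^ n) f))"
  have S': "S' \<in> carrier H" unfolding S'_def by (rule hecke_add_Tpow[OF S])
  have "S' (delta v) \<in> filt n" if v: "v \<in> V" for v
  proof (rule filt_eqI)
    have eq: "S' (delta v) = S (delta v) + fscale (- c) ((T ^^ n) (delta v))" for v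
      by (simp add: S'_def delta_ind)
    show "S' (delta v) \<in> filt (Suc n)"
      unfolding eq by (intro filt_subspace Suc.prems(2) v Tpow_delta_filt)
    fix k assume k: "k \<in> K"
    have "S' (delta v) (torus n ** k) = S' (delta (rho k v)) (torus n)"
      using hecke_delta_right[OF S' k] by simp
    also have "\<dots> = 0" unfolding eq using c[OF rho_V] by (simp add: fun_eq_iff)
    finally show "S' (delta v) (torus n ** k) = 0" .
  qed
  then obtain a where a: "\<And>f. f \<in> ind \<Longrightarrow> S' f = T_poly n a f" using Suc.IH[OF S'] by blast
  define a' where "a' = a(n := c)"
  have "S f = T_poly (Suc n) a' f" if f: "f \<in> ind" for f
  proof -
    have "S f = S' f + fscale c ((T ^^ n) f)" using f by (simp add: S'_def fun_eq_iff)
    also have "S' f = T_poly n a' f" unfolding a[OF f] by (rule T_poly_cong) (simp add: a'_def)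
    finally show ?thesis unfolding T_poly_Suc by (simp only: a'_def fun_upd_same)
  qed
  then show ?case by blast
qed

text \<open>The weight is finite dimensional, so a single degree bounds the images of all the generators \<open>delta v\<close>.\<close>

lemma hecke_polynomial:
  assumes S: "S \<in> carrier H"
  shows "\<exists>n a. \<forall>f\<in>ind. S f = T_poly n a f"
proof -
  have "\<exists>n. S (delta (weight_unit l)) \<in> filt n" for l
    using heckeD(2)[OF S delta_ind[of "weight_unit l"], unfolded ind_filt] by blast
  then obtain n where n: "\<And>l. S (delta (weight_unit l)) \<in> filt (n l)" by metis
  define N where "N = Max (n ` index)"
  have "S (delta v) \<in> filt N" if v: "v \<in> V" for v
  proof -
    have "deg g < N" if "S (delta v) g \<noteq> 0" for g
    proof (rule ccontr)
      assume "\<not> deg g < N"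
      moreover have "n l \<le> N" if "l \<in> index" for l using that by (simp add: N_def)
      ultimately have "S (delta (weight_unit l)) g = 0" if "l \<in> index" for l
        using filt_bound[OF n, of l g] that by (meson le_trans not_less)
      then have "S (delta v) g j = 0" for j
        using linear_on_weight_expand[OF hecke_delta_linear[OF S] v, of g j] by simp
      then show False using that by (simp add: fun_eq_iff)
    qed
    then show ?thesis using heckeD(2)[OF S delta_ind] unfolding filt_def by blast
  qed
  then show ?thesis using hecke_polynomial_bounded[OF S] by blast
qed

text \<open>The section supported at the vertex of \<open>torus (n + 1)\<close> is not a leading part of an element of the image of \<open>T\<close>, since
  these have equal values at all vertices that are reached from the same neighbour through the same vertex of the
  other type.\<close>

lemma not_descent: "\<exists>f\<in>filt (Suc (Suc n)). f \<notin> SF.descent (Suc n)"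
proof
  let ?N = "Suc n" and ?u = "weight_unit l0"
  define d where "d = right_translate (inv2 (torus ?N)) (delta ?u)"
  show "d \<in> filt (Suc (Suc n))"
    using right_translate_ind[OF delta_filt SL2_inv2[OF torus_G], of ?N ?u] by (simp add: d_def deg_inv2 deg_torus)
  show "d \<notin> SF.descent ?N"
  proof
    assume "d \<in> SF.descent ?N"
    then obtain x y where xy: "x \<in> filt ?N" "y \<in> filt ?N" "d = x + T y" unfolding SF.descent_def by blast
    have val: "d (torus ?N ** k) = vscale (y (torus n ** k) l0) ?u" if k: "k \<in> K" for k
    proof -
      have "deg (torus ?N ** k) = ?N" using deg_K_right[OF k] by (simp add: deg_torus)
      then have "x (torus ?N ** k) = 0" using filt_bound[OF xy(1)] by simp
      then show ?thesis using xy(3) T_outermost[OF xy(2) k] by simp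
    qed
    have one: "d (torus ?N ** mat 1) = ?u"
      using torus_G[of ?N] by (simp add: d_def right_translate_def inv2_right delta_one)
    \<comment> \<open>conjugated by \<open>torus n\<close> it becomes \<open>upper \<pi>\<close>, which lies in \<open>K\<close> and acts trivially on the weight; conjugated
      by \<open>torus (n + 1)\<close> it becomes \<open>upper (1 / \<pi>)\<close>, which does not lie in \<open>K\<close>\<close>
    let ?k = "upper (\<pi> ^ (2 * n) * \<pi>)"
    have k: "?k \<in> K" using av_le_1_mult[OF av_pi_power_le_1[of "2 * n"], of \<pi>] uniformizer(2) by (intro upper_K) simp
    have "y (torus n ** ?k) = rho (upper \<pi>) (y (torus n))"
      using indD(3)[OF filt_ind[OF xy(2)] upper_K[of \<pi>], of "torus n"] uniformizer(2) by (simp add: upper_torus)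
    also have "\<dots> = y (torus n)"
      using uniformizer(2) indD(2)[OF filt_ind[OF xy(2)]] by (intro rho_small_upper)
    finally have "d (torus ?N ** ?k) = d (torus ?N ** mat 1)" using val[OF k] val[OF K_one] by simp
    then have "d (torus ?N ** ?k) = ?u" using one by simp
    moreover have "torus ?N ** ?k ** inv2 (torus ?N) \<notin> K"
    proof -
      have "(torus ?N ** ?k ** inv2 (torus ?N)) $ 1 $ 2 = inverse \<pi>"
        by (simp add: matrix_mult_2 inv2_def field_simps power_mult power2_eq_square power_mult_distrib)
      moreover have "av (inverse \<pi>) > 1" using uniformizer one_less_inverse[of "av \<pi>"] by (simp add: av_inverse)
      ultimately show ?thesis by (auto simp: SL2_iff)
    qed
    then have "d (torus ?N ** ?k) = 0" by (simp add: d_def right_translate_def delta_def)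
    ultimately have "?u l0 = (0 :: 'k)" by (simp add: fun_eq_iff)
    then show False by (simp add: weight_unit_apply)
  qed
qed

lemma infinite_basis: "infinite SF.free_basis"
  using SF.infinite_free_basis not_descent by blast

end

section \<open>The module over the Hecke algebra\<close>

context weight_setting
begin

abbreviation "E \<equiv> evaluation_module ind"

lemma module_simps [simp]:
  "carrier E = ind" "ring.zero E = 0" "add E = (+)" "module.smult E = (\<lambda>S f. S f)"
  by (simp_all add: evaluation_module_def fun_eq_iff)

lemma hecke_simps [simp]:
  "monoid.mult H = (\<lambda>S S'. compose ind S S')" "one H = (\<lambda>f\<in>ind. f)"
  "ring.zero H = (\<lambda>f\<in>ind. 0)" "add H = (\<lambda>S S'. \<lambda>f\<in>ind. S f + S' f)"
  by (simp_all add: hecke_algebra_def End_ring_def fun_eq_iff restrict_def)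

lemma hecke_eqI:
  assumes "S \<in> carrier H" "S' \<in> carrier H" "\<And>f. f \<in> ind \<Longrightarrow> S f = S' f"
  shows "S = S'"
  using heckeD(1)[OF assms(1)] heckeD(1)[OF assms(2)] assms(3) by (rule extensionalityI)

lemma hecke_add:
  assumes S: "S \<in> carrier H" "S' \<in> carrier H"
  shows "(\<lambda>f\<in>ind. S f + S' f) \<in> carrier H"
proof (rule heckeI)
  fix f assume f: "f \<in> ind"
  show "S f + S' f \<in> ind" using heckeD(2)[OF S(1) f] heckeD(2)[OF S(2) f] by (rule ind_subspace)
  show "S (fscale c f) + S' (fscale c f) = fscale c (S f + S' f)" for c
    unfolding heckeD(4)[OF S(1) f] heckeD(4)[OF S(2) f] by (simp add: fun_eq_iff algebra_simps)
  show "S (f + f') + S' (f + f') = (S f + S' f) + (S f' + S' f')" if "f' \<in> ind" for f'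
    unfolding heckeD(3)[OF S(1) f that] heckeD(3)[OF S(2) f that] by (simp add: fun_eq_iff algebra_simps)
  show "S (right_translate g f) + S' (right_translate g f) = right_translate g (S f + S' f)" if "g \<in> G" for g
    unfolding heckeD(5)[OF S(1) that f] heckeD(5)[OF S(2) that f] by (simp add: fun_eq_iff right_translate_def)
qed

lemma hecke_compose:
  assumes S: "S \<in> carrier H" "S' \<in> carrier H"
  shows "compose ind S S' \<in> carrier H"
  unfolding compose_def
proof (rule heckeI)
  fix f assume f: "f \<in> ind"
  note f' = heckeD(2)[OF S(2) f]
  show "S (S' f) \<in> ind" using heckeD(2)[OF S(1) f'] .
  show "S (S' (fscale c f)) = fscale c (S (S' f))" for c
    unfolding heckeD(4)[OF S(2) f] by (rule heckeD(4)[OF S(1) f'])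
  show "S (S' (f + g)) = S (S' f) + S (S' g)" if "g \<in> ind" for g
    unfolding heckeD(3)[OF S(2) f that] by (rule heckeD(3)[OF S(1) f' heckeD(2)[OF S(2) that]])
  show "S (S' (right_translate g f)) = right_translate g (S (S' f))" if "g \<in> G" for g
    unfolding heckeD(5)[OF S(2) that f] by (rule heckeD(5)[OF S(1) that f'])
qed

lemma hecke_neg:
  assumes S: "S \<in> carrier H"
  shows "(\<lambda>f\<in>ind. fscale (- 1) (S f)) \<in> carrier H"
proof (rule heckeI)
  fix f assume f: "f \<in> ind"
  show "fscale (- 1) (S f) \<in> ind" using heckeD(2)[OF S f] by (rule ind_subspace)
  show "fscale (- 1) (S (fscale c f)) = fscale c (fscale (- 1) (S f))" for c
    unfolding heckeD(4)[OF S f] by (simp add: fun_eq_iff)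
  show "fscale (- 1) (S (f + f')) = fscale (- 1) (S f) + fscale (- 1) (S f')" if "f' \<in> ind" for f'
    unfolding heckeD(3)[OF S f that] by (simp add: fun_eq_iff)
  show "fscale (- 1) (S (right_translate g f)) = right_translate g (fscale (- 1) (S f))" if "g \<in> G" for g
    unfolding heckeD(5)[OF S that f] by (simp add: fun_eq_iff right_translate_def)
qed

lemma hecke_one: "(\<lambda>f\<in>ind. f) \<in> carrier H"
  by (rule heckeI) simp_all

lemma hecke_ring: "ring H"
proof (rule ringI)
  show "abelian_group H"
  proof (rule abelian_groupI)
    fix S assume S: "S \<in> carrier H"
    show "\<exists>S'\<in>carrier H. S' \<oplus>\<^bsub>H\<^esub> S = \<zero>\<^bsub>H\<^esub>"
    proof (rule bexI[OF _ hecke_neg[OF S]])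
      show "(\<lambda>f\<in>ind. fscale (- 1) (S f)) \<oplus>\<^bsub>H\<^esub> S = \<zero>\<^bsub>H\<^esub>"
        unfolding hecke_simps by (rule restrict_ext) (simp add: fun_eq_iff)
    qed
    show "\<zero>\<^bsub>H\<^esub> \<oplus>\<^bsub>H\<^esub> S = S"
      unfolding hecke_simps by (rule hecke_eqI[OF hecke_add[OF hecke_zero S] S]) simp
  next
    fix S1 S2 assume "S1 \<in> carrier H" "S2 \<in> carrier H"
    then show "S1 \<oplus>\<^bsub>H\<^esub> S2 \<in> carrier H" unfolding hecke_simps by (rule hecke_add)
    show "S1 \<oplus>\<^bsub>H\<^esub> S2 = S2 \<oplus>\<^bsub>H\<^esub> S1"
      unfolding hecke_simps by (rule restrict_ext) (rule add.commute)
  next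
    show "\<zero>\<^bsub>H\<^esub> \<in> carrier H" unfolding hecke_simps by (rule hecke_zero)
  next
    fix S1 S2 S3 :: "('f^2^2 \<Rightarrow> (nat \<Rightarrow> nat) \<Rightarrow> 'k) \<Rightarrow> _"
    show "S1 \<oplus>\<^bsub>H\<^esub> S2 \<oplus>\<^bsub>H\<^esub> S3 = S1 \<oplus>\<^bsub>H\<^esub> (S2 \<oplus>\<^bsub>H\<^esub> S3)"
      unfolding hecke_simps by (rule restrict_ext) (simp only: restrict_apply if_True add.assoc)
  qed
  show "monoid H"
  proof (rule monoidI)
    fix S1 S2 assume "S1 \<in> carrier H" "S2 \<in> carrier H"
    then show "S1 \<otimes>\<^bsub>H\<^esub> S2 \<in> carrier H" unfolding hecke_simps by (rule hecke_compose)
  next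
    show "\<one>\<^bsub>H\<^esub> \<in> carrier H" unfolding hecke_simps by (rule hecke_one)
  next
    fix S1 S2 S3 assume S: "S1 \<in> carrier H" "S2 \<in> carrier H" "S3 \<in> carrier H"
    show "S1 \<otimes>\<^bsub>H\<^esub> S2 \<otimes>\<^bsub>H\<^esub> S3 = S1 \<otimes>\<^bsub>H\<^esub> (S2 \<otimes>\<^bsub>H\<^esub> S3)"
      unfolding hecke_simps compose_def
      by (rule restrict_ext) (simp only: restrict_apply if_True heckeD(2)[OF S(3)])
  next
    fix S assume S: "S \<in> carrier H"
    show "\<one>\<^bsub>H\<^esub> \<otimes>\<^bsub>H\<^esub> S = S"
      unfolding hecke_simps
      by (rule hecke_eqI[OF hecke_compose[OF hecke_one S] S]) (simp add: compose_def heckeD(2)[OF S])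
    show "S \<otimes>\<^bsub>H\<^esub> \<one>\<^bsub>H\<^esub> = S"
      unfolding hecke_simps
      by (rule hecke_eqI[OF hecke_compose[OF S hecke_one] S]) (simp add: compose_def)
  qed
next
  fix S1 S2 S3 assume S: "S1 \<in> carrier H" "S2 \<in> carrier H" "S3 \<in> carrier H"
  show "(S1 \<oplus>\<^bsub>H\<^esub> S2) \<otimes>\<^bsub>H\<^esub> S3 = S1 \<otimes>\<^bsub>H\<^esub> S3 \<oplus>\<^bsub>H\<^esub> S2 \<otimes>\<^bsub>H\<^esub> S3"
    unfolding hecke_simps compose_def
    by (rule restrict_ext) (simp only: restrict_apply if_True heckeD(2)[OF S(3)])
  show "S3 \<otimes>\<^bsub>H\<^esub> (S1 \<oplus>\<^bsub>H\<^esub> S2) = S3 \<otimes>\<^bsub>H\<^esub> S1 \<oplus>\<^bsub>H\<^esub> S3 \<otimes>\<^bsub>H\<^esub> S2"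
    unfolding hecke_simps compose_def
    by (rule restrict_ext) (simp only: restrict_apply if_True heckeD(3)[OF S(3)] heckeD(2)[OF S(1)] heckeD(2)[OF S(2)])
qed

lemma module_group: "abelian_group E"
proof (rule abelian_groupI)
  fix f assume f: "f \<in> carrier E"
  show "\<exists>f'\<in>carrier E. f' \<oplus>\<^bsub>E\<^esub> f = \<zero>\<^bsub>E\<^esub>"
    unfolding module_simps
  proof (rule bexI)
    show "fscale (- 1) f + f = 0" by (simp add: fun_eq_iff)
    show "fscale (- 1) f \<in> ind" using f unfolding module_simps by (rule ind_subspace)
  qed
qed (simp_all only: module_simps ind_subspace add_ac add_0_left add_0_right)

lemma evaluation_left_module: "left_module H E"
proof (intro left_module.intro left_module_axioms.intro hecke_ring module_group)
  fix S f assume S: "S \<in> carrier H" and "f \<in> carrier E"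
  then have f: "f \<in> ind" by simp
  show "S \<odot>\<^bsub>E\<^esub> f \<in> carrier E" using heckeD(2)[OF S f] by simp
  show "S \<odot>\<^bsub>E\<^esub> (f \<oplus>\<^bsub>E\<^esub> f') = S \<odot>\<^bsub>E\<^esub> f \<oplus>\<^bsub>E\<^esub> S \<odot>\<^bsub>E\<^esub> f'" if "f' \<in> carrier E" for f'
    using heckeD(3)[OF S f] that by (simp only: module_simps)
  fix S' assume S': "S' \<in> carrier H"
  show "(S \<oplus>\<^bsub>H\<^esub> S') \<odot>\<^bsub>E\<^esub> f = S \<odot>\<^bsub>E\<^esub> f \<oplus>\<^bsub>E\<^esub> S' \<odot>\<^bsub>E\<^esub> f"
    using f by (simp only: module_simps hecke_simps restrict_apply if_True)
  show "(S \<otimes>\<^bsub>H\<^esub> S') \<odot>\<^bsub>E\<^esub> f = S \<odot>\<^bsub>E\<^esub> (S' \<odot>\<^bsub>E\<^esub> f)"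
    using f by (simp only: module_simps hecke_simps compose_def restrict_apply if_True)
next
  fix f assume "f \<in> carrier E"
  then show "\<one>\<^bsub>H\<^esub> \<odot>\<^bsub>E\<^esub> f = f" by (simp only: module_simps hecke_simps restrict_apply if_True)
qed

lemma finsum_evaluation:
  assumes "finite Z" "\<And>x. x \<in> Z \<Longrightarrow> F x \<in> ind"
  shows "(\<Oplus>\<^bsub>E\<^esub>x\<in>Z. F x) = (\<Sum>x\<in>Z. F x)"
  using assms
proof (induction Z rule: finite_induct)
  interpret E: abelian_group E by (rule module_group)
  case empty
  have "(\<Oplus>\<^bsub>E\<^esub>x\<in>{}. F x) = (\<Sum>x\<in>{}. F x)" by (simp only: E.finsum_empty module_simps sum.empty)
  then show ?case .
next
  interpret E: abelian_group E by (rule module_group)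
  case (insert x Z)
  have "(\<Oplus>\<^bsub>E\<^esub>x\<in>insert x Z. F x) = F x \<oplus>\<^bsub>E\<^esub> (\<Oplus>\<^bsub>E\<^esub>x\<in>Z. F x)"
    using insert by (intro E.finsum_insert) auto
  also have "(\<Oplus>\<^bsub>E\<^esub>x\<in>Z. F x) = (\<Sum>x\<in>Z. F x)" using insert by blast
  also have "F x \<oplus>\<^bsub>E\<^esub> (\<Sum>x\<in>Z. F x) = (\<Sum>x\<in>insert x Z. F x)"
    unfolding sum.insert[OF insert.hyps] module_simps ..
  finally show ?case .
qed

lemma free_basis_ind: "b \<in> SF.free_basis \<Longrightarrow> b \<in> ind"
  using SF.free_basis_subset unfolding ind_filt by blast

lemma T_poly_extend:
  assumes "n \<le> N"
  shows "T_poly n a f = T_poly N (\<lambda>m. if m < n then a m else 0) f"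
proof -
  have "(\<Sum>m<n. a m * (T ^^ m) f g i) = (\<Sum>m<N. (if m < n then a m else 0) * (T ^^ m) f g i)" for g i
    using assms by (intro sum.mono_neutral_cong_left) auto
  then show ?thesis by (simp add: fun_eq_iff T_poly_apply)
qed

text \<open>Coefficients in the Hecke algebra are the same as polynomials in \<open>T\<close>, for which \<open>strict_filtration\<close> gives spanning
  and independence.\<close>

lemma free_basis_module_basis: "module_basis H E SF.free_basis"
  unfolding module_basis_def
proof (intro conjI ballI allI impI)
  show "SF.free_basis \<subseteq> carrier E" using free_basis_ind by (simp add: subset_iff)
next
  fix x assume "x \<in> carrier E"
  then have "x \<in> ind" by simp
  then obtain n where n: "x \<in> filt n" unfolding ind_filt by (elim UN_E)
  from SF.free_basis_spans[OF n] obtain S N a where S: "finite S" "S \<subseteq> SF.free_basis"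
    and x: "x = (\<Sum>b\<in>S. \<Sum>m<N. fscale (a b m) ((T ^^ m) b))"
    by (elim exE conjE)
  define c where "c b = (\<lambda>f\<in>ind. T_poly N (a b) f)" for b
  have cH: "c b \<in> carrier H" for b unfolding c_def by (rule T_poly_hecke)
  have cb: "c b b = T_poly N (a b) b" if "b \<in> S" for b
    using free_basis_ind that S(2) by (auto simp: c_def)
  have "(\<Oplus>\<^bsub>E\<^esub>b\<in>S. c b \<odot>\<^bsub>E\<^esub> b) = (\<Oplus>\<^bsub>E\<^esub>b\<in>S. c b b)" by simp
  also have "\<dots> = (\<Sum>b\<in>S. c b b)"
    using S free_basis_ind heckeD(2)[OF cH] by (intro finsum_evaluation) auto
  also have "\<dots> = x" unfolding x by (rule sum.cong[OF refl]) (simp only: cb T_poly_def)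
  finally show "\<exists>S c. finite S \<and> S \<subseteq> SF.free_basis \<and> c \<in> S \<rightarrow> carrier H \<and> x = (\<Oplus>\<^bsub>E\<^esub>b\<in>S. c b \<odot>\<^bsub>E\<^esub> b)"
    using S cH by (intro exI[of _ S] exI[of _ c]) auto
next
  fix S c b
  assume S: "finite S" "S \<subseteq> SF.free_basis" and c: "c \<in> S \<rightarrow> carrier H"
    and zero: "(\<Oplus>\<^bsub>E\<^esub>b\<in>S. c b \<odot>\<^bsub>E\<^esub> b) = \<zero>\<^bsub>E\<^esub>" and b: "b \<in> S"
  have cH: "c b \<in> carrier H" if "b \<in> S" for b using c that by blast
  have "\<forall>b\<in>S. \<exists>n a. \<forall>f\<in>ind. c b f = T_poly n a f" using hecke_polynomial cH by blast
  then obtain n a where na: "\<And>b f. b \<in> S \<Longrightarrow> f \<in> ind \<Longrightarrow> c b f = T_poly (n b) (a b) f" by metis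
  define N where "N = Max (n ` S)"
  define a' where "a' b m = (if m < n b then a b m else 0)" for b m
  have poly: "c b f = T_poly N (a' b) f" if "b \<in> S" "f \<in> ind" for b f
  proof -
    have "n b \<le> N" using that(1) S(1) by (simp add: N_def)
    moreover have "a' b = (\<lambda>m. if m < n b then a b m else 0)" by (rule ext) (simp add: a'_def)
    ultimately show ?thesis using na[OF that] T_poly_extend[of "n b" N "a b" f] by (simp only:)
  qed
  have bI: "b \<in> ind" if "b \<in> S" for b using free_basis_ind that S(2) by blast
  have "(\<Sum>b\<in>S. \<Sum>m<N. fscale (a' b m) ((T ^^ m) b)) = (\<Sum>b\<in>S. c b b)"
    by (rule sum.cong[OF refl]) (simp only: poly bI T_poly_def)
  also have "\<dots> = (\<Oplus>\<^bsub>E\<^esub>b\<in>S. c b b)"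
    using heckeD(2)[OF cH bI] S(1) by (intro finsum_evaluation[symmetric]) auto
  also have "\<dots> = 0" using zero by simp
  finally have "a' b m = 0" if "m < N" for m
    using SF.free_basis_independent[OF S _ b that] by blast
  then have "T_poly N (a' b) f = T_poly 0 (a' b) f" for f
    unfolding T_poly_def by (auto simp: fun_eq_iff sum_fun_apply)
  then have "c b f = 0" if "f \<in> ind" for f using poly[OF b that] T_poly_0 by metis
  then have "c b = (\<lambda>f\<in>ind. 0)"
    by (intro hecke_eqI[OF cH[OF b] hecke_zero]) simp
  then show "c b = \<zero>\<^bsub>H\<^esub>" by simp
qed

lemma free: "free_of_infinite_rank H E"
  unfolding free_of_infinite_rank_def
  using evaluation_left_module free_basis_module_basis infinite_basis by blast

end

theorem theorem1p1:
  fixes av :: "'f::field \<Rightarrow> real"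
    and \<iota> :: "'f set \<Rightarrow> 'k::field"
    and p e :: nat
    and r :: "nat \<Rightarrow> nat"
  assumes "Factorial_Ring.prime p"
    and "nonarch_local_field av"
    and "card (carrier (residue_field av)) = p ^ e"
    and "CHAR('k) = p"
    and "algebraic_closure (ring_of_type_algebra :: 'k ring) (range of_nat)"
    and "\<iota> \<in> ring_hom (residue_field av) (ring_of_type_algebra :: 'k ring)"
    and "\<forall>i<e. r i \<le> p - 1"
  shows "free_of_infinite_rank (hecke_algebra av \<iota> p e r)
           (evaluation_module (ind_weight av \<iota> p e r))"
proof -
  interpret nonarch_local_field av by fact
  obtain \<pi> where \<pi>: "0 < av \<pi>" "av \<pi> < 1" "\<And>x. av x < 1 \<Longrightarrow> av x \<le> av \<pi>"
    using uniformizer_exists by blast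
  have "r i < p" if "i < e" for i
    using assms(7) that prime_gt_0_nat[OF assms(1)] by (metis Suc_pred' less_Suc_eq_le)
  then interpret weight_setting av \<pi> \<iota> p e r
    using \<pi> assms by unfold_locales
  show ?thesis by (rule free)
qed

end
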